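(* Let $\Bbbk=\mathbb F_3[t_1,t_2,t_3,t_4]/(t_1^2,t_2^2,t_3^2,t_4^2)$, let $M=\Bbbk^4/\langle t_1e_1+t_2e_2+t_3e_3+t_4e_4\rangle$, where $e_1,\dots,e_4$ is the standard basis of $\Bbbk^4$, and let $\mathfrak g=\mathcal F(M)$ be the free Lie algebra over $\Bbbk$ on the $\Bbbk$-module $M$. Then $$H^{\mathsf{CE}}_3(\mathfrak g)\neq 0\qquad\text{and}\qquad H^{\mathsf{RS}}_3(\mathfrak g)=0.$$
   Context: Lie algebras over $\Bbbk$ have alternating bracket. $\mathcal F$ is the left adjoint of the forgetful functor from Lie algebras over $\Bbbk$ to $\Bbbk$-modules. $H^{\mathsf{CE}}_n(\mathfrak g)=H_n(\mathsf{CE}_\bullet(\mathfrak g))$, where $\mathsf{CE}_n(\mathfrak g)=\Lambda^n_\Bbbk\mathfrak g$ and $\partial(x_1\wedge\dots\wedge x_n)=\sum_{i<j}(-1)^{i+j}[x_i,x_j]\wedge x_1\wedge\dots\wedge\hat x_i\wedge\dots\wedge\hat x_j\wedge\dots\wedge x_n$. Relative simplicial homology: $H^{\mathsf{RS}}_{n+1}(\mathfrak g)=L^{\mathcal G^{\mathsf M}}_n\mathsf{ab}(\mathfrak g)$ for $n\ge0$, where $\mathsf{ab}(\mathfrak g)=\mathfrak g/[\mathfrak g,\mathfrak g]$ and $\mathcal G^{\mathsf M}$ is the comonad (counit $\varepsilon$) on the category of Lie algebras over $\Bbbk$ of the free-forgetful adjunction with $\Bbbk$-modules. Here $L^{\mathcal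 G}_n\Phi(c)$ denotes the $n$-th homology of the (alternating-sum) chain complex of the simplicial object $[n]\mapsto\Phi(\mathcal G^{n+1}c)$ with faces $d_i=\Phi(\mathcal G^i\varepsilon\mathcal G^{n-i})$. *)

theory Defs
  imports
    "HOL-Algebra.Module"
    "HOL-Algebra.QuotRing"
    "HOL-Library.Poly_Mapping"
    "HOL-Library.Numeral_Type"
begin

section \<open>Modules\<close>

definition lin_hom ::
    "('k, 'r) ring_scheme \<Rightarrow> ('k, 'a, 'm) module_scheme \<Rightarrow> ('k, 'b, 'n) module_scheme \<Rightarrow> ('a \<Rightarrow> 'b) set"
  where "lin_hom R M N = {h \<in> carrier M \<rightarrow> carrier N.
    (\<forall>x\<in>carrier M. \<forall>y\<in>carrier M. h (x \<oplus>\<^bsub>M\<^esub> y) = h x \<oplus>\<^bsub>N\<^esub> h y) \<and>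
    (\<forall>r\<in>carrier R. \<forall>x\<in>carrier M. h (r \<odot>\<^bsub>M\<^esub> x) = r \<odot>\<^bsub>N\<^esub> h x)}"

definition mod_span :: "('k, 'r) ring_scheme \<Rightarrow> ('k, 'a, 'm) module_scheme \<Rightarrow> 'a set \<Rightarrow> 'a set"
  where "mod_span R M S = \<Inter>{N. submodule N R M \<and> S \<subseteq> N}"

text \<open>In every module below, the inherited record fields \<^const>\<open>mult\<close> and \<^const>\<open>one\<close> are
  meaningless; \<^locale>\<open>module\<close> does not refer to them.\<close>

definition quot_module :: "('k, 'a, 'm) module_scheme \<Rightarrow> 'a set \<Rightarrow> ('k, 'a set) module"
  where "quot_module M N =
    \<lparr>carrier = a_rcosets\<^bsub>M\<^esub> N, mult = (\<lambda>_ _. undefined), one = undefined,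
      zero = N, add = set_add M,
      smult = (\<lambda>r A. \<Union>x\<in>A. N +>\<^bsub>M\<^esub> (r \<odot>\<^bsub>M\<^esub> x))\<rparr>"

definition free_module :: "('k, 'r) ring_scheme \<Rightarrow> 'i set \<Rightarrow> ('k, 'i \<Rightarrow> 'k) module"
  where "free_module R S =
    \<lparr>carrier = {v. (\<forall>i. v i \<in> carrier R) \<and> (\<forall>i. i \<notin> S \<longrightarrow> v i = \<zero>\<^bsub>R\<^esub>) \<and> finite {i. v i \<noteq> \<zero>\<^bsub>R\<^esub>}},
      mult = (\<lambda>_ _. undefined), one = undefined,
      zero = (\<lambda>_. \<zero>\<^bsub>R\<^esub>), add = (\<lambda>v w i. v i \<oplus>\<^bsub>R\<^esub> w i),
      smult = (\<lambda>r v i. r \<otimes>\<^bsub>R\<^esub> v i)\<rparr>"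

definition basis_vec :: "('k, 'r) ring_scheme \<Rightarrow> 'i \<Rightarrow> ('i \<Rightarrow> 'k)"
  where "basis_vec R i = (\<lambda>j. if j = i then \<one>\<^bsub>R\<^esub> else \<zero>\<^bsub>R\<^esub>)"

definition alt_sign :: "('k, 'a, 'm) module_scheme \<Rightarrow> nat \<Rightarrow> 'a \<Rightarrow> 'a"
  where "alt_sign M n x = (if even n then x else \<ominus>\<^bsub>M\<^esub> x)"


section \<open>Homology of chain complexes\<close>

text \<open>A chain complex in nonnegative degrees is given by its terms \<open>C n\<close> and its differentials
  \<open>d n\<close> from \<open>C n\<close> to \<open>C (n - 1)\<close> for \<open>n \<ge> 1\<close>; the value of \<open>d 0\<close> is never used.\<close>

definition cycles :: "(nat \<Rightarrow> ('k, 'a) module) \<Rightarrow> (nat \<Rightarrow> 'a \<Rightarrow> 'a) \<Rightarrow> nat \<Rightarrow> 'a set"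
  where "cycles C d n = {x \<in> carrier (C n). n = 0 \<or> d n x = \<zero>\<^bsub>C (n - 1)\<^esub>}"

definition boundaries :: "(nat \<Rightarrow> ('k, 'a) module) \<Rightarrow> (nat \<Rightarrow> 'a \<Rightarrow> 'a) \<Rightarrow> nat \<Rightarrow> 'a set"
  where "boundaries C d n = d (Suc n) ` carrier (C (Suc n))"

definition homology ::
    "(nat \<Rightarrow> ('k, 'a) module) \<Rightarrow> (nat \<Rightarrow> 'a \<Rightarrow> 'a) \<Rightarrow> nat \<Rightarrow> ('k, 'a set) module"
  where "homology C d n = quot_module ((C n)\<lparr>carrier := cycles C d n\<rparr>) (boundaries C d n)"


section \<open>Lie algebras\<close>

record ('k, 'a) lie = "('k, 'a) module" +
  bracket :: "'a \<Rightarrow> 'a \<Rightarrow> 'a"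

locale lie_algebra = module R L for R and L :: "('k, 'a, 'm) lie_scheme" (structure) +
  assumes bracket_closed: "\<lbrakk>x \<in> carrier L; y \<in> carrier L\<rbrakk> \<Longrightarrow> bracket L x y \<in> carrier L"
    and bracket_add_left: "\<lbrakk>x \<in> carrier L; y \<in> carrier L; z \<in> carrier L\<rbrakk>
      \<Longrightarrow> bracket L (x \<oplus> y) z = bracket L x z \<oplus> bracket L y z"
    and bracket_add_right: "\<lbrakk>x \<in> carrier L; y \<in> carrier L; z \<in> carrier L\<rbrakk>
      \<Longrightarrow> bracket L z (x \<oplus> y) = bracket L z x \<oplus> bracket L z y"
    and bracket_smult_left: "\<lbrakk>r \<in> carrier R; x \<in> carrier L; y \<in> carrier L\<rbrakk>
      \<Longrightarrow> bracket L (r \<odot> x) y = r \<odot> bracket L x y"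
    and bracket_smult_right: "\<lbrakk>r \<in> carrier R; x \<in> carrier L; y \<in> carrier L\<rbrakk>
      \<Longrightarrow> bracket L x (r \<odot> y) = r \<odot> bracket L x y"
    and bracket_self: "x \<in> carrier L \<Longrightarrow> bracket L x x = \<zero>"
    and jacobi: "\<lbrakk>x \<in> carrier L; y \<in> carrier L; z \<in> carrier L\<rbrakk>
      \<Longrightarrow> bracket L x (bracket L y z) \<oplus> (bracket L y (bracket L z x) \<oplus> bracket L z (bracket L x y)) = \<zero>"

definition lie_hom ::
    "('k, 'r) ring_scheme \<Rightarrow> ('k, 'a, 'm) lie_scheme \<Rightarrow> ('k, 'b, 'n) lie_scheme \<Rightarrow> ('a \<Rightarrow> 'b) set"
  where "lie_hom R L L' = {h \<in> lin_hom R L L'.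
    \<forall>x\<in>carrier L. \<forall>y\<in>carrier L. h (bracket L x y) = bracket L' (h x) (h y)}"


subsection \<open>Chevalley--Eilenberg homology\<close>

text \<open>The \<open>n\<close>-th exterior power is the free module on \<open>n\<close>-tuples modulo the relations making
  the class of a tuple multilinear and alternating.\<close>

definition tuples :: "('k, 'a, 'm) module_scheme \<Rightarrow> nat \<Rightarrow> 'a list set"
  where "tuples M n = {xs. length xs = n \<and> set xs \<subseteq> carrier M}"

definition ext_relations ::
    "('k, 'r) ring_scheme \<Rightarrow> ('k, 'a, 'm) module_scheme \<Rightarrow> nat \<Rightarrow> ('a list \<Rightarrow> 'k) set"
  where "ext_relations R M n = (let V = free_module R (tuples M n); e = basis_vec R in
    {e (xs[i := x \<oplus>\<^bsub>M\<^esub> y]) \<ominus>\<^bsub>V\<^esub> (e (xs[i := x]) \<oplus>\<^bsub>V\<^esub> e (xs[i := y])) | xs i x y.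
       xs \<in> tuples M n \<and> i < n \<and> x \<in> carrier M \<and> y \<in> carrier M} \<union>
    {e (xs[i := r \<odot>\<^bsub>M\<^esub> x]) \<ominus>\<^bsub>V\<^esub> (r \<odot>\<^bsub>V\<^esub> e (xs[i := x])) | xs i r x.
       xs \<in> tuples M n \<and> i < n \<and> r \<in> carrier R \<and> x \<in> carrier M} \<union>
    {e xs | xs i j. xs \<in> tuples M n \<and> i < j \<and> j < n \<and> xs ! i = xs ! j})"

definition ext_null ::
    "('k, 'r) ring_scheme \<Rightarrow> ('k, 'a, 'm) module_scheme \<Rightarrow> nat \<Rightarrow> ('a list \<Rightarrow> 'k) set"
  where "ext_null R M n = mod_span R (free_module R (tuples M n)) (ext_relations R M n)"

definition ext_power ::
    "('k, 'r) ring_scheme \<Rightarrow> ('k, 'a, 'm) module_scheme \<Rightarrow> nat \<Rightarrow> ('k, ('a list \<Rightarrow> 'k) set) module"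
  where "ext_power R M n = quot_module (free_module R (tuples M n)) (ext_null R M n)"

definition wedge ::
    "('k, 'r) ring_scheme \<Rightarrow> ('k, 'a, 'm) module_scheme \<Rightarrow> 'a list \<Rightarrow> ('a list \<Rightarrow> 'k) set"
  where "wedge R M xs =
    ext_null R M (length xs) +>\<^bsub>free_module R (tuples M (length xs))\<^esub> basis_vec R xs"

text \<open>Positions in a list are counted from 0, which does not affect the parity of \<open>i + j\<close>.\<close>

definition ce_wedge_diff ::
    "('k, 'r) ring_scheme \<Rightarrow> ('k, 'a, 'm) lie_scheme \<Rightarrow> nat \<Rightarrow> 'a list \<Rightarrow> ('a list \<Rightarrow> 'k) set"
  where "ce_wedge_diff R L n xs =
    (\<Oplus>\<^bsub>ext_power R L (n - 1)\<^esub> j \<in> {..<n}. \<Oplus>\<^bsub>ext_power R L (n - 1)\<^esub> i \<in> {..<j}.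
      alt_sign (ext_power R L (n - 1)) (i + j)
        (wedge R L (bracket L (xs ! i) (xs ! j) # nths xs (- {i, j}))))"

definition ce_diff ::
    "('k, 'r) ring_scheme \<Rightarrow> ('k, 'a, 'm) lie_scheme \<Rightarrow> nat \<Rightarrow>
     ('a list \<Rightarrow> 'k) set \<Rightarrow> ('a list \<Rightarrow> 'k) set"
  where "ce_diff R L n A = the_elem ((\<lambda>v. \<Oplus>\<^bsub>ext_power R L (n - 1)\<^esub> xs \<in> {xs. v xs \<noteq> \<zero>\<^bsub>R\<^esub>}.
      v xs \<odot>\<^bsub>ext_power R L (n - 1)\<^esub> ce_wedge_diff R L n xs) ` A)"

definition H_CE ::
    "('k, 'r) ring_scheme \<Rightarrow> ('k, 'a, 'm) lie_scheme \<Rightarrow> nat \<Rightarrow> ('k, ('a list \<Rightarrow> 'k) set set) module"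
  where "H_CE R L n = homology (ext_power R L) (ce_diff R L) n"


section \<open>Free Lie algebras\<close>

text \<open>Terms in the operations of a Lie algebra. A generator is either an element of a base type
  or itself a term, so that the free Lie algebra on (the underlying module of) a Lie algebra of
  terms is again a Lie algebra of terms. This makes the free-forgetful comonad an operation on
  Lie algebras over one fixed type, which can be iterated.\<close>

datatype ('k, 'a) lie_term =
    LGen "'a + ('k, 'a) lie_term"
  | LZero
  | LAdd "('k, 'a) lie_term" "('k, 'a) lie_term"
  | LSmult 'k "('k, 'a) lie_term"
  | LBracket "('k, 'a) lie_term" "('k, 'a) lie_term"

primrec term_eval ::
    "('k, 'b, 'm) lie_scheme \<Rightarrow> ('a + ('k, 'a) lie_term \<Rightarrow> 'b) \<Rightarrow> ('k, 'a) lie_term \<Rightarrow> 'b"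
  where
    "term_eval L f (LGen x) = f x"
  | "term_eval L f LZero = \<zero>\<^bsub>L\<^esub>"
  | "term_eval L f (LAdd s t) = term_eval L f s \<oplus>\<^bsub>L\<^esub> term_eval L f t"
  | "term_eval L f (LSmult r t) = r \<odot>\<^bsub>L\<^esub> term_eval L f t"
  | "term_eval L f (LBracket s t) = bracket L (term_eval L f s) (term_eval L f t)"

inductive_set free_terms ::
    "('k, 'r) ring_scheme \<Rightarrow> ('c \<Rightarrow> 'a + ('k, 'a) lie_term) \<Rightarrow> ('k, 'c, 'm) module_scheme \<Rightarrow>
     ('k, 'a) lie_term set"
  for R :: "('k, 'r) ring_scheme" and \<iota> :: "'c \<Rightarrow> 'a + ('k, 'a) lie_term"
    and M :: "('k, 'c, 'm) module_scheme"
  where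
    gen: "x \<in> carrier M \<Longrightarrow> LGen (\<iota> x) \<in> free_terms R \<iota> M"
  | zero: "LZero \<in> free_terms R \<iota> M"
  | add: "s \<in> free_terms R \<iota> M \<Longrightarrow> t \<in> free_terms R \<iota> M \<Longrightarrow> LAdd s t \<in> free_terms R \<iota> M"
  | smult: "r \<in> carrier R \<Longrightarrow> t \<in> free_terms R \<iota> M \<Longrightarrow> LSmult r t \<in> free_terms R \<iota> M"
  | bracket: "s \<in> free_terms R \<iota> M \<Longrightarrow> t \<in> free_terms R \<iota> M \<Longrightarrow> LBracket s t \<in> free_terms R \<iota> M"

text \<open>The least congruence that turns terms into a Lie algebra in which the generators
  depend linearly on the elements of \<open>M\<close>.\<close>

inductive free_eq ::
    "('k, 'r) ring_scheme \<Rightarrow> ('c \<Rightarrow> 'a + ('k, 'a) lie_term) \<Rightarrow> ('k, 'c, 'm) module_scheme \<Rightarrow>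
     ('k, 'a) lie_term \<Rightarrow> ('k, 'a) lie_term \<Rightarrow> bool"
  for R :: "('k, 'r) ring_scheme" and \<iota> :: "'c \<Rightarrow> 'a + ('k, 'a) lie_term"
    and M :: "('k, 'c, 'm) module_scheme"
  where
    refl: "t \<in> free_terms R \<iota> M \<Longrightarrow> free_eq R \<iota> M t t"
  | sym: "free_eq R \<iota> M s t \<Longrightarrow> free_eq R \<iota> M t s"
  | trans: "free_eq R \<iota> M s t \<Longrightarrow> free_eq R \<iota> M t u \<Longrightarrow> free_eq R \<iota> M s u"
  | add_cong: "free_eq R \<iota> M s s' \<Longrightarrow> free_eq R \<iota> M t t'
      \<Longrightarrow> free_eq R \<iota> M (LAdd s t) (LAdd s' t')"
  | smult_cong: "r \<in> carrier R \<Longrightarrow> free_eq R \<iota> M t t'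
      \<Longrightarrow> free_eq R \<iota> M (LSmult r t) (LSmult r t')"
  | bracket_cong: "free_eq R \<iota> M s s' \<Longrightarrow> free_eq R \<iota> M t t'
      \<Longrightarrow> free_eq R \<iota> M (LBracket s t) (LBracket s' t')"
  | add_assoc: "\<lbrakk>s \<in> free_terms R \<iota> M; t \<in> free_terms R \<iota> M; u \<in> free_terms R \<iota> M\<rbrakk>
      \<Longrightarrow> free_eq R \<iota> M (LAdd (LAdd s t) u) (LAdd s (LAdd t u))"
  | add_comm: "\<lbrakk>s \<in> free_terms R \<iota> M; t \<in> free_terms R \<iota> M\<rbrakk>
      \<Longrightarrow> free_eq R \<iota> M (LAdd s t) (LAdd t s)"
  | add_zero: "t \<in> free_terms R \<iota> M \<Longrightarrow> free_eq R \<iota> M (LAdd LZero t) t"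
  | add_neg: "t \<in> free_terms R \<iota> M
      \<Longrightarrow> free_eq R \<iota> M (LAdd (LSmult (\<ominus>\<^bsub>R\<^esub> \<one>\<^bsub>R\<^esub>) t) t) LZero"
  | smult_add_left: "\<lbrakk>q \<in> carrier R; r \<in> carrier R; t \<in> free_terms R \<iota> M\<rbrakk>
      \<Longrightarrow> free_eq R \<iota> M (LSmult (q \<oplus>\<^bsub>R\<^esub> r) t) (LAdd (LSmult q t) (LSmult r t))"
  | smult_add_right: "\<lbrakk>r \<in> carrier R; s \<in> free_terms R \<iota> M; t \<in> free_terms R \<iota> M\<rbrakk>
      \<Longrightarrow> free_eq R \<iota> M (LSmult r (LAdd s t)) (LAdd (LSmult r s) (LSmult r t))"
  | smult_assoc: "\<lbrakk>q \<in> carrier R; r \<in> carrier R; t \<in> free_terms R \<iota> M\<rbrakk>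
      \<Longrightarrow> free_eq R \<iota> M (LSmult (q \<otimes>\<^bsub>R\<^esub> r) t) (LSmult q (LSmult r t))"
  | smult_one: "t \<in> free_terms R \<iota> M \<Longrightarrow> free_eq R \<iota> M (LSmult \<one>\<^bsub>R\<^esub> t) t"
  | bracket_add_left: "\<lbrakk>s \<in> free_terms R \<iota> M; t \<in> free_terms R \<iota> M; u \<in> free_terms R \<iota> M\<rbrakk>
      \<Longrightarrow> free_eq R \<iota> M (LBracket (LAdd s t) u) (LAdd (LBracket s u) (LBracket t u))"
  | bracket_add_right: "\<lbrakk>s \<in> free_terms R \<iota> M; t \<in> free_terms R \<iota> M; u \<in> free_terms R \<iota> M\<rbrakk>
      \<Longrightarrow> free_eq R \<iota> M (LBracket u (LAdd s t)) (LAdd (LBracket u s) (LBracket u t))"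
  | bracket_smult_left: "\<lbrakk>r \<in> carrier R; s \<in> free_terms R \<iota> M; t \<in> free_terms R \<iota> M\<rbrakk>
      \<Longrightarrow> free_eq R \<iota> M (LBracket (LSmult r s) t) (LSmult r (LBracket s t))"
  | bracket_smult_right: "\<lbrakk>r \<in> carrier R; s \<in> free_terms R \<iota> M; t \<in> free_terms R \<iota> M\<rbrakk>
      \<Longrightarrow> free_eq R \<iota> M (LBracket s (LSmult r t)) (LSmult r (LBracket s t))"
  | bracket_self: "t \<in> free_terms R \<iota> M \<Longrightarrow> free_eq R \<iota> M (LBracket t t) LZero"
  | jacobi: "\<lbrakk>s \<in> free_terms R \<iota> M; t \<in> free_terms R \<iota> M; u \<in> free_terms R \<iota> M\<rbrakk>
      \<Longrightarrow> free_eq R \<iota> M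
        (LAdd (LBracket s (LBracket t u)) (LAdd (LBracket t (LBracket u s)) (LBracket u (LBracket s t))))
        LZero"
  | gen_add: "\<lbrakk>x \<in> carrier M; y \<in> carrier M\<rbrakk>
      \<Longrightarrow> free_eq R \<iota> M (LGen (\<iota> (x \<oplus>\<^bsub>M\<^esub> y))) (LAdd (LGen (\<iota> x)) (LGen (\<iota> y)))"
  | gen_smult: "\<lbrakk>r \<in> carrier R; x \<in> carrier M\<rbrakk>
      \<Longrightarrow> free_eq R \<iota> M (LGen (\<iota> (r \<odot>\<^bsub>M\<^esub> x))) (LSmult r (LGen (\<iota> x)))"

text \<open>An element of the free Lie algebra is a congruence class of terms, encoded by a chosen
  representative, so that the elements are again terms. The injection \<open>\<iota>\<close> (in practice
  \<^const>\<open>Inl\<close> or \<^const>\<open>Inr\<close>) names the generator belonging to an element of \<open>M\<close>.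
  The left-adjoint property is \<open>free_lie_universal\<close> below.\<close>

definition free_rep ::
    "('k, 'r) ring_scheme \<Rightarrow> ('c \<Rightarrow> 'a + ('k, 'a) lie_term) \<Rightarrow> ('k, 'c, 'm) module_scheme \<Rightarrow>
     ('k, 'a) lie_term \<Rightarrow> ('k, 'a) lie_term"
  where "free_rep R \<iota> M t = (SOME s. free_eq R \<iota> M t s)"

definition free_lie ::
    "('k, 'r) ring_scheme \<Rightarrow> ('c \<Rightarrow> 'a + ('k, 'a) lie_term) \<Rightarrow> ('k, 'c, 'm) module_scheme \<Rightarrow>
     ('k, ('k, 'a) lie_term) lie"
  where "free_lie R \<iota> M =
    \<lparr>carrier = free_rep R \<iota> M ` free_terms R \<iota> M, mult = (\<lambda>_ _. undefined), one = undefined,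
      zero = free_rep R \<iota> M LZero,
      add = (\<lambda>s t. free_rep R \<iota> M (LAdd s t)),
      smult = (\<lambda>r t. free_rep R \<iota> M (LSmult r t)),
      bracket = (\<lambda>s t. free_rep R \<iota> M (LBracket s t))\<rparr>"

definition free_gen ::
    "('k, 'r) ring_scheme \<Rightarrow> ('c \<Rightarrow> 'a + ('k, 'a) lie_term) \<Rightarrow> ('k, 'c, 'm) module_scheme \<Rightarrow>
     'c \<Rightarrow> ('k, 'a) lie_term"
  where "free_gen R \<iota> M x = free_rep R \<iota> M (LGen (\<iota> x))"

lemma free_rep_eq: "t \<in> free_terms R \<iota> M \<Longrightarrow> free_eq R \<iota> M t (free_rep R \<iota> M t)"
  unfolding free_rep_def by (rule someI[of "free_eq R \<iota> M t"]) (rule free_eq.refl)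

lemma free_rep_cong: "free_eq R \<iota> M s t \<Longrightarrow> free_rep R \<iota> M s = free_rep R \<iota> M t"
proof -
  assume "free_eq R \<iota> M s t"
  then have "free_eq R \<iota> M s = free_eq R \<iota> M t"
    by (intro ext) (metis free_eq.sym free_eq.trans)
  then show ?thesis by (simp add: free_rep_def)
qed

lemma free_rep_add:
  assumes "s \<in> free_terms R \<iota> M" "t \<in> free_terms R \<iota> M"
  shows "add (free_lie R \<iota> M) (free_rep R \<iota> M s) (free_rep R \<iota> M t) = free_rep R \<iota> M (LAdd s t)"
  using free_rep_eq[OF assms(1)] free_rep_eq[OF assms(2)]
  by (auto simp: free_lie_def intro!: free_rep_cong intro: free_eq.add_cong free_eq.sym)

lemma free_rep_smult:
  assumes "r \<in> carrier R" "t \<in> free_terms R \<iota> M"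
  shows "smult (free_lie R \<iota> M) r (free_rep R \<iota> M t) = free_rep R \<iota> M (LSmult r t)"
  using free_rep_eq[OF assms(2)] assms(1)
  by (auto simp: free_lie_def intro!: free_rep_cong intro: free_eq.smult_cong free_eq.sym)

lemma free_rep_bracket:
  assumes "s \<in> free_terms R \<iota> M" "t \<in> free_terms R \<iota> M"
  shows "bracket (free_lie R \<iota> M) (free_rep R \<iota> M s) (free_rep R \<iota> M t) =
    free_rep R \<iota> M (LBracket s t)"
  using free_rep_eq[OF assms(1)] free_rep_eq[OF assms(2)]
  by (auto simp: free_lie_def intro!: free_rep_cong intro: free_eq.bracket_cong free_eq.sym)

lemma free_lie_zero: "zero (free_lie R \<iota> M) = free_rep R \<iota> M LZero"
  by (simp add: free_lie_def)

lemma free_lie_carrier: "carrier (free_lie R \<iota> M) = free_rep R \<iota> M ` free_terms R \<iota> M"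
  by (simp add: free_lie_def)

lemmas free_lie_simps = free_lie_carrier free_lie_zero free_rep_add free_rep_smult
  free_rep_bracket free_terms.intros

theorem free_lie_lie_algebra:
  assumes "module R M"
  shows "lie_algebra R (free_lie R \<iota> M)"
proof -
  interpret module R M by fact
  have "abelian_group (free_lie R \<iota> M)"
  proof (rule abelian_groupI)
    fix x assume "x \<in> carrier (free_lie R \<iota> M)"
    then obtain t where t: "t \<in> free_terms R \<iota> M" "x = free_rep R \<iota> M t"
      by (auto simp: free_lie_carrier)
    have "add (free_lie R \<iota> M) (free_rep R \<iota> M (LSmult (\<ominus>\<^bsub>R\<^esub> \<one>\<^bsub>R\<^esub>) t)) x = zero (free_lie R \<iota> M)"
      using t by (simp add: free_lie_simps free_rep_cong[OF free_eq.add_neg])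
    moreover have "free_rep R \<iota> M (LSmult (\<ominus>\<^bsub>R\<^esub> \<one>\<^bsub>R\<^esub>) t) \<in> carrier (free_lie R \<iota> M)"
      using t by (simp add: free_lie_simps)
    ultimately show "\<exists>y\<in>carrier (free_lie R \<iota> M). y \<oplus>\<^bsub>free_lie R \<iota> M\<^esub> x = \<zero>\<^bsub>free_lie R \<iota> M\<^esub>"
      by blast
  qed (auto simp: free_lie_simps free_rep_cong[OF free_eq.add_assoc]
      free_rep_cong[OF free_eq.add_zero] intro!: free_rep_cong intro: free_eq.add_comm)
  then have "module R (free_lie R \<iota> M)"
    by (intro moduleI R.is_cring)
      (auto simp: free_lie_simps free_rep_cong[OF free_eq.smult_add_left]
        free_rep_cong[OF free_eq.smult_add_right] free_rep_cong[OF free_eq.smult_assoc]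
        free_rep_cong[OF free_eq.smult_one])
  then show ?thesis
    by (intro lie_algebra.intro lie_algebra_axioms.intro)
      (auto simp: free_lie_simps free_rep_cong[OF free_eq.bracket_add_left]
        free_rep_cong[OF free_eq.bracket_add_right] free_rep_cong[OF free_eq.bracket_smult_left]
        free_rep_cong[OF free_eq.bracket_smult_right] free_rep_cong[OF free_eq.bracket_self]
        free_rep_cong[OF free_eq.jacobi])
qed

lemma free_gen_lin_hom: "free_gen R \<iota> M \<in> lin_hom R M (free_lie R \<iota> M)"
  by (auto simp: lin_hom_def free_gen_def free_lie_simps free_rep_cong[OF free_eq.gen_add]
      free_rep_cong[OF free_eq.gen_smult])

lemma term_eval_closed:
  assumes "lie_algebra R L" "\<And>x. x \<in> carrier M \<Longrightarrow> \<phi> (\<iota> x) \<in> carrier L" "t \<in> free_terms R \<iota> M"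
  shows "term_eval L \<phi> t \<in> carrier L"
proof -
  interpret lie_algebra R L by fact
  show ?thesis using assms(3) by induction (auto simp: assms(2) bracket_closed)
qed

lemma term_eval_eq:
  assumes "module R M" "lie_algebra R L" "(\<lambda>x. \<phi> (\<iota> x)) \<in> lin_hom R M L" "free_eq R \<iota> M s t"
  shows "term_eval L \<phi> s = term_eval L \<phi> t"
proof -
  interpret L: lie_algebra R L by fact
  have c: "term_eval L \<phi> t \<in> carrier L" if "t \<in> free_terms R \<iota> M" for t
    using assms(2,3) that by (intro term_eval_closed) (auto simp: lin_hom_def)
  show ?thesis using assms(4)
  proof induction
    case (add_neg t)
    then show ?case using c[of t] by (simp add: L.smult_l_minus L.l_neg)
  qed (use assms(3) in \<open>auto simp: c L.a_assoc L.smult_l_distr L.smult_r_distr L.smult_assoc1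
      L.bracket_add_left L.bracket_add_right L.bracket_smult_left L.bracket_smult_right
      L.bracket_self L.jacobi L.bracket_closed lin_hom_def intro: L.a_comm\<close>)
qed

theorem free_lie_universal:
  assumes "module R M" "lie_algebra R L" "inj_on \<iota> (carrier M)" "f \<in> lin_hom R M L"
  shows "\<exists>h \<in> lie_hom R (free_lie R \<iota> M) L. (\<forall>x\<in>carrier M. h (free_gen R \<iota> M x) = f x) \<and>
    (\<forall>h' \<in> lie_hom R (free_lie R \<iota> M) L. (\<forall>x\<in>carrier M. h' (free_gen R \<iota> M x) = f x) \<longrightarrow>
      (\<forall>y\<in>carrier (free_lie R \<iota> M). h' y = h y))"
proof -
  interpret L: lie_algebra R L by fact
  interpret F: lie_algebra R "free_lie R \<iota> M" by (rule free_lie_lie_algebra) fact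
  define \<phi> where "\<phi> = (\<lambda>y. f (inv_into (carrier M) \<iota> y))"
  interpret M: module R M by fact
  have \<phi>: "\<phi> (\<iota> x) = f x" if "x \<in> carrier M" for x
    using assms(3) that by (simp add: \<phi>_def)
  have lin: "(\<lambda>x. \<phi> (\<iota> x)) \<in> lin_hom R M L"
    using assms(4) by (auto simp: lin_hom_def \<phi>)
  have c: "term_eval L \<phi> t \<in> carrier L" if "t \<in> free_terms R \<iota> M" for t
    using assms(2) lin that by (intro term_eval_closed) (auto simp: lin_hom_def)
  have rep: "term_eval L \<phi> (free_rep R \<iota> M t) = term_eval L \<phi> t" if "t \<in> free_terms R \<iota> M" for t
    using term_eval_eq[OF assms(1,2) lin free_rep_eq[OF that]] by simp
  have hom: "term_eval L \<phi> \<in> lie_hom R (free_lie R \<iota> M) L"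
    by (auto simp: lie_hom_def lin_hom_def free_lie_simps rep c)
  have gen: "\<forall>x\<in>carrier M. term_eval L \<phi> (free_gen R \<iota> M x) = f x"
    by (auto simp: free_gen_def rep free_terms.intros \<phi>)
  have "h' (free_rep R \<iota> M t) = term_eval L \<phi> (free_rep R \<iota> M t)"
    if h': "h' \<in> lie_hom R (free_lie R \<iota> M) L" "\<forall>x\<in>carrier M. h' (free_gen R \<iota> M x) = f x"
      and t: "t \<in> free_terms R \<iota> M" for h' t
    using t
  proof induction
    case zero
    have "h' (\<zero>\<^bsub>free_lie R \<iota> M\<^esub> \<oplus>\<^bsub>free_lie R \<iota> M\<^esub> \<zero>\<^bsub>free_lie R \<iota> M\<^esub>) =
        h' \<zero>\<^bsub>free_lie R \<iota> M\<^esub> \<oplus>\<^bsub>L\<^esub> h' \<zero>\<^bsub>free_lie R \<iota> M\<^esub>"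
      using h'(1) F.zero_closed unfolding lie_hom_def lin_hom_def by blast
    then have zz: "h' \<zero>\<^bsub>free_lie R \<iota> M\<^esub> = h' \<zero>\<^bsub>free_lie R \<iota> M\<^esub> \<oplus>\<^bsub>L\<^esub> h' \<zero>\<^bsub>free_lie R \<iota> M\<^esub>"
      by simp
    have "h' \<zero>\<^bsub>free_lie R \<iota> M\<^esub> \<in> carrier L"
      using h'(1) F.zero_closed unfolding lie_hom_def lin_hom_def by blast
    with zz have "h' \<zero>\<^bsub>free_lie R \<iota> M\<^esub> = \<zero>\<^bsub>L\<^esub>"
      by (metis L.add.r_cancel_one')
    then show ?case by (simp add: free_lie_zero rep free_terms.intros)
  next
    case (gen x)
    then show ?case using h'(2) by (simp add: rep free_terms.intros \<phi> free_gen_def)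
  next
    case (add s t)
    have "h' (add (free_lie R \<iota> M) (free_rep R \<iota> M s) (free_rep R \<iota> M t)) =
        add L (h' (free_rep R \<iota> M s)) (h' (free_rep R \<iota> M t))"
      using add.hyps h'(1) by (auto simp: lie_hom_def lin_hom_def free_lie_carrier)
    with add show ?case by (simp add: free_lie_simps rep)
  next
    case (smult r t)
    have "h' (smult (free_lie R \<iota> M) r (free_rep R \<iota> M t)) = smult L r (h' (free_rep R \<iota> M t))"
      using smult.hyps h'(1) by (auto simp: lie_hom_def lin_hom_def free_lie_carrier)
    with smult show ?case by (simp add: free_lie_simps rep)
  next
    case (bracket s t)
    have "h' (lie.bracket (free_lie R \<iota> M) (free_rep R \<iota> M s) (free_rep R \<iota> M t)) =
        lie.bracket L (h' (free_rep R \<iota> M s)) (h' (free_rep R \<iota> M t))"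
      using bracket.hyps h'(1) by (auto simp: lie_hom_def lin_hom_def free_lie_carrier)
    with bracket show ?case by (simp add: free_lie_simps rep)
  qed
  then show ?thesis
    using hom gen by (intro bexI[of _ "term_eval L \<phi>"]) (auto simp: free_lie_carrier)
qed


section \<open>The free-forgetful comonad and relative simplicial homology\<close>

type_synonym ('k, 'a) term_lie = "('k, ('k, 'a) lie_term) lie"

definition com_obj :: "('k, 'r) ring_scheme \<Rightarrow> ('k, 'a) term_lie \<Rightarrow> ('k, 'a) term_lie"
  where "com_obj R L = free_lie R Inr L"

text \<open>The image under the comonad of a morphism \<open>f\<close> into \<open>L'\<close> (the source is not needed): the
  morphism of free Lie algebras that sends the generator of \<open>x\<close> to the generator of \<open>f x\<close>.\<close>

definition com_map ::
    "('k, 'r) ring_scheme \<Rightarrow> ('k, 'a) term_lie \<Rightarrow>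
     (('k, 'a) lie_term \<Rightarrow> ('k, 'a) lie_term) \<Rightarrow> ('k, 'a) lie_term \<Rightarrow> ('k, 'a) lie_term"
  where "com_map R L' f = term_eval (com_obj R L') (\<lambda>g. free_gen R Inr L' (f (projr g)))"

definition com_counit :: "('k, 'a) term_lie \<Rightarrow> ('k, 'a) lie_term \<Rightarrow> ('k, 'a) lie_term"
  where "com_counit L = term_eval L projr"

text \<open>\<open>com_map_pow R L' i f\<close> is the \<open>i\<close>-fold image of \<open>f\<close>, a morphism into the \<open>i\<close>-fold image
  of \<open>L'\<close>.\<close>

primrec com_map_pow ::
    "('k, 'r) ring_scheme \<Rightarrow> ('k, 'a) term_lie \<Rightarrow> nat \<Rightarrow>
     (('k, 'a) lie_term \<Rightarrow> ('k, 'a) lie_term) \<Rightarrow> ('k, 'a) lie_term \<Rightarrow> ('k, 'a) lie_term"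
  where
    "com_map_pow R L' 0 f = f"
  | "com_map_pow R L' (Suc i) f = com_map R ((com_obj R ^^ i) L') (com_map_pow R L' i f)"

definition com_face ::
    "('k, 'r) ring_scheme \<Rightarrow> ('k, 'a) term_lie \<Rightarrow> nat \<Rightarrow> nat \<Rightarrow> ('k, 'a) lie_term \<Rightarrow> ('k, 'a) lie_term"
  where "com_face R L n i =
    com_map_pow R ((com_obj R ^^ (n - i)) L) i (com_counit ((com_obj R ^^ (n - i)) L))"

text \<open>Left derived functors, relative to the comonad, of a functor from Lie algebras to modules
  with object part \<open>\<Phi>\<close> and morphism part \<open>\<Phi>m\<close>; the latter takes source, target and morphism.\<close>

definition com_derived ::
    "('k, 'r) ring_scheme \<Rightarrow> (('k, 'a) term_lie \<Rightarrow> ('k, 'b) module) \<Rightarrow>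
     (('k, 'a) term_lie \<Rightarrow> ('k, 'a) term_lie \<Rightarrow> (('k, 'a) lie_term \<Rightarrow> ('k, 'a) lie_term) \<Rightarrow> 'b \<Rightarrow> 'b) \<Rightarrow>
     nat \<Rightarrow> ('k, 'a) term_lie \<Rightarrow> ('k, 'b set) module"
  where "com_derived R \<Phi> \<Phi>m n L =
    homology (\<lambda>m. \<Phi> ((com_obj R ^^ Suc m) L))
      (\<lambda>m A. \<Oplus>\<^bsub>\<Phi> ((com_obj R ^^ m) L)\<^esub> i \<in> {..m}.
        alt_sign (\<Phi> ((com_obj R ^^ m) L)) i
          (\<Phi>m ((com_obj R ^^ Suc m) L) ((com_obj R ^^ m) L) (com_face R L m i) A))
      n"

definition derived_ideal :: "('k, 'r) ring_scheme \<Rightarrow> ('k, 'a, 'm) lie_scheme \<Rightarrow> 'a set"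
  where "derived_ideal R L =
    mod_span R L {bracket L x y | x y. x \<in> carrier L \<and> y \<in> carrier L}"

definition ab_obj :: "('k, 'r) ring_scheme \<Rightarrow> ('k, 'a, 'm) lie_scheme \<Rightarrow> ('k, 'a set) module"
  where "ab_obj R L = quot_module L (derived_ideal R L)"

definition ab_map ::
    "('k, 'r) ring_scheme \<Rightarrow> ('k, 'a, 'm) lie_scheme \<Rightarrow> ('k, 'b, 'n) lie_scheme \<Rightarrow>
     ('a \<Rightarrow> 'b) \<Rightarrow> 'a set \<Rightarrow> 'b set"
  where "ab_map R L L' f A = the_elem ((\<lambda>x. derived_ideal R L' +>\<^bsub>L'\<^esub> f x) ` A)"

text \<open>Meaningful for \<open>n \<ge> 1\<close> only.\<close>

definition H_RS ::
    "('k, 'r) ring_scheme \<Rightarrow> ('k, 'a) term_lie \<Rightarrow> nat \<Rightarrow> ('k, ('k, 'a) lie_term set set) module"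
  where "H_RS R L n = com_derived R (ab_obj R) (ab_map R) (n - 1) L"


section \<open>The example\<close>

text \<open>Polynomials over the type \<open>3\<close> of integers modulo 3, with variables indexed by the
  four-element type \<open>4\<close>.\<close>

type_synonym poly4 = "(4 \<Rightarrow>\<^sub>0 nat) \<Rightarrow>\<^sub>0 3"

definition poly_var :: "4 \<Rightarrow> poly4"
  where "poly_var i = Poly_Mapping.single (Poly_Mapping.single i 1) 1"

definition poly4_ring :: "poly4 ring"
  where "poly4_ring = \<lparr>carrier = UNIV, mult = (*), one = 1, zero = 0, add = (+)\<rparr>"

definition sq_ideal :: "poly4 set"
  where "sq_ideal = genideal poly4_ring (range (\<lambda>i. poly_var i ^ 2))"

definition kk :: "poly4 set ring"
  where "kk = poly4_ring Quot sq_ideal"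

definition kk_t :: "4 \<Rightarrow> poly4 set"
  where "kk_t i = sq_ideal +>\<^bsub>poly4_ring\<^esub> poly_var i"

definition kk4 :: "(poly4 set, 4 \<Rightarrow> poly4 set) module"
  where "kk4 = free_module kk UNIV"

definition M_ex :: "(poly4 set, (4 \<Rightarrow> poly4 set) set) module"
  where "M_ex = quot_module kk4
    (mod_span kk kk4 {\<Oplus>\<^bsub>kk4\<^esub> i \<in> UNIV. kk_t i \<odot>\<^bsub>kk4\<^esub> basis_vec kk i})"

definition g_ex :: "(poly4 set, (4 \<Rightarrow> poly4 set) set) term_lie"
  where "g_ex = free_lie kk Inl M_ex"

end

theory Submission
  imports Defs
begin

text \<open>
  Relative simplicial homology: the unit of the adjunction gives a section \<open>s\<close> of the counit at a free
  Lie algebra, and the maps \<open>G\<^sup>n s\<close> are an extra degeneracy, so that all higher homology vanishes.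

  Chevalley--Eilenberg homology: the class of \<open>\<omega> = t\<^sub>1 t\<^sub>2 t\<^sub>3 e\<^sub>1 \<and> e\<^sub>2 \<and> e\<^sub>3\<close> is not zero. Multiplying
  \<open>[e\<^sub>i, \<tau>] \<and> e\<^sub>k\<close> and \<open>[e\<^sub>i, e\<^sub>j] \<and> \<tau>\<close>, where \<open>\<tau> = \<Sum> t\<^sub>i e\<^sub>i = 0\<close>, by products of two of the \<open>t\<^sub>i\<close> and
  using \<open>t\<^sub>i\<^sup>2 = 0\<close>, one finds that \<open>\<partial>\<omega>\<close> is three times an element, hence zero. On the other hand,
  \<open>(x, y, z) \<mapsto> det (\<tau>, x, y, z)\<close> is an alternating form on \<open>M\<close>; pulled back along the projection of the
  free Lie algebra to the abelian Lie algebra \<open>M\<close> it annihilates all boundaries, but up to sign its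
  value at \<open>\<omega>\<close> is \<open>t\<^sub>1 t\<^sub>2 t\<^sub>3 t\<^sub>4 \<noteq> 0\<close>.
\<close>


section \<open>Linear maps and quotient modules\<close>

text \<open>Grade the free Lie algebra by word length. In weight three the complex begins with the
  comultiplication from the third exterior power of \<open>M\<close> to (second exterior power)
  tensor \<open>M\<close>. Followed by the product back into the third exterior power, it is
  multiplication by -3, so a cycle there is 3-torsion: hence coefficients of characteristic 3. For
  free, and so for flat, \<open>M\<close> the comultiplication is injective, so \<open>M\<close>
  must not be flat; a single relation with square-zero coefficients achieves this. A nonzero cycle
  made of generators cannot be a boundary, since the fourth exterior power of the Lie algebra starts
  in weight four. No grading is constructed: the map to the abelian Lie algebra on \<open>M\<close>
  forgets everything but weight one, which is enough to see the cycle. The factor of three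
  coefficients in the cycle serves two ends: with each of them squaring to zero it removes the
  unwanted terms of the relation, and it is still not annihilated by the fourth coefficient, which
  the determinant supplies. The relative theory does not see any of this, because its resolution of
  a free Lie algebra contracts whatever the module of generators is.\<close>

lemma lin_homI:
  assumes "\<And>x. x \<in> carrier M \<Longrightarrow> h x \<in> carrier N"
    and "\<And>x y. x \<in> carrier M \<Longrightarrow> y \<in> carrier M \<Longrightarrow> h (x \<oplus>\<^bsub>M\<^esub> y) = h x \<oplus>\<^bsub>N\<^esub> h y"
    and "\<And>r x. r \<in> carrier R \<Longrightarrow> x \<in> carrier M \<Longrightarrow> h (r \<odot>\<^bsub>M\<^esub> x) = r \<odot>\<^bsub>N\<^esub> h x"
  shows "h \<in> lin_hom R M N"
  using assms by (simp add: lin_hom_def)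

lemma lin_hom_closed: "h \<in> lin_hom R M N \<Longrightarrow> x \<in> carrier M \<Longrightarrow> h x \<in> carrier N"
  by (auto simp: lin_hom_def)

lemma lin_hom_add:
  "h \<in> lin_hom R M N \<Longrightarrow> x \<in> carrier M \<Longrightarrow> y \<in> carrier M \<Longrightarrow> h (x \<oplus>\<^bsub>M\<^esub> y) = h x \<oplus>\<^bsub>N\<^esub> h y"
  by (auto simp: lin_hom_def)

lemma lin_hom_smult:
  "h \<in> lin_hom R M N \<Longrightarrow> r \<in> carrier R \<Longrightarrow> x \<in> carrier M \<Longrightarrow> h (r \<odot>\<^bsub>M\<^esub> x) = r \<odot>\<^bsub>N\<^esub> h x"
  by (auto simp: lin_hom_def)

lemma lin_hom_zero:
  assumes "module R M" "module R N" "h \<in> lin_hom R M N"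
  shows "h \<zero>\<^bsub>M\<^esub> = \<zero>\<^bsub>N\<^esub>"
proof -
  interpret M: module R M by fact
  interpret N: module R N by fact
  \<comment> \<open>Writing the argument as zero times zero lets homogeneity alone give the
    claim.\<close>
  have "h (\<zero>\<^bsub>R\<^esub> \<odot>\<^bsub>M\<^esub> \<zero>\<^bsub>M\<^esub>) = \<zero>\<^bsub>R\<^esub> \<odot>\<^bsub>N\<^esub> h \<zero>\<^bsub>M\<^esub>"
    using assms(3) by (rule lin_hom_smult) auto
  then show ?thesis
    using lin_hom_closed[OF assms(3)] by simp
qed

lemma lin_hom_minus:
  assumes "module R M" "module R N" "h \<in> lin_hom R M N" "x \<in> carrier M"
  shows "h (\<ominus>\<^bsub>M\<^esub> x) = \<ominus>\<^bsub>N\<^esub> h x"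
proof -
  interpret M: module R M by fact
  interpret N: module R N by fact
  have "\<ominus>\<^bsub>M\<^esub> x = (\<ominus>\<^bsub>R\<^esub> \<one>\<^bsub>R\<^esub>) \<odot>\<^bsub>M\<^esub> x"
    using assms(4) by (simp add: M.smult_l_minus)
  then show ?thesis
    using assms(3,4) lin_hom_closed[OF assms(3,4)]
    by (simp add: lin_hom_smult N.smult_l_minus)
qed

lemma lin_hom_finsum:
  assumes "module R M" "module R N" "h \<in> lin_hom R M N" "finite I" "f \<in> I \<rightarrow> carrier M"
  shows "h (\<Oplus>\<^bsub>M\<^esub>i\<in>I. f i) = (\<Oplus>\<^bsub>N\<^esub>i\<in>I. h (f i))"
proof -
  interpret M: module R M by fact
  interpret N: module R N by fact
  note c = lin_hom_closed[OF assms(3)]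
  show ?thesis
    using assms(4,5)
  proof (induction I)
    case empty
    then show ?case using lin_hom_zero[OF assms(1-3)] by simp
  next
    case (insert i I)
    then have "f i \<in> carrier M" "f \<in> I \<rightarrow> carrier M" by auto
    moreover from this have "(\<lambda>i. h (f i)) \<in> I \<rightarrow> carrier N" using c by auto
    ultimately show ?case
      using insert c by (simp add: lin_hom_add[OF assms(3)])
  qed
qed

lemma lin_hom_alt_sign:
  assumes "module R M" "module R N" "h \<in> lin_hom R M N" "x \<in> carrier M"
  shows "h (alt_sign M n x) = alt_sign N n (h x)"
  using lin_hom_minus[OF assms] by (simp add: alt_sign_def)

lemma alt_sign_closed: "module R M \<Longrightarrow> x \<in> carrier M \<Longrightarrow> alt_sign M n x \<in> carrier M"
  by (simp add: alt_sign_def module.axioms abelian_group.a_inv_closed)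

lemma lin_hom_comp:
  assumes "h \<in> lin_hom R M N" "k \<in> lin_hom R N K"
  shows "(\<lambda>x. k (h x)) \<in> lin_hom R M K"
  by (rule lin_homI)
    (use lin_hom_closed[OF assms(1)] lin_hom_closed[OF assms(2)] in
      \<open>simp_all add: lin_hom_add[OF assms(1)] lin_hom_add[OF assms(2)]
        lin_hom_smult[OF assms(1)] lin_hom_smult[OF assms(2)]\<close>)

lemma lin_hom_kernel_submodule:
  assumes "module R M" "module R N" "h \<in> lin_hom R M N"
  shows "submodule {x \<in> carrier M. h x = \<zero>\<^bsub>N\<^esub>} R M"
proof -
  interpret M: module R M by fact
  interpret N: module R N by fact
  show ?thesis
    using assms
    by (intro M.submoduleI) (auto simp: lin_hom_zero lin_hom_minus lin_hom_add lin_hom_smult)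
qed

lemma mod_span_incl: "x \<in> S \<Longrightarrow> x \<in> mod_span R M S"
  by (auto simp: mod_span_def)

lemma mod_span_least: "submodule N R M \<Longrightarrow> S \<subseteq> N \<Longrightarrow> mod_span R M S \<subseteq> N"
  by (auto simp: mod_span_def)

lemma mod_span_submodule:
  assumes "module R M" "S \<subseteq> carrier M"
  shows "submodule (mod_span R M S) R M"
proof -
  interpret M: module R M by fact
  note E = M.submoduleE
  have z: "\<zero>\<^bsub>M\<^esub> \<in> N" if "submodule N R M" for N
    using subgroup.one_closed[OF submodule.axioms(1)[OF that]] by simp
  show ?thesis
  proof (rule M.submoduleI)
    show "mod_span R M S \<subseteq> carrier M"
      using assms(2) M.carrier_is_submodule by (auto simp: mod_span_def)
  qed (auto simp: mod_span_def z dest: E(3) E(4) E(5))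
qed

text \<open>The kernel is a submodule, so it contains the span as soon as it contains the
  generators. Every linear map below is shown to kill a span in this way, without writing elements
  as linear combinations.\<close>

lemma mod_span_vanish:
  assumes "module R M" "module R N" "h \<in> lin_hom R M N" "S \<subseteq> carrier M"
    and "\<And>x. x \<in> S \<Longrightarrow> h x = \<zero>\<^bsub>N\<^esub>" "x \<in> mod_span R M S"
  shows "h x = \<zero>\<^bsub>N\<^esub>"
  using mod_span_least[OF lin_hom_kernel_submodule[OF assms(1-3)], of S] assms(4-6) by auto

lemma submodule_abelian_subgroup:
  assumes "module R M" "submodule N R M"
  shows "abelian_subgroup N M"
  using assms by (intro abelian_subgroupI3 additive_subgroupI submodule.axioms module.axioms)

lemma mem_a_r_coset: "y \<in> N +>\<^bsub>M\<^esub> x \<longleftrightarrow> (\<exists>n\<in>N. y = n \<oplus>\<^bsub>M\<^esub> x)"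
  by (auto simp: a_r_coset_def')

lemma coset_eq_zero_iff:
  assumes "module R M" "submodule N R M" "x \<in> carrier M"
  shows "N +>\<^bsub>M\<^esub> x = N \<longleftrightarrow> x \<in> N"
proof -
  interpret abelian_subgroup N M using assms by (intro submodule_abelian_subgroup)
  show ?thesis
    using a_coset_join1[OF _ assms(3) a_subgroup] a_coset_join2[OF assms(3) a_subgroup] by auto
qed

lemma coset_add_absorb:
  assumes "module R M" "submodule N R M" "x \<in> carrier M" "n \<in> N"
  shows "N +>\<^bsub>M\<^esub> (n \<oplus>\<^bsub>M\<^esub> x) = N +>\<^bsub>M\<^esub> x"
proof -
  interpret abelian_subgroup N M using assms by (intro submodule_abelian_subgroup)
  have "n \<oplus>\<^bsub>M\<^esub> x \<in> N +>\<^bsub>M\<^esub> x" using assms(4) by (auto simp: mem_a_r_coset)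
  then show ?thesis using a_repr_independence[OF _ assms(3) a_subgroup] by simp
qed

text \<open>In \<open>quot_module\<close> a scalar acts by a union over all representatives of the
  coset. Two representatives differ by some \<open>n\<close> in \<open>N\<close>, and
  \<open>r\<close> times \<open>n\<close> is again in \<open>N\<close>, so the union runs over
  copies of one coset.\<close>

lemma quot_smult:
  assumes "module R M" "submodule N R M" "r \<in> carrier R" "x \<in> carrier M"
  shows "r \<odot>\<^bsub>quot_module M N\<^esub> (N +>\<^bsub>M\<^esub> x) = N +>\<^bsub>M\<^esub> (r \<odot>\<^bsub>M\<^esub> x)"
proof -
  interpret M: module R M by fact
  interpret abelian_subgroup N M using assms by (intro submodule_abelian_subgroup)
  have "N +>\<^bsub>M\<^esub> (r \<odot>\<^bsub>M\<^esub> y) = N +>\<^bsub>M\<^esub> (r \<odot>\<^bsub>M\<^esub> x)" if y: "y \<in> N +>\<^bsub>M\<^esub> x" for y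
  proof -
    obtain n where n: "n \<in> N" "y = n \<oplus>\<^bsub>M\<^esub> x" using y by (auto simp: mem_a_r_coset)
    have "n \<in> carrier M" using n a_subset by auto
    then have "r \<odot>\<^bsub>M\<^esub> y = r \<odot>\<^bsub>M\<^esub> n \<oplus>\<^bsub>M\<^esub> r \<odot>\<^bsub>M\<^esub> x" using n assms by (simp add: M.smult_r_distr)
    moreover have "r \<odot>\<^bsub>M\<^esub> n \<in> N" using M.submoduleE(4)[OF assms(2,3)] n by simp
    ultimately show ?thesis using assms by (simp add: coset_add_absorb)
  qed
  then have "(\<lambda>y. N +>\<^bsub>M\<^esub> (r \<odot>\<^bsub>M\<^esub> y)) ` (N +>\<^bsub>M\<^esub> x) = {N +>\<^bsub>M\<^esub> (r \<odot>\<^bsub>M\<^esub> x)}"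
    using a_rcos_self[OF assms(4)] by fast
  then show ?thesis by (simp add: quot_module_def)
qed

lemma quot_add:
  assumes "module R M" "submodule N R M" "x \<in> carrier M" "y \<in> carrier M"
  shows "(N +>\<^bsub>M\<^esub> x) \<oplus>\<^bsub>quot_module M N\<^esub> (N +>\<^bsub>M\<^esub> y) = N +>\<^bsub>M\<^esub> (x \<oplus>\<^bsub>M\<^esub> y)"
  using abelian_subgroup.a_rcos_sum[OF submodule_abelian_subgroup[OF assms(1,2)] assms(3,4)]
  by (simp add: quot_module_def)

lemma quot_zero: "\<zero>\<^bsub>quot_module M N\<^esub> = N"
  by (simp add: quot_module_def)

lemma quot_carrier: "carrier (quot_module M N) = (\<lambda>x. N +>\<^bsub>M\<^esub> x) ` carrier M"
  by (auto simp: quot_module_def A_RCOSETS_def')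

lemma quot_module_module:
  assumes "module R M" "submodule N R M"
  shows "module R (quot_module M N)"
proof -
  interpret M: module R M by fact
  interpret N: abelian_subgroup N M using assms by (intro submodule_abelian_subgroup)
  have z: "N = N +>\<^bsub>M\<^esub> \<zero>\<^bsub>M\<^esub>" using N.a_subset by simp
  note s = quot_add[OF assms] quot_smult[OF assms] quot_carrier
  have ag: "abelian_group (quot_module M N)"
  proof (rule abelian_groupI)
    show "\<zero>\<^bsub>quot_module M N\<^esub> \<in> carrier (quot_module M N)"
      by (subst quot_zero, subst z) (auto simp: quot_carrier)
    fix A assume "A \<in> carrier (quot_module M N)"
    then obtain x where x: "x \<in> carrier M" "A = N +>\<^bsub>M\<^esub> x" by (auto simp: quot_carrier)
    have "N \<oplus>\<^bsub>quot_module M N\<^esub> A = A"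
      by (subst (1) z) (simp add: x s)
    then show "\<zero>\<^bsub>quot_module M N\<^esub> \<oplus>\<^bsub>quot_module M N\<^esub> A = A" by (simp add: quot_zero)
    have "(N +>\<^bsub>M\<^esub> \<ominus>\<^bsub>M\<^esub> x) \<oplus>\<^bsub>quot_module M N\<^esub> A = \<zero>\<^bsub>quot_module M N\<^esub>"
      using x z by (simp add: s quot_zero M.l_neg)
    then show "\<exists>B\<in>carrier (quot_module M N). B \<oplus>\<^bsub>quot_module M N\<^esub> A = \<zero>\<^bsub>quot_module M N\<^esub>"
      using x by (auto simp: quot_carrier)
  qed (auto simp: s M.a_ac)
  show ?thesis
    by (intro moduleI M.R.is_cring ag)
      (auto simp: s M.smult_l_distr M.smult_r_distr M.smult_assoc1)
qed

lemma quot_proj_lin_hom: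
  assumes "module R M" "submodule N R M"
  shows "(\<lambda>x. N +>\<^bsub>M\<^esub> x) \<in> lin_hom R M (quot_module M N)"
  by (rule lin_homI) (auto simp: quot_carrier quot_add[OF assms] quot_smult[OF assms])

text \<open>\<open>ab_map\<close> and \<open>ce_diff\<close> act on a coset through
  \<open>the_elem\<close> of an image. They are meaningful because a map that kills \<open>N\<close>
  is constant on the cosets of \<open>N\<close>.\<close>

lemma image_coset:
  assumes "module R M" "module R K" "submodule N R M" "f \<in> lin_hom R M K"
    and "\<And>n. n \<in> N \<Longrightarrow> f n = \<zero>\<^bsub>K\<^esub>" "x \<in> carrier M"
  shows "f ` (N +>\<^bsub>M\<^esub> x) = {f x}"
proof -
  interpret M: module R M by fact
  interpret K: module R K by fact
  interpret N: abelian_subgroup N M using assms by (intro submodule_abelian_subgroup)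
  have "f y = f x" if "y \<in> N +>\<^bsub>M\<^esub> x" for y
    using that assms(5,6) N.a_subset lin_hom_closed[OF assms(4)]
    by (auto simp: mem_a_r_coset lin_hom_add[OF assms(4)] subset_iff)
  moreover have "x \<in> N +>\<^bsub>M\<^esub> x" using assms by (simp add: N.a_rcos_self)
  ultimately show ?thesis by fast
qed

lemma quot_lift_lin_hom:
  assumes "module R M" "module R K" "submodule N R M" "f \<in> lin_hom R M K"
    and "\<And>n. n \<in> N \<Longrightarrow> f n = \<zero>\<^bsub>K\<^esub>"
  shows "(\<lambda>A. the_elem (f ` A)) \<in> lin_hom R (quot_module M N) K"
proof -
  interpret M: module R M by fact
  note s = quot_add[OF assms(1,3)] quot_smult[OF assms(1,3)] image_coset[OF assms]
  show ?thesis
    by (rule lin_homI)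
      (auto simp: quot_carrier s lin_hom_closed[OF assms(4)] lin_hom_add[OF assms(4)]
        lin_hom_smult[OF assms(4)])
qed


section \<open>Free modules and exterior powers\<close>

lemma free_module_module:
  assumes "cring R"
  shows "module R (free_module R S)"
proof -
  interpret R: cring R by fact
  have fin_add: "finite {i. v i \<oplus>\<^bsub>R\<^esub> w i \<noteq> \<zero>\<^bsub>R\<^esub>}"
    if "finite {i. v i \<noteq> \<zero>\<^bsub>R\<^esub>}" "finite {i. w i \<noteq> \<zero>\<^bsub>R\<^esub>}" for v w :: "'c \<Rightarrow> 'a"
    by (rule finite_subset[OF _ finite_UnI[OF that]]) auto
  have fin_smult: "finite {i. r \<otimes>\<^bsub>R\<^esub> v i \<noteq> \<zero>\<^bsub>R\<^esub>}"
    if "finite {i. v i \<noteq> \<zero>\<^bsub>R\<^esub>}" "r \<in> carrier R" for r and v :: "'c \<Rightarrow> 'a"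
    by (rule finite_subset[OF _ that(1)]) (use that(2) in auto)
  have ag: "abelian_group (free_module R S)"
  proof (rule abelian_groupI)
    fix v assume v: "v \<in> carrier (free_module R S)"
    then have c: "\<And>i. v i \<in> carrier R" by (simp add: free_module_def)
    have "(\<lambda>i. \<ominus>\<^bsub>R\<^esub> v i) \<in> carrier (free_module R S)"
      using v c fin_smult[of v "\<ominus>\<^bsub>R\<^esub> \<one>\<^bsub>R\<^esub>"] by (auto simp: free_module_def R.l_minus)
    moreover have "(\<lambda>i. \<ominus>\<^bsub>R\<^esub> v i) \<oplus>\<^bsub>free_module R S\<^esub> v = \<zero>\<^bsub>free_module R S\<^esub>"
      using c by (auto simp: free_module_def R.l_neg)
    ultimately show "\<exists>w\<in>carrier (free_module R S). w \<oplus>\<^bsub>free_module R S\<^esub> v = \<zero>\<^bsub>free_module R S\<^esub>"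
      by blast
  qed (auto simp: free_module_def R.a_ac fin_add intro!: ext)
  show ?thesis
    by (intro moduleI assms ag)
      (auto simp: free_module_def R.l_distr R.r_distr R.m_assoc fin_smult)
qed

lemma free_module_simps:
  "v \<oplus>\<^bsub>free_module R S\<^esub> w = (\<lambda>i. v i \<oplus>\<^bsub>R\<^esub> w i)"
  "r \<odot>\<^bsub>free_module R S\<^esub> v = (\<lambda>i. r \<otimes>\<^bsub>R\<^esub> v i)"
  "\<zero>\<^bsub>free_module R S\<^esub> = (\<lambda>i. \<zero>\<^bsub>R\<^esub>)"
  by (simp_all add: free_module_def)

lemma basis_vec_closed:
  assumes "cring R" "i \<in> S"
  shows "basis_vec R i \<in> carrier (free_module R S)"
proof -
  interpret R: cring R by fact
  have "{j. basis_vec R i j \<noteq> \<zero>\<^bsub>R\<^esub>} \<subseteq> {i}" by (auto simp: basis_vec_def)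
  then have "finite {j. basis_vec R i j \<noteq> \<zero>\<^bsub>R\<^esub>}" by (rule finite_subset) simp
  then show ?thesis using assms(2) by (auto simp: free_module_def basis_vec_def)
qed

text \<open>The sum runs over the support of \<open>v\<close>, exactly as in \<open>ce_diff\<close>,
  so that the differential is this linear extension passed to cosets.\<close>

definition free_lift :: "('k, 'r) ring_scheme \<Rightarrow> ('k, 'b, 'n) module_scheme \<Rightarrow> ('i \<Rightarrow> 'b) \<Rightarrow> ('i \<Rightarrow> 'k) \<Rightarrow> 'b"
  where "free_lift R N f v = (\<Oplus>\<^bsub>N\<^esub> i \<in> {i. v i \<noteq> \<zero>\<^bsub>R\<^esub>}. v i \<odot>\<^bsub>N\<^esub> f i)"

text \<open>Two vectors and their sum have different supports. To prove additivity all three sums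
  are taken over one finite set, where the extra summands are zero.\<close>

lemma free_lift_superset:
  assumes "module R N" "\<And>i. i \<in> S \<Longrightarrow> f i \<in> carrier N" "v \<in> carrier (free_module R S)"
    and "finite I" "{i. v i \<noteq> \<zero>\<^bsub>R\<^esub>} \<subseteq> I" "I \<subseteq> S"
  shows "free_lift R N f v = (\<Oplus>\<^bsub>N\<^esub> i \<in> I. v i \<odot>\<^bsub>N\<^esub> f i)"
proof -
  interpret N: module R N by fact
  have v: "\<And>i. v i \<in> carrier R" using assms(3) by (simp add: free_module_def)
  have sub: "{i. v i \<noteq> \<zero>\<^bsub>R\<^esub>} \<subseteq> S" using assms(3) by (auto simp: free_module_def)
  show ?thesis unfolding free_lift_def
    by (rule N.M.add.finprod_mono_neutral_cong_left[OF assms(4,5)])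
      (use assms(2,6) v in auto)
qed

lemma free_lift_lin_hom:
  assumes "module R N" "\<And>i. i \<in> S \<Longrightarrow> f i \<in> carrier N"
  shows "free_lift R N f \<in> lin_hom R (free_module R S) N"
proof -
  interpret N: module R N by fact
  let ?F = "free_module R S"
  interpret F: module R ?F by (rule free_module_module) (rule N.R.is_cring)
  have supp: "finite {i. v i \<noteq> \<zero>\<^bsub>R\<^esub>}" "{i. v i \<noteq> \<zero>\<^bsub>R\<^esub>} \<subseteq> S" "\<And>i. v i \<in> carrier R"
    if "v \<in> carrier ?F" for v
    using that by (auto simp: free_module_def)
  show ?thesis
  proof (rule lin_homI)
    fix v assume v: "v \<in> carrier ?F"
    note [simp] = supp(1,3)[OF v]
    show "free_lift R N f v \<in> carrier N"
      unfolding free_lift_def using subsetD[OF supp(2)[OF v]] assms(2) by (intro N.finsum_closed) auto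
    {
      fix w assume w: "w \<in> carrier ?F"
      let ?I = "{i. v i \<noteq> \<zero>\<^bsub>R\<^esub>} \<union> {i. w i \<noteq> \<zero>\<^bsub>R\<^esub>}"
      note [simp] = supp(1,3)[OF w]
      have c: "f i \<in> carrier N" if "i \<in> ?I" for i using that assms(2) supp(2)[OF v] supp(2)[OF w] by auto
      have "free_lift R N f (v \<oplus>\<^bsub>?F\<^esub> w) = (\<Oplus>\<^bsub>N\<^esub>i\<in>?I. (v \<oplus>\<^bsub>?F\<^esub> w) i \<odot>\<^bsub>N\<^esub> f i)"
        using F.a_closed[OF v w] supp(2)[OF v] supp(2)[OF w]
        by (intro free_lift_superset[OF assms]) (auto simp: free_module_simps(1))
      also have "\<dots> = (\<Oplus>\<^bsub>N\<^esub>i\<in>?I. v i \<odot>\<^bsub>N\<^esub> f i \<oplus>\<^bsub>N\<^esub> w i \<odot>\<^bsub>N\<^esub> f i)"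
        using c by (intro N.finsum_cong') (auto simp: free_module_simps N.smult_l_distr)
      also have "\<dots> = (\<Oplus>\<^bsub>N\<^esub>i\<in>?I. v i \<odot>\<^bsub>N\<^esub> f i) \<oplus>\<^bsub>N\<^esub> (\<Oplus>\<^bsub>N\<^esub>i\<in>?I. w i \<odot>\<^bsub>N\<^esub> f i)"
        using c by (intro N.finsum_addf) auto
      also have "(\<Oplus>\<^bsub>N\<^esub>i\<in>?I. v i \<odot>\<^bsub>N\<^esub> f i) = free_lift R N f v"
        using supp(2)[OF v] supp(2)[OF w] v
        by (intro free_lift_superset[OF assms, symmetric]) auto
      also have "(\<Oplus>\<^bsub>N\<^esub>i\<in>?I. w i \<odot>\<^bsub>N\<^esub> f i) = free_lift R N f w"
        using supp(2)[OF v] supp(2)[OF w] w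
        by (intro free_lift_superset[OF assms, symmetric]) auto
      finally show "free_lift R N f (v \<oplus>\<^bsub>?F\<^esub> w) = free_lift R N f v \<oplus>\<^bsub>N\<^esub> free_lift R N f w" .
    }
    fix r assume r: "r \<in> carrier R"
    let ?I = "{i. v i \<noteq> \<zero>\<^bsub>R\<^esub>}"
    have c: "f i \<in> carrier N" if "i \<in> ?I" for i using that assms(2) supp(2)[OF v] by auto
    have "free_lift R N f (r \<odot>\<^bsub>?F\<^esub> v) = (\<Oplus>\<^bsub>N\<^esub>i\<in>?I. (r \<odot>\<^bsub>?F\<^esub> v) i \<odot>\<^bsub>N\<^esub> f i)"
      using F.smult_closed[OF r v] r supp(2)[OF v]
      by (intro free_lift_superset[OF assms]) (auto simp: free_module_simps(2))
    also have "\<dots> = (\<Oplus>\<^bsub>N\<^esub>i\<in>?I. r \<odot>\<^bsub>N\<^esub> (v i \<odot>\<^bsub>N\<^esub> f i))"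
      using c r by (intro N.finsum_cong') (auto simp: free_module_simps N.smult_assoc1)
    also have "\<dots> = r \<odot>\<^bsub>N\<^esub> free_lift R N f v"
      unfolding free_lift_def using c r by (intro N.finsum_smult_ldistr[symmetric]) auto
    finally show "free_lift R N f (r \<odot>\<^bsub>?F\<^esub> v) = r \<odot>\<^bsub>N\<^esub> free_lift R N f v" .
  qed
qed

lemma free_lift_basis_vec:
  assumes "module R N" "f i \<in> carrier N"
  shows "free_lift R N f (basis_vec R i) = f i"
proof -
  interpret N: module R N by fact
  have "free_lift R N f (basis_vec R i) = (\<Oplus>\<^bsub>N\<^esub> j \<in> {i}. basis_vec R i j \<odot>\<^bsub>N\<^esub> f j)"
    using assms basis_vec_closed[OF N.R.is_cring, of i "{i}"]
    by (intro free_lift_superset[where S = "{i}"]) (auto simp: basis_vec_def)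
  then show ?thesis using assms(2) by (simp add: basis_vec_def)
qed

text \<open>Meant for \<open>f\<close> the differential on 4-tuples and \<open>g\<close> a linear
  form that kills each of its values: \<open>g\<close> then kills every boundary.\<close>

lemma lin_hom_free_lift_zero:
  assumes "module R N" "module R K" "g \<in> lin_hom R N K" "v \<in> carrier (free_module R S)"
    and "\<And>i. i \<in> S \<Longrightarrow> f i \<in> carrier N" "\<And>i. i \<in> S \<Longrightarrow> g (f i) = \<zero>\<^bsub>K\<^esub>"
  shows "g (free_lift R N f v) = \<zero>\<^bsub>K\<^esub>"
proof -
  interpret N: module R N by fact
  interpret K: module R K by fact
  have v: "finite {i. v i \<noteq> \<zero>\<^bsub>R\<^esub>}" "{i. v i \<noteq> \<zero>\<^bsub>R\<^esub>} \<subseteq> S" "\<And>i. v i \<in> carrier R"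
    using assms(4) by (auto simp: free_module_def)
  have "g (free_lift R N f v) = (\<Oplus>\<^bsub>K\<^esub> i \<in> {i. v i \<noteq> \<zero>\<^bsub>R\<^esub>}. g (v i \<odot>\<^bsub>N\<^esub> f i))"
    unfolding free_lift_def
    using v assms(5) by (intro lin_hom_finsum[OF assms(1-3)]) auto
  also have "\<dots> = (\<Oplus>\<^bsub>K\<^esub> i \<in> {i. v i \<noteq> \<zero>\<^bsub>R\<^esub>}. \<zero>\<^bsub>K\<^esub>)"
    using v assms(5,6) by (intro K.finsum_cong') (auto simp: lin_hom_smult[OF assms(3)] subset_iff)
  finally show ?thesis by simp
qed

section \<open>Alternating multilinear maps and the universal property of exterior powers\<close>

definition alt_multilin ::
    "('k, 'r) ring_scheme \<Rightarrow> ('k, 'a, 'm) module_scheme \<Rightarrow> nat \<Rightarrow> ('k, 'b, 'n) module_scheme \<Rightarrow>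
     ('a list \<Rightarrow> 'b) \<Rightarrow> bool"
  where "alt_multilin R M n N f \<longleftrightarrow>
    (\<forall>xs\<in>tuples M n. f xs \<in> carrier N) \<and>
    (\<forall>xs\<in>tuples M n. \<forall>i<n. \<forall>x\<in>carrier M. \<forall>y\<in>carrier M.
      f (xs[i := x \<oplus>\<^bsub>M\<^esub> y]) = f (xs[i := x]) \<oplus>\<^bsub>N\<^esub> f (xs[i := y])) \<and>
    (\<forall>xs\<in>tuples M n. \<forall>i<n. \<forall>r\<in>carrier R. \<forall>x\<in>carrier M.
      f (xs[i := r \<odot>\<^bsub>M\<^esub> x]) = r \<odot>\<^bsub>N\<^esub> f (xs[i := x])) \<and>
    (\<forall>xs\<in>tuples M n. \<forall>i j. i < j \<longrightarrow> j < n \<longrightarrow> xs ! i = xs ! j \<longrightarrow> f xs = \<zero>\<^bsub>N\<^esub>)"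

lemma tuples_update: "xs \<in> tuples M n \<Longrightarrow> x \<in> carrier M \<Longrightarrow> xs[i := x] \<in> tuples M n"
  by (auto simp: tuples_def dest!: set_update_subset_insert[THEN subsetD])

lemma ext_relations_closed:
  assumes "module R M"
  shows "ext_relations R M n \<subseteq> carrier (free_module R (tuples M n))"
proof -
  interpret M: module R M by fact
  interpret F: module R "free_module R (tuples M n)"
    by (rule free_module_module) (rule M.R.is_cring)
  show ?thesis
    by (auto simp: ext_relations_def Let_def intro!: F.minus_closed F.a_closed F.smult_closed
        basis_vec_closed[OF M.R.is_cring] tuples_update)
qed

lemma ext_null_submodule:
  "module R M \<Longrightarrow> submodule (ext_null R M n) R (free_module R (tuples M n))"
  unfolding ext_null_def
  by (intro mod_span_submodule free_module_module ext_relations_closed module.axioms)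

lemma ext_power_module: "module R M \<Longrightarrow> module R (ext_power R M n)"
  unfolding ext_power_def
  by (intro quot_module_module ext_null_submodule free_module_module module.axioms)

text \<open>\<open>alt_multilin\<close> is phrased with list updates in order to match the three
  families in \<open>ext_relations\<close>: each generator of the null submodule is sent to zero by
  one clause.\<close>

lemma ext_null_vanish:
  assumes "module R M" "module R N" "alt_multilin R M n N f" "v \<in> ext_null R M n"
  shows "free_lift R N f v = \<zero>\<^bsub>N\<^esub>"
proof -
  interpret M: module R M by fact
  interpret N: module R N by fact
  let ?F = "free_module R (tuples M n)"
  interpret F: module R ?F by (rule free_module_module) (rule M.R.is_cring)
  have fc: "\<And>xs. xs \<in> tuples M n \<Longrightarrow> f xs \<in> carrier N" using assms(3) by (simp add: alt_multilin_def)
  have h: "free_lift R N f \<in> lin_hom R ?F N" by (rule free_lift_lin_hom[OF assms(2) fc])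
  note b = basis_vec_closed[OF M.R.is_cring, of _ "tuples M n"]
  note s = lin_hom_add[OF h] lin_hom_smult[OF h] lin_hom_minus[OF F.module_axioms assms(2) h]
    free_lift_basis_vec[OF assms(2)]
  have alt: "\<And>xs i x y. \<lbrakk>xs \<in> tuples M n; i < n; x \<in> carrier M; y \<in> carrier M\<rbrakk> \<Longrightarrow>
      f (xs[i := x \<oplus>\<^bsub>M\<^esub> y]) = f (xs[i := x]) \<oplus>\<^bsub>N\<^esub> f (xs[i := y])"
    "\<And>xs i r x. \<lbrakk>xs \<in> tuples M n; i < n; r \<in> carrier R; x \<in> carrier M\<rbrakk> \<Longrightarrow>
      f (xs[i := r \<odot>\<^bsub>M\<^esub> x]) = r \<odot>\<^bsub>N\<^esub> f (xs[i := x])"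
    "\<And>xs i j. \<lbrakk>xs \<in> tuples M n; i < j; j < n; xs ! i = xs ! j\<rbrakk> \<Longrightarrow> f xs = \<zero>\<^bsub>N\<^esub>"
    using assms(3) unfolding alt_multilin_def by blast+
  have "free_lift R N f x = \<zero>\<^bsub>N\<^esub>" if x: "x \<in> ext_relations R M n" for x
    using x unfolding ext_relations_def Let_def
    by (elim UnE CollectE exE conjE)
      (simp_all add: a_minus_def s b tuples_update fc alt(1,2) alt(3) N.r_neg)
  then show ?thesis
    by (rule mod_span_vanish[OF F.module_axioms assms(2) h ext_relations_closed[OF assms(1)] _
          assms(4)[unfolded ext_null_def]])
qed

lemma ext_lift_lin_hom:
  assumes "module R M" "module R N" "alt_multilin R M n N f"
  shows "(\<lambda>A. the_elem (free_lift R N f ` A)) \<in> lin_hom R (ext_power R M n) N"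
proof -
  have "module R (free_module R (tuples M n))"
    by (intro free_module_module module.axioms) fact
  moreover have "free_lift R N f \<in> lin_hom R (free_module R (tuples M n)) N"
    using assms by (intro free_lift_lin_hom) (auto simp: alt_multilin_def)
  ultimately show ?thesis
    unfolding ext_power_def
    by (rule quot_lift_lin_hom[OF _ assms(2) ext_null_submodule[OF assms(1)]])
      (rule ext_null_vanish[OF assms])
qed

text \<open>An element of an exterior power is in general not a single wedge, so the lift has to be
  known on the coset of an arbitrary \<open>v\<close>. Boundaries need it in this
  generality.\<close>

lemma ext_lift_coset:
  assumes "module R M" "module R N" "alt_multilin R M n N f" "v \<in> carrier (free_module R (tuples M n))"
  shows "the_elem (free_lift R N f ` (ext_null R M n +>\<^bsub>free_module R (tuples M n)\<^esub> v)) = free_lift R N f v"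
proof -
  have "module R (free_module R (tuples M n))"
    by (intro free_module_module module.axioms) fact
  moreover have "free_lift R N f \<in> lin_hom R (free_module R (tuples M n)) N"
    using assms by (intro free_lift_lin_hom) (auto simp: alt_multilin_def)
  ultimately have "free_lift R N f ` (ext_null R M n +>\<^bsub>free_module R (tuples M n)\<^esub> v) = {free_lift R N f v}"
    using assms(4)
    by (intro image_coset[OF _ assms(2) ext_null_submodule[OF assms(1)]] ext_null_vanish[OF assms(1-3)])
  then show ?thesis by simp
qed

lemma ext_lift_wedge:
  assumes "module R M" "module R N" "alt_multilin R M n N f" "xs \<in> tuples M n"
  shows "the_elem (free_lift R N f ` wedge R M xs) = f xs"
proof -
  have n: "length xs = n" using assms(4) by (simp add: tuples_def)
  show ?thesis
    using assms unfolding wedge_def n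
    by (subst ext_lift_coset)
      (auto simp: basis_vec_closed module.axioms alt_multilin_def free_lift_basis_vec)
qed

lemma ext_power_carrier:
  "carrier (ext_power R M n) =
    (\<lambda>v. ext_null R M n +>\<^bsub>free_module R (tuples M n)\<^esub> v) ` carrier (free_module R (tuples M n))"
  unfolding ext_power_def by (rule quot_carrier)

lemma wedge_alt_multilin:
  assumes "module R M"
  shows "alt_multilin R M n (ext_power R M n) (wedge R M)"
proof -
  interpret M: module R M by fact
  let ?F = "free_module R (tuples M n)"
  interpret F: module R ?F by (rule free_module_module) (rule M.R.is_cring)
  let ?N = "ext_null R M n"
  define p where "p = (\<lambda>x. ?N +>\<^bsub>?F\<^esub> x)"
  have sub: "submodule ?N R ?F" by (rule ext_null_submodule) fact
  have p: "p \<in> lin_hom R ?F (ext_power R M n)"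
    unfolding ext_power_def p_def by (rule quot_proj_lin_hom[OF F.module_axioms sub])
  interpret E: module R "ext_power R M n" by (rule ext_power_module) fact
  have rel: "p x = \<zero>\<^bsub>ext_power R M n\<^esub>" if "x \<in> ext_relations R M n" for x
  proof -
    have "x \<in> ?N" using that unfolding ext_null_def by (rule mod_span_incl)
    moreover have "x \<in> carrier ?F" using that ext_relations_closed[OF assms] by auto
    ultimately show ?thesis
      using coset_eq_zero_iff[OF F.module_axioms sub] by (simp add: p_def ext_power_def quot_zero)
  qed
  have b: "basis_vec R xs \<in> carrier ?F" if "xs \<in> tuples M n" for xs
    using that by (rule basis_vec_closed[OF M.R.is_cring])
  have w: "wedge R M xs = p (basis_vec R xs)" if "xs \<in> tuples M n" for xs
    using that by (simp add: wedge_def p_def tuples_def)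
  \<comment> \<open>The additivity and homogeneity relations are differences, so they become
    equations between cosets; the relation for repeated entries uses \<open>rel\<close>
    directly.\<close>
  have eq: "p x = p y" if "x \<ominus>\<^bsub>?F\<^esub> y \<in> ext_relations R M n" "x \<in> carrier ?F" "y \<in> carrier ?F" for x y
  proof -
    have "p x \<ominus>\<^bsub>ext_power R M n\<^esub> p y = \<zero>\<^bsub>ext_power R M n\<^esub>"
      using rel[OF that(1)] that(2,3)
      by (simp add: a_minus_def lin_hom_add[OF p] lin_hom_minus[OF F.module_axioms E.module_axioms p])
    then show ?thesis
      using lin_hom_closed[OF p] that(2,3)
      by (metis E.M.minus_equality E.M.minus_minus E.M.a_inv_closed a_minus_def)
  qed
  show ?thesis unfolding alt_multilin_def
  proof (intro conjI ballI allI impI)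
    fix xs i x y assume a: "xs \<in> tuples M n" "i < n" "x \<in> carrier M" "y \<in> carrier M"
    have "p (basis_vec R (xs[i := x \<oplus>\<^bsub>M\<^esub> y])) =
      p (basis_vec R (xs[i := x]) \<oplus>\<^bsub>?F\<^esub> basis_vec R (xs[i := y]))"
      using a by (intro eq) (auto simp: ext_relations_def Let_def b tuples_update)
    with a show "wedge R M (xs[i := x \<oplus>\<^bsub>M\<^esub> y]) =
        wedge R M (xs[i := x]) \<oplus>\<^bsub>ext_power R M n\<^esub> wedge R M (xs[i := y])"
      by (simp add: w tuples_update lin_hom_add[OF p] b)
  next
    fix xs i r x assume a: "xs \<in> tuples M n" "i < n" "r \<in> carrier R" "x \<in> carrier M"
    have "p (basis_vec R (xs[i := r \<odot>\<^bsub>M\<^esub> x])) = p (r \<odot>\<^bsub>?F\<^esub> basis_vec R (xs[i := x]))"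
      using a by (intro eq) (auto simp: ext_relations_def Let_def b tuples_update)
    with a show "wedge R M (xs[i := r \<odot>\<^bsub>M\<^esub> x]) = r \<odot>\<^bsub>ext_power R M n\<^esub> wedge R M (xs[i := x])"
      by (simp add: w tuples_update lin_hom_smult[OF p] b)
  next
    fix xs i j assume a: "xs \<in> tuples M n" "i < j" "j < n" "xs ! i = xs ! j"
    then show "wedge R M xs = \<zero>\<^bsub>ext_power R M n\<^esub>"
      by (simp only: w, intro rel) (auto simp: ext_relations_def Let_def)
  next
    fix xs assume a: "xs \<in> tuples M n"
    then show "wedge R M xs \<in> carrier (ext_power R M n)"
      using lin_hom_closed[OF p] by (simp add: w b)
  qed
qed


section \<open>Abelianization\<close>

lemma lie_algebra_module: "lie_algebra R L \<Longrightarrow> module R L"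
  by (rule lie_algebra.axioms)

lemma lie_hom_lin_hom: "h \<in> lie_hom R L L' \<Longrightarrow> h \<in> lin_hom R L L'"
  by (simp add: lie_hom_def)

lemma lie_hom_closed: "h \<in> lie_hom R L L' \<Longrightarrow> x \<in> carrier L \<Longrightarrow> h x \<in> carrier L'"
  by (rule lin_hom_closed) (rule lie_hom_lin_hom)

lemma lie_hom_bracket:
  "h \<in> lie_hom R L L' \<Longrightarrow> x \<in> carrier L \<Longrightarrow> y \<in> carrier L \<Longrightarrow> h (bracket L x y) = bracket L' (h x) (h y)"
  by (simp add: lie_hom_def)

lemma lie_hom_comp:
  assumes "h \<in> lie_hom R L L'" "k \<in> lie_hom R L' L''"
  shows "(\<lambda>x. k (h x)) \<in> lie_hom R L L''"
  using lin_hom_comp[OF assms[THEN lie_hom_lin_hom]]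
  by (simp add: lie_hom_def[of R L L''] lie_hom_bracket[OF assms(1)] lie_hom_bracket[OF assms(2)]
      lie_hom_closed[OF assms(1)])

lemma lie_hom_id: "lie_algebra R L \<Longrightarrow> (\<lambda>x. x) \<in> lie_hom R L L"
  by (auto simp: lie_hom_def lin_hom_def)

lemma derived_ideal_generators_closed:
  "lie_algebra R L \<Longrightarrow> {bracket L x y | x y. x \<in> carrier L \<and> y \<in> carrier L} \<subseteq> carrier L"
  by (auto intro: lie_algebra.bracket_closed)

lemma derived_ideal_submodule: "lie_algebra R L \<Longrightarrow> submodule (derived_ideal R L) R L"
  unfolding derived_ideal_def
  by (intro mod_span_submodule lie_algebra_module derived_ideal_generators_closed)

lemma ab_obj_module: "lie_algebra R L \<Longrightarrow> module R (ab_obj R L)"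
  unfolding ab_obj_def by (intro quot_module_module lie_algebra_module derived_ideal_submodule)

lemma ab_obj_carrier: "carrier (ab_obj R L) = (\<lambda>x. derived_ideal R L +>\<^bsub>L\<^esub> x) ` carrier L"
  unfolding ab_obj_def by (rule quot_carrier)

lemma ab_proj_lin_hom:
  assumes "lie_algebra R L" "lie_algebra R L'" "f \<in> lie_hom R L L'"
  shows "(\<lambda>x. derived_ideal R L' +>\<^bsub>L'\<^esub> f x) \<in> lin_hom R L (ab_obj R L')"
  unfolding ab_obj_def
  by (rule lin_hom_comp[OF lie_hom_lin_hom[OF assms(3)] quot_proj_lin_hom])
    (use assms in \<open>auto intro: lie_algebra_module derived_ideal_submodule\<close>)

text \<open>A homomorphism sends brackets to brackets, so \<open>f\<close> followed by the
  projection kills the generators of the derived ideal, and by linearity their span.\<close>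

lemma ab_proj_vanish:
  assumes "lie_algebra R L" "lie_algebra R L'" "f \<in> lie_hom R L L'" "x \<in> derived_ideal R L"
  shows "derived_ideal R L' +>\<^bsub>L'\<^esub> f x = \<zero>\<^bsub>ab_obj R L'\<^esub>"
proof (rule mod_span_vanish[where x = x, OF lie_algebra_module[OF assms(1)] ab_obj_module[OF assms(2)]
      ab_proj_lin_hom[OF assms(1-3)] derived_ideal_generators_closed[OF assms(1)]
      _ assms(4)[unfolded derived_ideal_def]])
  fix z assume "z \<in> {bracket L x y | x y. x \<in> carrier L \<and> y \<in> carrier L}"
  then obtain x y where z: "z = bracket L x y" "x \<in> carrier L" "y \<in> carrier L" by auto
  have "f z = bracket L' (f x) (f y)"
    using z assms(3) by (simp add: lie_hom_bracket)
  then have "f z \<in> derived_ideal R L'"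
    unfolding derived_ideal_def using z lie_hom_closed[OF assms(3)]
    by (intro mod_span_incl) auto
  moreover have "f z \<in> carrier L'"
    using lie_hom_closed[OF assms(3)] z lie_algebra.bracket_closed[OF assms(1)] by auto
  ultimately show "derived_ideal R L' +>\<^bsub>L'\<^esub> f z = \<zero>\<^bsub>ab_obj R L'\<^esub>"
    using coset_eq_zero_iff[OF lie_algebra_module derived_ideal_submodule, OF assms(2,2)]
    by (simp add: ab_obj_def quot_zero)
qed

lemma ab_map_lin_hom:
  assumes "lie_algebra R L" "lie_algebra R L'" "f \<in> lie_hom R L L'"
  shows "ab_map R L L' f \<in> lin_hom R (ab_obj R L) (ab_obj R L')"
  unfolding ab_map_def[abs_def] ab_obj_def[of R L]
  by (rule quot_lift_lin_hom[OF lie_algebra_module[OF assms(1)] ab_obj_module[OF assms(2)]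
        derived_ideal_submodule[OF assms(1)] ab_proj_lin_hom[OF assms]])
    (rule ab_proj_vanish[OF assms])

lemma ab_map_coset:
  assumes "lie_algebra R L" "lie_algebra R L'" "f \<in> lie_hom R L L'" "x \<in> carrier L"
  shows "ab_map R L L' f (derived_ideal R L +>\<^bsub>L\<^esub> x) = derived_ideal R L' +>\<^bsub>L'\<^esub> f x"
proof -
  have "(\<lambda>x. derived_ideal R L' +>\<^bsub>L'\<^esub> f x) ` (derived_ideal R L +>\<^bsub>L\<^esub> x) =
      {derived_ideal R L' +>\<^bsub>L'\<^esub> f x}"
    by (rule image_coset[OF lie_algebra_module[OF assms(1)] ab_obj_module[OF assms(2)]
        derived_ideal_submodule[OF assms(1)] ab_proj_lin_hom[OF assms(1-3)] _ assms(4)])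
      (rule ab_proj_vanish[OF assms(1-3)])
  then show ?thesis by (simp add: ab_map_def)
qed


section \<open>The free-forgetful comonad\<close>

text \<open>The existence half of freeness for a prescribed evaluation: \<open>com_map\<close> and
  \<open>com_counit\<close> are particular instances of \<open>term_eval\<close>, about which the
  existential statement \<open>free_lie_universal\<close> says nothing.\<close>

lemma term_eval_lie_hom:
  assumes "module R M" "lie_algebra R L" "(\<lambda>x. \<phi> (\<iota> x)) \<in> lin_hom R M L"
  shows "term_eval L \<phi> \<in> lie_hom R (free_lie R \<iota> M) L"
proof -
  have c: "term_eval L \<phi> t \<in> carrier L" if "t \<in> free_terms R \<iota> M" for t
    using assms(2,3) that by (intro term_eval_closed) (auto simp: lin_hom_def)
  have rep: "term_eval L \<phi> (free_rep R \<iota> M t) = term_eval L \<phi> t" if "t \<in> free_terms R \<iota> M" for t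
    using term_eval_eq[OF assms free_rep_eq[OF that]] by simp
  show ?thesis
    by (auto simp: lie_hom_def lin_hom_def free_lie_simps rep c)
qed

lemma term_eval_free_gen:
  assumes "module R M" "lie_algebra R L" "(\<lambda>x. \<phi> (\<iota> x)) \<in> lin_hom R M L" "x \<in> carrier M"
  shows "term_eval L \<phi> (free_gen R \<iota> M x) = \<phi> (\<iota> x)"
  using term_eval_eq[OF assms(1-3) free_rep_eq[OF free_terms.gen, OF assms(4)]]
  by (simp add: free_gen_def)

lemma free_gen_closed: "x \<in> carrier M \<Longrightarrow> free_gen R \<iota> M x \<in> carrier (free_lie R \<iota> M)"
  using lin_hom_closed[OF free_gen_lin_hom] .

text \<open>The uniqueness half of freeness. Identities between morphisms out of a free Lie algebra
  are reduced by it to a check on generators.\<close>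

lemma free_lie_hom_ext:
  assumes "module R M" "lie_algebra R L" "inj_on \<iota> (carrier M)"
    and "h \<in> lie_hom R (free_lie R \<iota> M) L" "h' \<in> lie_hom R (free_lie R \<iota> M) L"
    and "\<And>x. x \<in> carrier M \<Longrightarrow> h (free_gen R \<iota> M x) = h' (free_gen R \<iota> M x)"
    and "y \<in> carrier (free_lie R \<iota> M)"
  shows "h y = h' y"
proof -
  have "(\<lambda>x. h (free_gen R \<iota> M x)) \<in> lin_hom R M L"
    by (rule lin_hom_comp[OF free_gen_lin_hom lie_hom_lin_hom[OF assms(4)]])
  from free_lie_universal[OF assms(1-3) this] obtain k where
    "\<And>g. \<lbrakk>g \<in> lie_hom R (free_lie R \<iota> M) L;
      \<forall>x\<in>carrier M. g (free_gen R \<iota> M x) = h (free_gen R \<iota> M x)\<rbrakk> \<Longrightarrow> g y = k y"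
    using assms(7) by blast
  from this[OF assms(4)] this[OF assms(5)] assms(6) show ?thesis by simp
qed

lemma com_obj_lie_algebra: "lie_algebra R L \<Longrightarrow> lie_algebra R (com_obj R L)"
  unfolding com_obj_def by (intro free_lie_lie_algebra lie_algebra_module)

lemma com_obj_pow_lie_algebra: "lie_algebra R L \<Longrightarrow> lie_algebra R ((com_obj R ^^ n) L)"
  by (induction n) (auto intro: com_obj_lie_algebra)

lemma com_obj_hom_ext:
  assumes "lie_algebra R L" "lie_algebra R L'"
    and "h \<in> lie_hom R (com_obj R L) L'" "h' \<in> lie_hom R (com_obj R L) L'"
    and "\<And>x. x \<in> carrier L \<Longrightarrow> h (free_gen R Inr L x) = h' (free_gen R Inr L x)"
    and "y \<in> carrier (com_obj R L)"
  shows "h y = h' y"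
  by (rule free_lie_hom_ext[OF lie_algebra_module[OF assms(1)] assms(2) inj_Inr
        assms(3-6)[unfolded com_obj_def]])

lemma com_counit_lie_hom:
  assumes "lie_algebra R L"
  shows "com_counit L \<in> lie_hom R (com_obj R L) L"
  unfolding com_counit_def com_obj_def
  using lie_hom_id[OF assms]
  by (intro term_eval_lie_hom lie_algebra_module assms) (simp add: lie_hom_lin_hom)

lemma com_counit_free_gen:
  assumes "lie_algebra R L" "x \<in> carrier L"
  shows "com_counit L (free_gen R Inr L x) = x"
  unfolding com_counit_def
  using lie_hom_id[OF assms(1)] assms
  by (subst term_eval_free_gen) (auto intro: lie_algebra_module simp: lie_hom_lin_hom)

lemma com_map_lie_hom:
  assumes "lie_algebra R L" "lie_algebra R L'" "f \<in> lie_hom R L L'"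
  shows "com_map R L' f \<in> lie_hom R (com_obj R L) (com_obj R L')"
  unfolding com_map_def com_obj_def
  using lin_hom_comp[OF lie_hom_lin_hom[OF assms(3)] free_gen_lin_hom]
  by (intro term_eval_lie_hom lie_algebra_module free_lie_lie_algebra assms) simp

lemma com_map_free_gen:
  assumes "lie_algebra R L" "lie_algebra R L'" "f \<in> lie_hom R L L'" "x \<in> carrier L"
  shows "com_map R L' f (free_gen R Inr L x) = free_gen R Inr L' (f x)"
  unfolding com_map_def com_obj_def
  using lin_hom_comp[OF lie_hom_lin_hom[OF assms(3)] free_gen_lin_hom] assms
  by (subst term_eval_free_gen) (auto intro: lie_algebra_module free_lie_lie_algebra)

text \<open>A morphism is a total function on terms of which only the values on the carrier matter,
  but \<open>com_map\<close> takes the whole function. Functoriality therefore holds up to equality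
  on carriers, and this congruence is needed to rewrite under the comonad.\<close>

lemma com_map_cong:
  assumes "lie_algebra R L" "lie_algebra R L'" "f \<in> lie_hom R L L'" "g \<in> lie_hom R L L'"
    and "\<And>x. x \<in> carrier L \<Longrightarrow> f x = g x" "y \<in> carrier (com_obj R L)"
  shows "com_map R L' f y = com_map R L' g y"
  by (rule com_obj_hom_ext[OF assms(1) com_obj_lie_algebra[OF assms(2)] com_map_lie_hom[OF assms(1-3)]
        com_map_lie_hom[OF assms(1,2,4)] _ assms(6)])
    (simp add: com_map_free_gen[OF assms(1-3)] com_map_free_gen[OF assms(1,2,4)] assms(5))

lemma com_map_id:
  assumes "lie_algebra R L" "y \<in> carrier (com_obj R L)"
  shows "com_map R L (\<lambda>x. x) y = y"
proof -
  note i = lie_hom_id[OF assms(1)]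
  show ?thesis
    by (rule com_obj_hom_ext[OF assms(1) com_obj_lie_algebra[OF assms(1)] com_map_lie_hom[OF assms(1,1) i]
        lie_hom_id[OF com_obj_lie_algebra[OF assms(1)]] _ assms(2)])
      (simp add: com_map_free_gen[OF assms(1,1) i])
qed

lemma com_map_comp:
  assumes "lie_algebra R L" "lie_algebra R L'" "lie_algebra R L''"
    and "f \<in> lie_hom R L L'" "g \<in> lie_hom R L' L''" "y \<in> carrier (com_obj R L)"
  shows "com_map R L'' g (com_map R L' f y) = com_map R L'' (\<lambda>x. g (f x)) y"
proof -
  note fg = lie_hom_comp[OF assms(4,5)]
  show ?thesis
    by (rule com_obj_hom_ext[OF assms(1) com_obj_lie_algebra[OF assms(3)]
          lie_hom_comp[OF com_map_lie_hom[OF assms(1,2,4)] com_map_lie_hom[OF assms(2,3,5)]]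
          com_map_lie_hom[OF assms(1,3) fg] _ assms(6)])
      (simp add: com_map_free_gen[OF assms(1,2,4)] com_map_free_gen[OF assms(2,3,5)]
        com_map_free_gen[OF assms(1,3) fg] lie_hom_closed[OF assms(4)])
qed

text \<open>It suffices to look at the generator of \<open>x\<close>, where both sides are
  \<open>f x\<close>. The extra degeneracy rests on this naturality.\<close>

lemma com_counit_natural:
  assumes "lie_algebra R L" "lie_algebra R L'" "f \<in> lie_hom R L L'" "y \<in> carrier (com_obj R L)"
  shows "com_counit L' (com_map R L' f y) = f (com_counit L y)"
  by (rule com_obj_hom_ext[OF assms(1,2)
        lie_hom_comp[OF com_map_lie_hom[OF assms(1-3)] com_counit_lie_hom[OF assms(2)]]
        lie_hom_comp[OF com_counit_lie_hom[OF assms(1)] assms(3)] _ assms(4)])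
    (simp add: com_map_free_gen[OF assms(1-3)] com_counit_free_gen[OF assms(1)]
      com_counit_free_gen[OF assms(2)] lie_hom_closed[OF assms(3)])

section \<open>Iterates of the comonad and the face maps\<close>

lemma com_map_pow_lie_hom:
  assumes "lie_algebra R L" "lie_algebra R L'" "f \<in> lie_hom R L L'"
  shows "com_map_pow R L' i f \<in> lie_hom R ((com_obj R ^^ i) L) ((com_obj R ^^ i) L')"
  by (induction i) (auto simp: assms intro!: com_map_lie_hom com_obj_pow_lie_algebra)

lemma com_map_pow_cong:
  assumes "lie_algebra R L" "lie_algebra R L'" "f \<in> lie_hom R L L'" "g \<in> lie_hom R L L'"
    and "\<And>x. x \<in> carrier L \<Longrightarrow> f x = g x" "y \<in> carrier ((com_obj R ^^ i) L)"
  shows "com_map_pow R L' i f y = com_map_pow R L' i g y"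
  using assms(6)
proof (induction i arbitrary: y)
  case (Suc i)
  then have "y \<in> carrier (com_obj R ((com_obj R ^^ i) L))" by simp
  from com_map_cong[OF com_obj_pow_lie_algebra[OF assms(1)] com_obj_pow_lie_algebra[OF assms(2)]
      com_map_pow_lie_hom[OF assms(1-3)] com_map_pow_lie_hom[OF assms(1,2,4)] Suc.IH this]
  show ?case by simp
qed (simp add: assms(5))

lemma com_map_pow_id:
  assumes "lie_algebra R L" "y \<in> carrier ((com_obj R ^^ i) L)"
  shows "com_map_pow R L i (\<lambda>x. x) y = y"
  using assms(2)
proof (induction i arbitrary: y)
  case (Suc i)
  let ?L = "(com_obj R ^^ i) L"
  note l = com_obj_pow_lie_algebra[OF assms(1), of i]
  have "com_map_pow R L (Suc i) (\<lambda>x. x) y = com_map R ?L (\<lambda>x. x) y"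
    using Suc com_map_cong[OF l l com_map_pow_lie_hom[OF assms(1,1) lie_hom_id[OF assms(1)]] lie_hom_id[OF l]]
    by simp
  then show ?case using com_map_id[OF l] Suc.prems by simp
qed simp

lemma com_map_pow_comp:
  assumes "lie_algebra R L" "lie_algebra R L'" "lie_algebra R L''"
    and "f \<in> lie_hom R L L'" "g \<in> lie_hom R L' L''" "y \<in> carrier ((com_obj R ^^ i) L)"
  shows "com_map_pow R L'' i g (com_map_pow R L' i f y) = com_map_pow R L'' i (\<lambda>x. g (f x)) y"
  using assms(6)
proof (induction i arbitrary: y)
  case (Suc i)
  let ?f = "com_map_pow R L' i f" and ?g = "com_map_pow R L'' i g"
  note l = com_obj_pow_lie_algebra[of R _ i, OF assms(1)] com_obj_pow_lie_algebra[of R _ i, OF assms(2)]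
    com_obj_pow_lie_algebra[of R _ i, OF assms(3)]
  note h = com_map_pow_lie_hom[OF assms(1,2,4), of i] com_map_pow_lie_hom[OF assms(2,3,5), of i]
    com_map_pow_lie_hom[OF assms(1,3) lie_hom_comp[OF assms(4,5)], of i]
  have y: "y \<in> carrier (com_obj R ((com_obj R ^^ i) L))" using Suc.prems by simp
  have "com_map_pow R L'' (Suc i) g (com_map_pow R L' (Suc i) f y) =
      com_map R ((com_obj R ^^ i) L'') (\<lambda>x. ?g (?f x)) y"
    using com_map_comp[OF l h(1,2) y] by simp
  also have "\<dots> = com_map_pow R L'' (Suc i) (\<lambda>x. g (f x)) y"
    using com_map_cong[OF l(1,3) lie_hom_comp[OF h(1,2)] h(3) Suc.IH y] by simp
  finally show ?case .
qed simp

text \<open>Both sides unfold to the same nested \<open>com_map\<close>, so this is an equality of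
  functions, not only of their values on carriers. It separates the outer iterates from the inner
  ones, on which a counit acts.\<close>

lemma com_map_pow_add:
  "com_map_pow R L' (i + j) f = com_map_pow R ((com_obj R ^^ j) L') i (com_map_pow R L' j f)"
  by (induction i) (simp_all add: funpow_add)

lemma com_face_lie_hom:
  assumes "lie_algebra R L" "i \<le> n"
  shows "com_face R L n i \<in> lie_hom R ((com_obj R ^^ Suc n) L) ((com_obj R ^^ n) L)"
proof -
  let ?L = "(com_obj R ^^ (n - i)) L"
  have l: "lie_algebra R ?L" by (rule com_obj_pow_lie_algebra[OF assms(1)])
  \<comment> \<open>Here \<open>i \<le> n\<close> enters: the truncated difference
    \<open>n - i\<close> has to be the true one for the exponents to add up to
    \<open>n\<close>.\<close>
  have "(com_obj R ^^ i) ?L = (com_obj R ^^ n) L"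
    using assms(2) by (simp flip: funpow_add[THEN fun_cong, unfolded o_apply])
  moreover have "(com_obj R ^^ i) (com_obj R ?L) = (com_obj R ^^ Suc n) L"
    using assms(2) by (simp flip: funpow_add[THEN fun_cong, unfolded o_apply] add: funpow_swap1)
  ultimately show ?thesis
    using com_map_pow_lie_hom[OF com_obj_lie_algebra[OF l] l com_counit_lie_hom[OF l], of i]
    by (simp add: com_face_def)
qed


section \<open>The extra degeneracy\<close>

text \<open>Put \<open>m = n - i\<close>. By naturality, the counit at \<open>G^(m+1) L\<close>
  after \<open>G^(m+1) s\<close> equals \<open>G^m s\<close> after the counit at
  \<open>G^m L\<close>. Applying \<open>G^i\<close> to this square gives the claim.\<close>

lemma com_face_section:
  assumes "lie_algebra R L" "s \<in> lie_hom R L (com_obj R L)" "i \<le> n" "x \<in> carrier ((com_obj R ^^ Suc n) L)"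
  shows "com_face R L (Suc n) i (com_map_pow R (com_obj R L) (Suc n) s x) =
    com_map_pow R (com_obj R L) n s (com_face R L n i x)"
proof -
  define m where "m = n - i"
  have n: "n = i + m" "Suc n - i = Suc m" "Suc n = i + Suc m" using assms(3) by (auto simp: m_def)
  let ?G = "\<lambda>k. (com_obj R ^^ k) L" and ?s = "\<lambda>k. com_map_pow R (com_obj R L) k s"
  have G: "(com_obj R ^^ k) (com_obj R L) = ?G (Suc k)" for k by (simp add: funpow_swap1)
  have l: "lie_algebra R (?G k)" for k by (rule com_obj_pow_lie_algebra[OF assms(1)])
  have s: "?s k \<in> lie_hom R (?G k) (?G (Suc k))" for k
    using com_map_pow_lie_hom[OF assms(1) com_obj_lie_algebra[OF assms(1)] assms(2), of k] by (simp only: G)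
  have eps: "com_counit (?G k) \<in> lie_hom R (?G (Suc k)) (?G k)" for k
    using com_counit_lie_hom[OF l, of k] by simp
  have x: "x \<in> carrier ((com_obj R ^^ i) (?G (Suc m)))"
    using assms(4) unfolding n(3) funpow_add by simp
  \<comment> \<open>\<open>G^(n+1) s\<close> is read as \<open>G^i\<close> of
    \<open>G^(m+1) s\<close>, so that the face and the degeneracy are both \<open>i\<close>-fold
    images and can be composed inside.\<close>
  have "?s (Suc n) x = com_map_pow R (?G (Suc (Suc m))) i (?s (Suc m)) x"
    unfolding n(3) com_map_pow_add G ..
  then have "com_face R L (Suc n) i (?s (Suc n) x) =
      com_map_pow R (?G (Suc m)) i (\<lambda>y. com_counit (?G (Suc m)) (?s (Suc m) y)) x"
    unfolding com_face_def n(2) using com_map_pow_comp[OF l l l s eps x] by simp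
  also have "\<dots> = com_map_pow R (?G (Suc m)) i (\<lambda>y. ?s m (com_counit (?G m) y)) x"
  proof (rule com_map_pow_cong[OF l l lie_hom_comp[OF s eps] lie_hom_comp[OF eps s] _ x])
    fix y assume "y \<in> carrier (?G (Suc m))"
    then show "com_counit (?G (Suc m)) (?s (Suc m) y) = ?s m (com_counit (?G m) y)"
      using com_counit_natural[OF l l s, of y m] by (simp add: funpow_swap1)
  qed
  also have "\<dots> = com_map_pow R (?G (Suc m)) i (?s m) (com_map_pow R (?G m) i (com_counit (?G m)) x)"
    by (rule com_map_pow_comp[OF l l l eps s x, symmetric])
  also have "com_map_pow R (?G (Suc m)) i (?s m) = ?s n"
    unfolding n(1) com_map_pow_add G ..
  also have "com_map_pow R (?G m) i (com_counit (?G m)) = com_face R L n i"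
    by (simp add: com_face_def m_def)
  finally show ?thesis .
qed

text \<open>The last face is \<open>G^n\<close> of the counit at \<open>L\<close> itself. Only here
  does it matter that \<open>s\<close> is a section: the composite is \<open>G^n\<close> of the
  identity.\<close>

lemma com_face_section_last:
  assumes "lie_algebra R L" "s \<in> lie_hom R L (com_obj R L)"
    and "\<And>x. x \<in> carrier L \<Longrightarrow> com_counit L (s x) = x" "x \<in> carrier ((com_obj R ^^ n) L)"
  shows "com_face R L n n (com_map_pow R (com_obj R L) n s x) = x"
proof -
  note l = assms(1) com_obj_lie_algebra[OF assms(1)] and eps = com_counit_lie_hom[OF assms(1)]
  have "com_face R L n n (com_map_pow R (com_obj R L) n s x) =
      com_map_pow R L n (\<lambda>y. com_counit L (s y)) x"
    using com_map_pow_comp[OF l l(1) assms(2) eps assms(4)] by (simp add: com_face_def)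
  also have "\<dots> = com_map_pow R L n (\<lambda>y. y) x"
    by (rule com_map_pow_cong[OF l(1,1) lie_hom_comp[OF assms(2) eps] lie_hom_id[OF l(1)] assms(3,4)])
  also have "\<dots> = x" by (rule com_map_pow_id[OF l(1) assms(4)])
  finally show ?thesis .
qed

lemma lin_hom_finsum_fun:
  assumes "module R M" "module R N" "finite I" "\<And>i. i \<in> I \<Longrightarrow> f i \<in> lin_hom R M N"
  shows "(\<lambda>x. \<Oplus>\<^bsub>N\<^esub> i \<in> I. f i x) \<in> lin_hom R M N"
proof -
  interpret M: module R M by fact
  interpret N: module R N by fact
  have c: "f i x \<in> carrier N" if "i \<in> I" "x \<in> carrier M" for i x
    using lin_hom_closed[OF assms(4)] that by auto
  have p: "(\<lambda>i. f i x) \<in> I \<rightarrow> carrier N" if "x \<in> carrier M" for x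
    using c that by auto
  show ?thesis
  proof (rule lin_homI)
    fix x y assume xy: "x \<in> carrier M" "y \<in> carrier M"
    have "(\<Oplus>\<^bsub>N\<^esub> i \<in> I. f i (x \<oplus>\<^bsub>M\<^esub> y)) = (\<Oplus>\<^bsub>N\<^esub> i \<in> I. f i x \<oplus>\<^bsub>N\<^esub> f i y)"
      using xy c by (intro N.finsum_cong') (auto simp: lin_hom_add[OF assms(4)])
    then show "(\<Oplus>\<^bsub>N\<^esub> i \<in> I. f i (x \<oplus>\<^bsub>M\<^esub> y)) = (\<Oplus>\<^bsub>N\<^esub> i \<in> I. f i x) \<oplus>\<^bsub>N\<^esub> (\<Oplus>\<^bsub>N\<^esub> i \<in> I. f i y)"
      using N.finsum_addf[OF p p] xy by simp
  next
    fix r x assume rx: "r \<in> carrier R" "x \<in> carrier M"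
    have "(\<Oplus>\<^bsub>N\<^esub> i \<in> I. f i (r \<odot>\<^bsub>M\<^esub> x)) = (\<Oplus>\<^bsub>N\<^esub> i \<in> I. r \<odot>\<^bsub>N\<^esub> f i x)"
      using rx c by (intro N.finsum_cong') (auto simp: lin_hom_smult[OF assms(4)])
    then show "(\<Oplus>\<^bsub>N\<^esub> i \<in> I. f i (r \<odot>\<^bsub>M\<^esub> x)) = r \<odot>\<^bsub>N\<^esub> (\<Oplus>\<^bsub>N\<^esub> i \<in> I. f i x)"
      using N.finsum_smult_ldistr[OF assms(3) rx(1) p] rx by simp
  qed (use p in \<open>auto intro: N.finsum_closed\<close>)
qed

lemma alt_sign_lin_hom:
  assumes "module R M" "module R N" "f \<in> lin_hom R M N"
  shows "(\<lambda>x. alt_sign N i (f x)) \<in> lin_hom R M N"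
proof -
  interpret M: module R M by fact
  interpret N: module R N by fact
  show ?thesis
    using assms(3)
    by (intro lin_homI)
      (auto simp: alt_sign_def lin_hom_closed[OF assms(3)] lin_hom_add[OF assms(3)]
        lin_hom_smult[OF assms(3)] N.minus_add N.smult_r_minus)
qed

lemma homology_trivial:
  assumes "module R (C (Suc n))" "module R (C n)" "d (Suc n) \<in> lin_hom R (C (Suc n)) (C n)"
    and "\<zero>\<^bsub>C n\<^esub> \<in> cycles C d n" "cycles C d n \<subseteq> boundaries C d n"
  shows "carrier (homology C d n) = {\<zero>\<^bsub>homology C d n\<^esub>}"
proof -
  interpret C1: module R "C (Suc n)" by fact
  interpret C: module R "C n" by fact
  let ?B = "boundaries C d n"
  note d = lin_hom_closed[OF assms(3)] lin_hom_add[OF assms(3)] lin_hom_smult[OF assms(3)]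
    lin_hom_zero[OF assms(1-3)] lin_hom_minus[OF assms(1-3)]
  have B: "submodule ?B R (C n)"
  proof (rule C.submoduleI)
    show "\<zero>\<^bsub>C n\<^esub> \<in> ?B" using assms(4,5) by auto
    fix a assume "a \<in> ?B"
    then obtain a' where a: "a' \<in> carrier (C (Suc n))" "a = d (Suc n) a'" by (auto simp: boundaries_def)
    have "\<ominus>\<^bsub>C n\<^esub> a = d (Suc n) (\<ominus>\<^bsub>C (Suc n)\<^esub> a')" using a d by simp
    then show "\<ominus>\<^bsub>C n\<^esub> a \<in> ?B" using a by (auto simp: boundaries_def)
    {
      fix b assume "b \<in> ?B"
      then obtain b' where b: "b' \<in> carrier (C (Suc n))" "b = d (Suc n) b'" by (auto simp: boundaries_def)
      have "a \<oplus>\<^bsub>C n\<^esub> b = d (Suc n) (a' \<oplus>\<^bsub>C (Suc n)\<^esub> b')" using a b d by simp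
      then show "a \<oplus>\<^bsub>C n\<^esub> b \<in> ?B" using a b by (auto simp: boundaries_def)
    }
    fix r assume r: "r \<in> carrier R"
    have "r \<odot>\<^bsub>C n\<^esub> a = d (Suc n) (r \<odot>\<^bsub>C (Suc n)\<^esub> a')" using a d r by simp
    then show "r \<odot>\<^bsub>C n\<^esub> a \<in> ?B" using a r by (auto simp: boundaries_def)
  qed (auto simp: boundaries_def d)
  \<comment> \<open>Cosets are formed from the addition alone, so restricting the carrier to the
    cycles does not change them. Each cycle lies in \<open>?B\<close>, hence its coset is
    \<open>?B\<close>, the zero of the quotient; the zero cycle shows that the carrier is not
    empty.\<close>
  have "?B +>\<^bsub>C n\<lparr>carrier := cycles C d n\<rparr>\<^esub> x = ?B" if "x \<in> cycles C d n" for x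
  proof -
    have "x \<in> ?B" "x \<in> carrier (C n)" using that assms(5) by (auto simp: cycles_def)
    then have "?B +>\<^bsub>C n\<^esub> x = ?B" using coset_eq_zero_iff[OF assms(2) B] by simp
    then show ?thesis by (simp add: a_r_coset_def')
  qed
  then show ?thesis
    using assms(4) by (auto simp: homology_def quot_carrier quot_zero)
qed

text \<open>The maps induced by the extra degeneracy contract the complex up to sign:
  \<open>d h\<close> is \<open>h d\<close> plus or minus the identity, so a cycle \<open>a\<close>
  is the boundary of plus or minus \<open>h a\<close>. As \<open>H_RS\<close> in degree
  \<open>n\<close> is the derived functor in degree \<open>n - 1\<close>, the bound
  \<open>n \<ge> 2\<close> says that the latter degree is positive.\<close>

lemma H_RS_trivial:
  assumes "lie_algebra R L" "s \<in> lie_hom R L (com_obj R L)"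
    and "\<And>x. x \<in> carrier L \<Longrightarrow> com_counit L (s x) = x" "n \<ge> 2"
  shows "carrier (H_RS R L n) = {\<zero>\<^bsub>H_RS R L n\<^esub>}"
proof -
  let ?G = "\<lambda>k. (com_obj R ^^ k) L" and ?s = "\<lambda>k. com_map_pow R (com_obj R L) k s"
  let ?A = "\<lambda>k. ab_obj R (?G k)"
  define f where "f = (\<lambda>m i. ab_map R (?G (Suc m)) (?G m) (com_face R L m i))"
  define d where "d = (\<lambda>m A. \<Oplus>\<^bsub>?A m\<^esub> i \<in> {..m}. alt_sign (?A m) i (f m i A))"
  define h where "h = (\<lambda>m. ab_map R (?G m) (?G (Suc m)) (?s m))"
  \<comment> \<open>Chains of degree \<open>m\<close> live on \<open>G^(m+1) L\<close>, hence the
    shift between \<open>C\<close> and \<open>?A\<close>.\<close>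
  define C where "C = (\<lambda>m. ?A (Suc m))"
  have l: "lie_algebra R (?G k)" for k by (rule com_obj_pow_lie_algebra[OF assms(1)])
  have A: "module R (?A k)" for k by (rule ab_obj_module[OF l])
  have f: "f m i \<in> lin_hom R (?A (Suc m)) (?A m)" if "i \<le> m" for m i
    unfolding f_def by (rule ab_map_lin_hom[OF l l com_face_lie_hom[OF assms(1) that]])
  have d: "d m \<in> lin_hom R (?A (Suc m)) (?A m)" for m
    unfolding d_def by (intro lin_hom_finsum_fun A alt_sign_lin_hom f) auto
  have s: "?s m \<in> lie_hom R (?G m) (?G (Suc m))" for m
    using com_map_pow_lie_hom[OF assms(1) com_obj_lie_algebra[OF assms(1)] assms(2), of m]
    by (simp add: funpow_swap1)
  have h: "h m \<in> lin_hom R (?A m) (?A (Suc m))" for m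
    unfolding h_def by (rule ab_map_lin_hom[OF l l s])
  have fh: "f (Suc m) i (h (Suc m) a) = h m (f m i a)" if a: "a \<in> carrier (?A (Suc m))" and i: "i \<le> m" for a m i
  proof -
    obtain x where x: "x \<in> carrier (?G (Suc m))" "a = derived_ideal R (?G (Suc m)) +>\<^bsub>?G (Suc m)\<^esub> x"
      using a unfolding ab_obj_carrier by blast
    have i': "i \<le> Suc m" using i by simp
    have "f (Suc m) i (h (Suc m) a) = derived_ideal R (?G (Suc m)) +>\<^bsub>?G (Suc m)\<^esub> com_face R L (Suc m) i (?s (Suc m) x)"
      unfolding f_def h_def x(2) ab_map_coset[OF l l s x(1)]
      by (rule ab_map_coset[OF l l com_face_lie_hom[OF assms(1) i'] lie_hom_closed[OF s x(1)]])
    moreover have "h m (f m i a) = derived_ideal R (?G (Suc m)) +>\<^bsub>?G (Suc m)\<^esub> ?s m (com_face R L m i x)"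
      unfolding f_def h_def x(2) ab_map_coset[OF l l com_face_lie_hom[OF assms(1) i] x(1)]
      by (rule ab_map_coset[OF l l s lie_hom_closed[OF com_face_lie_hom[OF assms(1) i] x(1)]])
    ultimately show ?thesis
      using com_face_section[OF assms(1,2) i x(1)] by simp
  qed
  have fh_last: "f m m (h m a) = a" if a: "a \<in> carrier (?A m)" for a m
  proof -
    obtain x where x: "x \<in> carrier (?G m)" "a = derived_ideal R (?G m) +>\<^bsub>?G m\<^esub> x"
      using a unfolding ab_obj_carrier by blast
    have "f m m (h m a) = derived_ideal R (?G m) +>\<^bsub>?G m\<^esub> com_face R L m m (?s m x)"
      unfolding f_def h_def x(2) ab_map_coset[OF l l s x(1)]
      by (rule ab_map_coset[OF l l com_face_lie_hom[OF assms(1) le_refl] lie_hom_closed[OF s x(1)]])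
    then show ?thesis using com_face_section_last[OF assms(1-3) x(1)] x(2) by simp
  qed
  have homotopy: "d (Suc m) (h (Suc m) a) = alt_sign (?A (Suc m)) (Suc m) a \<oplus>\<^bsub>?A (Suc m)\<^esub> h m (d m a)"
    if a: "a \<in> carrier (?A (Suc m))" for a m
  proof -
    interpret A: module R "?A (Suc m)" by (rule A)
    note c = alt_sign_closed[OF A] lin_hom_closed[OF f] lin_hom_closed[OF h]
    \<comment> \<open>The summand of the last face is split off: there the face undoes the
      degeneracy and only the sign remains. In all other summands the face moves past
      \<open>h\<close>.\<close>
    have "d (Suc m) (h (Suc m) a) = alt_sign (?A (Suc m)) (Suc m) a \<oplus>\<^bsub>?A (Suc m)\<^esub>
        (\<Oplus>\<^bsub>?A (Suc m)\<^esub> i \<in> {..m}. alt_sign (?A (Suc m)) i (f (Suc m) i (h (Suc m) a)))"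
      unfolding d_def atMost_Suc using a c fh_last[OF a]
      by (subst A.finsum_insert) (auto simp del: com_map_pow.simps funpow.simps)
    also have "(\<Oplus>\<^bsub>?A (Suc m)\<^esub> i \<in> {..m}. alt_sign (?A (Suc m)) i (f (Suc m) i (h (Suc m) a))) =
        (\<Oplus>\<^bsub>?A (Suc m)\<^esub> i \<in> {..m}. h m (alt_sign (?A m) i (f m i a)))"
      using a c by (intro A.finsum_cong') (auto simp del: funpow.simps simp: fh lin_hom_alt_sign[OF A A h])
    also have "\<dots> = h m (d m a)"
      unfolding d_def using a c by (intro lin_hom_finsum[OF A A h, symmetric]) (auto simp del: funpow.simps)
    finally show ?thesis .
  qed
  obtain m where n: "n = Suc (Suc m)" using assms(4) by (metis add_2_eq_Suc le_Suc_ex)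
  have "carrier (homology C d (Suc m)) = {\<zero>\<^bsub>homology C d (Suc m)\<^esub>}"
  proof (rule homology_trivial)
    show "\<zero>\<^bsub>C (Suc m)\<^esub> \<in> cycles C d (Suc m)"
      using A[of "Suc (Suc m)"] lin_hom_zero[OF A A d, of "Suc m"]
      by (simp add: cycles_def C_def module.axioms abelian_group.axioms abelian_monoid.zero_closed del: funpow.simps)
    show "cycles C d (Suc m) \<subseteq> boundaries C d (Suc m)"
    proof
      fix a assume "a \<in> cycles C d (Suc m)"
      then have a: "a \<in> carrier (?A (Suc (Suc m)))" "d (Suc m) a = \<zero>\<^bsub>?A (Suc m)\<^esub>"
        by (auto simp: cycles_def C_def)
      let ?k = "Suc (Suc m)" and ?K = "Suc (Suc (Suc m))"
      interpret A: module R "?A ?k" by (rule A)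
      \<comment> \<open>The sign of the homotopy is put on the preimage too; it then occurs twice
        and cancels.\<close>
      have "d ?k (alt_sign (?A ?K) ?k (h ?k a)) = alt_sign (?A ?k) ?k (d ?k (h ?k a))"
        by (rule lin_hom_alt_sign[OF A A d]) (rule lin_hom_closed[OF h a(1)])
      also have "d ?k (h ?k a) = alt_sign (?A ?k) ?k a"
        using homotopy[OF a(1)] a lin_hom_zero[OF A A h, of "Suc m"] alt_sign_closed[OF A a(1)]
        by (simp del: funpow.simps)
      also have "alt_sign (?A ?k) ?k \<dots> = a"
        using a(1) by (simp add: alt_sign_def del: funpow.simps)
      finally have "d ?k (alt_sign (?A ?K) ?k (h ?k a)) = a" .
      moreover have "alt_sign (?A ?K) ?k (h ?k a) \<in> carrier (C ?k)"
        unfolding C_def by (rule alt_sign_closed[OF A lin_hom_closed[OF h a(1)]])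
      ultimately show "a \<in> boundaries C d (Suc m)"
        unfolding boundaries_def by (metis imageI)
    qed
  qed (use A d in \<open>auto simp: C_def simp del: funpow.simps\<close>)
  moreover have "H_RS R L n = homology C d (Suc m)"
    by (simp add: H_RS_def com_derived_def C_def d_def[abs_def] f_def n del: funpow.simps)
  ultimately show ?thesis by simp
qed

theorem H_RS_free_lie:
  fixes \<iota> :: "'c \<Rightarrow> 'a + ('k, 'a) lie_term"
  assumes "module R M" "inj_on \<iota> (carrier M)" "n \<ge> 2"
  shows "carrier (H_RS R (free_lie R \<iota> M) n) = {\<zero>\<^bsub>H_RS R (free_lie R \<iota> M) n\<^esub>}"
proof -
  let ?L = "free_lie R \<iota> M"
  have l: "lie_algebra R ?L" by (rule free_lie_lie_algebra[OF assms(1)])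
  \<comment> \<open>The generator of \<open>x\<close> is an element of \<open>?L\<close> and so
    names a generator one level up. This assignment is linear in \<open>x\<close> and extends to
    \<open>s\<close>; the counit evaluates the outer generator and returns the inner one.\<close>
  have "(\<lambda>x. free_gen R Inr ?L (free_gen R \<iota> M x)) \<in> lin_hom R M (com_obj R ?L)"
    unfolding com_obj_def by (rule lin_hom_comp[OF free_gen_lin_hom free_gen_lin_hom])
  from free_lie_universal[OF assms(1) com_obj_lie_algebra[OF l] assms(2) this]
  obtain s where s: "s \<in> lie_hom R ?L (com_obj R ?L)"
    "\<And>x. x \<in> carrier M \<Longrightarrow> s (free_gen R \<iota> M x) = free_gen R Inr ?L (free_gen R \<iota> M x)"
    by blast
  have "com_counit ?L (s y) = y" if "y \<in> carrier ?L" for y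
    by (rule free_lie_hom_ext[OF assms(1) l assms(2) lie_hom_comp[OF s(1) com_counit_lie_hom[OF l]]
          lie_hom_id[OF l] _ that])
      (simp add: s(2) com_counit_free_gen[OF l] free_gen_closed)
  then show ?thesis by (rule H_RS_trivial[OF l s(1) _ assms(3)])
qed


section \<open>Chevalley--Eilenberg homology in degree three\<close>

lemma ce_diff_eq_free_lift:
  "ce_diff R L n = (\<lambda>A. the_elem (free_lift R (ext_power R L (n - 1)) (ce_wedge_diff R L n) ` A))"
  by (simp add: ce_diff_def[abs_def] free_lift_def[abs_def])

lemma tuples_3: "xs \<in> tuples M 3 \<longleftrightarrow>
    (\<exists>a b c. xs = [a, b, c] \<and> a \<in> carrier M \<and> b \<in> carrier M \<and> c \<in> carrier M)"
  by (auto simp: tuples_def numeral_3_eq_3 length_Suc_conv)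

lemma tuples_4: "xs \<in> tuples M 4 \<longleftrightarrow> (\<exists>a b c d. xs = [a, b, c, d] \<and>
    a \<in> carrier M \<and> b \<in> carrier M \<and> c \<in> carrier M \<and> d \<in> carrier M)"
  by (auto simp: tuples_def eval_nat_numeral length_Suc_conv)

lemma less_3_cases: "(i::nat) < 3 \<longleftrightarrow> i = 0 \<or> i = 1 \<or> i = 2"
  by auto

lemma less_4_cases: "(i::nat) < 4 \<longleftrightarrow> i = 0 \<or> i = 1 \<or> i = 2 \<or> i = 3"
  by auto

text \<open>Turns the conditions on list positions into conditions on explicit triples, slot by
  slot, the form in which the differential and the determinant can be computed.\<close>

lemma alt_multilin_3I:
  assumes "\<And>a b c. \<lbrakk>a \<in> carrier M; b \<in> carrier M; c \<in> carrier M\<rbrakk> \<Longrightarrow> f [a, b, c] \<in> carrier N"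
    and "\<And>x y b c. \<lbrakk>x \<in> carrier M; y \<in> carrier M; b \<in> carrier M; c \<in> carrier M\<rbrakk> \<Longrightarrow>
      f [x \<oplus>\<^bsub>M\<^esub> y, b, c] = f [x, b, c] \<oplus>\<^bsub>N\<^esub> f [y, b, c]"
    and "\<And>x y a c. \<lbrakk>x \<in> carrier M; y \<in> carrier M; a \<in> carrier M; c \<in> carrier M\<rbrakk> \<Longrightarrow>
      f [a, x \<oplus>\<^bsub>M\<^esub> y, c] = f [a, x, c] \<oplus>\<^bsub>N\<^esub> f [a, y, c]"
    and "\<And>x y a b. \<lbrakk>x \<in> carrier M; y \<in> carrier M; a \<in> carrier M; b \<in> carrier M\<rbrakk> \<Longrightarrow>
      f [a, b, x \<oplus>\<^bsub>M\<^esub> y] = f [a, b, x] \<oplus>\<^bsub>N\<^esub> f [a, b, y]"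
    and "\<And>r a b c. \<lbrakk>r \<in> carrier R; a \<in> carrier M; b \<in> carrier M; c \<in> carrier M\<rbrakk> \<Longrightarrow>
      f [r \<odot>\<^bsub>M\<^esub> a, b, c] = r \<odot>\<^bsub>N\<^esub> f [a, b, c]"
    and "\<And>r a b c. \<lbrakk>r \<in> carrier R; a \<in> carrier M; b \<in> carrier M; c \<in> carrier M\<rbrakk> \<Longrightarrow>
      f [a, r \<odot>\<^bsub>M\<^esub> b, c] = r \<odot>\<^bsub>N\<^esub> f [a, b, c]"
    and "\<And>r a b c. \<lbrakk>r \<in> carrier R; a \<in> carrier M; b \<in> carrier M; c \<in> carrier M\<rbrakk> \<Longrightarrow>
      f [a, b, r \<odot>\<^bsub>M\<^esub> c] = r \<odot>\<^bsub>N\<^esub> f [a, b, c]"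
    and "\<And>a b. \<lbrakk>a \<in> carrier M; b \<in> carrier M\<rbrakk> \<Longrightarrow> f [a, a, b] = \<zero>\<^bsub>N\<^esub>"
    and "\<And>a b. \<lbrakk>a \<in> carrier M; b \<in> carrier M\<rbrakk> \<Longrightarrow> f [a, b, a] = \<zero>\<^bsub>N\<^esub>"
    and "\<And>a b. \<lbrakk>a \<in> carrier M; b \<in> carrier M\<rbrakk> \<Longrightarrow> f [b, a, a] = \<zero>\<^bsub>N\<^esub>"
  shows "alt_multilin R M 3 N f"
  unfolding alt_multilin_def
proof (intro conjI ballI allI impI)
  fix xs and i j :: nat
  assume xs: "xs \<in> tuples M 3" and ij: "i < j" "j < 3" "xs ! i = xs ! j"
  then consider "i = 0" "j = 1" | "i = 0" "j = 2" | "i = 1" "j = 2" by linarith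
  then show "f xs = \<zero>\<^bsub>N\<^esub>"
    using xs ij(3) by cases (auto simp: tuples_3 assms(8-10))
qed (auto simp: tuples_3 less_3_cases assms(1-7))

lemma alt_multilin_4I:
  assumes "\<And>a b c d. \<lbrakk>a \<in> carrier M; b \<in> carrier M; c \<in> carrier M; d \<in> carrier M\<rbrakk> \<Longrightarrow>
      f [a, b, c, d] \<in> carrier N"
    and "\<And>x y b c d. \<lbrakk>x \<in> carrier M; y \<in> carrier M; b \<in> carrier M; c \<in> carrier M; d \<in> carrier M\<rbrakk> \<Longrightarrow>
      f [x \<oplus>\<^bsub>M\<^esub> y, b, c, d] = f [x, b, c, d] \<oplus>\<^bsub>N\<^esub> f [y, b, c, d]"
    and "\<And>x y a c d. \<lbrakk>x \<in> carrier M; y \<in> carrier M; a \<in> carrier M; c \<in> carrier M; d \<in> carrier M\<rbrakk> \<Longrightarrow>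
      f [a, x \<oplus>\<^bsub>M\<^esub> y, c, d] = f [a, x, c, d] \<oplus>\<^bsub>N\<^esub> f [a, y, c, d]"
    and "\<And>x y a b d. \<lbrakk>x \<in> carrier M; y \<in> carrier M; a \<in> carrier M; b \<in> carrier M; d \<in> carrier M\<rbrakk> \<Longrightarrow>
      f [a, b, x \<oplus>\<^bsub>M\<^esub> y, d] = f [a, b, x, d] \<oplus>\<^bsub>N\<^esub> f [a, b, y, d]"
    and "\<And>x y a b c. \<lbrakk>x \<in> carrier M; y \<in> carrier M; a \<in> carrier M; b \<in> carrier M; c \<in> carrier M\<rbrakk> \<Longrightarrow>
      f [a, b, c, x \<oplus>\<^bsub>M\<^esub> y] = f [a, b, c, x] \<oplus>\<^bsub>N\<^esub> f [a, b, c, y]"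
    and "\<And>r a b c d. \<lbrakk>r \<in> carrier R; a \<in> carrier M; b \<in> carrier M; c \<in> carrier M; d \<in> carrier M\<rbrakk> \<Longrightarrow>
      f [r \<odot>\<^bsub>M\<^esub> a, b, c, d] = r \<odot>\<^bsub>N\<^esub> f [a, b, c, d]"
    and "\<And>r a b c d. \<lbrakk>r \<in> carrier R; a \<in> carrier M; b \<in> carrier M; c \<in> carrier M; d \<in> carrier M\<rbrakk> \<Longrightarrow>
      f [a, r \<odot>\<^bsub>M\<^esub> b, c, d] = r \<odot>\<^bsub>N\<^esub> f [a, b, c, d]"
    and "\<And>r a b c d. \<lbrakk>r \<in> carrier R; a \<in> carrier M; b \<in> carrier M; c \<in> carrier M; d \<in> carrier M\<rbrakk> \<Longrightarrow>
      f [a, b, r \<odot>\<^bsub>M\<^esub> c, d] = r \<odot>\<^bsub>N\<^esub> f [a, b, c, d]"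
    and "\<And>r a b c d. \<lbrakk>r \<in> carrier R; a \<in> carrier M; b \<in> carrier M; c \<in> carrier M; d \<in> carrier M\<rbrakk> \<Longrightarrow>
      f [a, b, c, r \<odot>\<^bsub>M\<^esub> d] = r \<odot>\<^bsub>N\<^esub> f [a, b, c, d]"
    and "\<And>a b c. \<lbrakk>a \<in> carrier M; b \<in> carrier M; c \<in> carrier M\<rbrakk> \<Longrightarrow> f [a, a, b, c] = \<zero>\<^bsub>N\<^esub>"
    and "\<And>a b c. \<lbrakk>a \<in> carrier M; b \<in> carrier M; c \<in> carrier M\<rbrakk> \<Longrightarrow> f [a, b, a, c] = \<zero>\<^bsub>N\<^esub>"
    and "\<And>a b c. \<lbrakk>a \<in> carrier M; b \<in> carrier M; c \<in> carrier M\<rbrakk> \<Longrightarrow> f [a, b, c, a] = \<zero>\<^bsub>N\<^esub>"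
    and "\<And>a b c. \<lbrakk>a \<in> carrier M; b \<in> carrier M; c \<in> carrier M\<rbrakk> \<Longrightarrow> f [b, a, a, c] = \<zero>\<^bsub>N\<^esub>"
    and "\<And>a b c. \<lbrakk>a \<in> carrier M; b \<in> carrier M; c \<in> carrier M\<rbrakk> \<Longrightarrow> f [b, a, c, a] = \<zero>\<^bsub>N\<^esub>"
    and "\<And>a b c. \<lbrakk>a \<in> carrier M; b \<in> carrier M; c \<in> carrier M\<rbrakk> \<Longrightarrow> f [b, c, a, a] = \<zero>\<^bsub>N\<^esub>"
  shows "alt_multilin R M 4 N f"
  unfolding alt_multilin_def
proof (intro conjI ballI allI impI)
  fix xs and i j :: nat
  assume xs: "xs \<in> tuples M 4" and ij: "i < j" "j < 4" "xs ! i = xs ! j"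
  then have "i = 0 \<or> i = 1 \<or> i = 2" "j = 1 \<or> j = 2 \<or> j = 3" by linarith+
  then show "f xs = \<zero>\<^bsub>N\<^esub>"
    using xs ij(1,3) by (elim disjE) (auto simp: tuples_4 assms(10-15))
qed (auto simp: tuples_4 less_4_cases assms(1-9))

lemma alt_multilin_add:
  "\<lbrakk>alt_multilin R M n N f; xs \<in> tuples M n; i < n; x \<in> carrier M; y \<in> carrier M\<rbrakk> \<Longrightarrow>
    f (xs[i := x \<oplus>\<^bsub>M\<^esub> y]) = f (xs[i := x]) \<oplus>\<^bsub>N\<^esub> f (xs[i := y])"
  unfolding alt_multilin_def by blast

lemma alt_multilin_smult:
  "\<lbrakk>alt_multilin R M n N f; xs \<in> tuples M n; i < n; r \<in> carrier R; x \<in> carrier M\<rbrakk> \<Longrightarrow>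
    f (xs[i := r \<odot>\<^bsub>M\<^esub> x]) = r \<odot>\<^bsub>N\<^esub> f (xs[i := x])"
  unfolding alt_multilin_def by blast

lemma alt_multilin_zero:
  "\<lbrakk>alt_multilin R M n N f; xs \<in> tuples M n; i < j; j < n; xs ! i = xs ! j\<rbrakk> \<Longrightarrow> f xs = \<zero>\<^bsub>N\<^esub>"
  unfolding alt_multilin_def by blast

lemma alt_multilin_closed: "alt_multilin R M n N f \<Longrightarrow> xs \<in> tuples M n \<Longrightarrow> f xs \<in> carrier N"
  unfolding alt_multilin_def by blast

section \<open>Wedges and the differential in low degrees, over an arbitrary Lie algebra\<close>

context lie_algebra
begin

lemma ext_module: "module R (ext_power R L n)"
  by (rule ext_power_module) (rule module_axioms)

lemma bracket_antisym:
  assumes "x \<in> carrier L" "y \<in> carrier L"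
  shows "bracket L y x = \<ominus>\<^bsub>L\<^esub> bracket L x y"
proof -
  have "\<zero>\<^bsub>L\<^esub> = bracket L (y \<oplus>\<^bsub>L\<^esub> x) (y \<oplus>\<^bsub>L\<^esub> x)"
    using assms by (simp add: bracket_self)
  also have "\<dots> = bracket L y x \<oplus>\<^bsub>L\<^esub> bracket L x y"
    using assms by (simp add: bracket_add_left bracket_add_right bracket_closed)
      (simp add: bracket_self bracket_closed a_comm)
  finally show ?thesis
    using assms by (intro M.minus_equality[symmetric]) (auto simp: bracket_closed)
qed

lemma wedge2:
  assumes "a \<in> carrier L" "b \<in> carrier L"
  shows "wedge R L [a, b] \<in> carrier (ext_power R L 2)"
    and "x \<in> carrier L \<Longrightarrow> wedge R L [a \<oplus>\<^bsub>L\<^esub> x, b] = wedge R L [a, b] \<oplus>\<^bsub>ext_power R L 2\<^esub> wedge R L [x, b]"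
    and "x \<in> carrier L \<Longrightarrow> wedge R L [a, b \<oplus>\<^bsub>L\<^esub> x] = wedge R L [a, b] \<oplus>\<^bsub>ext_power R L 2\<^esub> wedge R L [a, x]"
    and "r \<in> carrier R \<Longrightarrow> wedge R L [r \<odot>\<^bsub>L\<^esub> a, b] = r \<odot>\<^bsub>ext_power R L 2\<^esub> wedge R L [a, b]"
    and "r \<in> carrier R \<Longrightarrow> wedge R L [a, r \<odot>\<^bsub>L\<^esub> b] = r \<odot>\<^bsub>ext_power R L 2\<^esub> wedge R L [a, b]"
proof -
  have t: "[a, b] \<in> tuples L 2" using assms by (simp add: tuples_def)
  note w = wedge_alt_multilin[OF module_axioms, of 2]
  show "wedge R L [a, b] \<in> carrier (ext_power R L 2)"
    by (rule alt_multilin_closed[OF w t])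
  show "x \<in> carrier L \<Longrightarrow> wedge R L [a \<oplus>\<^bsub>L\<^esub> x, b] = wedge R L [a, b] \<oplus>\<^bsub>ext_power R L 2\<^esub> wedge R L [x, b]"
    using alt_multilin_add[OF w t, of 0 a x] assms by simp
  show "x \<in> carrier L \<Longrightarrow> wedge R L [a, b \<oplus>\<^bsub>L\<^esub> x] = wedge R L [a, b] \<oplus>\<^bsub>ext_power R L 2\<^esub> wedge R L [a, x]"
    using alt_multilin_add[OF w t, of 1 b x] assms by simp
  show "r \<in> carrier R \<Longrightarrow> wedge R L [r \<odot>\<^bsub>L\<^esub> a, b] = r \<odot>\<^bsub>ext_power R L 2\<^esub> wedge R L [a, b]"
    using alt_multilin_smult[OF w t, of 0 r a] assms by simp
  show "r \<in> carrier R \<Longrightarrow> wedge R L [a, r \<odot>\<^bsub>L\<^esub> b] = r \<odot>\<^bsub>ext_power R L 2\<^esub> wedge R L [a, b]"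
    using alt_multilin_smult[OF w t, of 1 r b] assms by simp
qed

lemma wedge3:
  assumes "a \<in> carrier L" "b \<in> carrier L" "c \<in> carrier L"
  shows "wedge R L [a, b, c] \<in> carrier (ext_power R L 3)"
    and "x \<in> carrier L \<Longrightarrow> wedge R L [a \<oplus>\<^bsub>L\<^esub> x, b, c] = wedge R L [a, b, c] \<oplus>\<^bsub>ext_power R L 3\<^esub> wedge R L [x, b, c]"
    and "x \<in> carrier L \<Longrightarrow> wedge R L [a, b \<oplus>\<^bsub>L\<^esub> x, c] = wedge R L [a, b, c] \<oplus>\<^bsub>ext_power R L 3\<^esub> wedge R L [a, x, c]"
    and "x \<in> carrier L \<Longrightarrow> wedge R L [a, b, c \<oplus>\<^bsub>L\<^esub> x] = wedge R L [a, b, c] \<oplus>\<^bsub>ext_power R L 3\<^esub> wedge R L [a, b, x]"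
    and "r \<in> carrier R \<Longrightarrow> wedge R L [r \<odot>\<^bsub>L\<^esub> a, b, c] = r \<odot>\<^bsub>ext_power R L 3\<^esub> wedge R L [a, b, c]"
    and "r \<in> carrier R \<Longrightarrow> wedge R L [a, r \<odot>\<^bsub>L\<^esub> b, c] = r \<odot>\<^bsub>ext_power R L 3\<^esub> wedge R L [a, b, c]"
    and "r \<in> carrier R \<Longrightarrow> wedge R L [a, b, r \<odot>\<^bsub>L\<^esub> c] = r \<odot>\<^bsub>ext_power R L 3\<^esub> wedge R L [a, b, c]"
    and "wedge R L [a, b, b] = \<zero>\<^bsub>ext_power R L 3\<^esub>"
proof -
  have t: "[a, b, c] \<in> tuples L 3" "[a, b, b] \<in> tuples L 3" using assms by (simp_all add: tuples_def)
  note w = wedge_alt_multilin[OF module_axioms, of 3]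
  show "wedge R L [a, b, c] \<in> carrier (ext_power R L 3)"
    by (rule alt_multilin_closed[OF w t(1)])
  show "x \<in> carrier L \<Longrightarrow> wedge R L [a \<oplus>\<^bsub>L\<^esub> x, b, c] = wedge R L [a, b, c] \<oplus>\<^bsub>ext_power R L 3\<^esub> wedge R L [x, b, c]"
    using alt_multilin_add[OF w t(1), of 0 a x] assms by simp
  show "x \<in> carrier L \<Longrightarrow> wedge R L [a, b \<oplus>\<^bsub>L\<^esub> x, c] = wedge R L [a, b, c] \<oplus>\<^bsub>ext_power R L 3\<^esub> wedge R L [a, x, c]"
    using alt_multilin_add[OF w t(1), of 1 b x] assms by simp
  show "x \<in> carrier L \<Longrightarrow> wedge R L [a, b, c \<oplus>\<^bsub>L\<^esub> x] = wedge R L [a, b, c] \<oplus>\<^bsub>ext_power R L 3\<^esub> wedge R L [a, b, x]"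
    using alt_multilin_add[OF w t(1), of 2 c x] assms by simp
  show "r \<in> carrier R \<Longrightarrow> wedge R L [r \<odot>\<^bsub>L\<^esub> a, b, c] = r \<odot>\<^bsub>ext_power R L 3\<^esub> wedge R L [a, b, c]"
    using alt_multilin_smult[OF w t(1), of 0 r a] assms by simp
  show "r \<in> carrier R \<Longrightarrow> wedge R L [a, r \<odot>\<^bsub>L\<^esub> b, c] = r \<odot>\<^bsub>ext_power R L 3\<^esub> wedge R L [a, b, c]"
    using alt_multilin_smult[OF w t(1), of 1 r b] assms by simp
  show "r \<in> carrier R \<Longrightarrow> wedge R L [a, b, r \<odot>\<^bsub>L\<^esub> c] = r \<odot>\<^bsub>ext_power R L 3\<^esub> wedge R L [a, b, c]"
    using alt_multilin_smult[OF w t(1), of 2 r c] assms by simp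
  show "wedge R L [a, b, b] = \<zero>\<^bsub>ext_power R L 3\<^esub>"
    by (rule alt_multilin_zero[OF w t(2), of 1 2]) auto
qed

lemma wedge2_minus:
  assumes "a \<in> carrier L" "b \<in> carrier L"
  shows "wedge R L [\<ominus>\<^bsub>L\<^esub> a, b] = \<ominus>\<^bsub>ext_power R L 2\<^esub> wedge R L [a, b]"
proof -
  interpret E: module R "ext_power R L 2" by (rule ext_module)
  have "\<ominus>\<^bsub>L\<^esub> a = (\<ominus>\<^bsub>R\<^esub> \<one>\<^bsub>R\<^esub>) \<odot>\<^bsub>L\<^esub> a" using assms by (simp add: smult_l_minus)
  then show ?thesis using assms by (simp add: wedge2 E.smult_l_minus)
qed

lemma wedge3_minus:
  assumes "a \<in> carrier L" "b \<in> carrier L" "c \<in> carrier L"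
  shows "wedge R L [\<ominus>\<^bsub>L\<^esub> a, b, c] = \<ominus>\<^bsub>ext_power R L 3\<^esub> wedge R L [a, b, c]"
proof -
  interpret E: module R "ext_power R L 3" by (rule ext_module)
  have "\<ominus>\<^bsub>L\<^esub> a = (\<ominus>\<^bsub>R\<^esub> \<one>\<^bsub>R\<^esub>) \<odot>\<^bsub>L\<^esub> a" using assms by (simp add: smult_l_minus)
  then show ?thesis using assms by (simp add: wedge3 E.smult_l_minus)
qed

text \<open>Only the last two factors ever have to be exchanged, since the differential always puts
  the bracket first. The sign comes from expanding the wedge whose last two factors are both the sum
  of \<open>c\<close> and \<open>b\<close>.\<close>

lemma wedge3_swap:
  assumes "a \<in> carrier L" "b \<in> carrier L" "c \<in> carrier L"
  shows "wedge R L [a, c, b] = \<ominus>\<^bsub>ext_power R L 3\<^esub> wedge R L [a, b, c]"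
proof -
  interpret E: module R "ext_power R L 3" by (rule ext_module)
  have "\<zero>\<^bsub>ext_power R L 3\<^esub> = wedge R L [a, c \<oplus>\<^bsub>L\<^esub> b, c \<oplus>\<^bsub>L\<^esub> b]"
    using assms by (simp add: wedge3)
  also have "\<dots> = wedge R L [a, c, b] \<oplus>\<^bsub>ext_power R L 3\<^esub> wedge R L [a, b, c]"
    using assms by (simp add: wedge3(1-7)) (simp add: wedge3(1,8) E.M.a_comm)
  finally show ?thesis
    using assms by (intro E.M.minus_equality[symmetric]) (auto simp: wedge3)
qed

text \<open>Counted from zero, the pairs of positions (0,1), (0,2), (1,2) have sums 1, 2, 3, hence
  the signs minus, plus, minus.\<close>

lemma ce_wedge_diff_3:
  assumes "a \<in> carrier L" "b \<in> carrier L" "c \<in> carrier L"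
  shows "ce_wedge_diff R L 3 [a, b, c] =
    \<ominus>\<^bsub>ext_power R L 2\<^esub> wedge R L [bracket L a b, c] \<oplus>\<^bsub>ext_power R L 2\<^esub>
    (wedge R L [bracket L a c, b] \<oplus>\<^bsub>ext_power R L 2\<^esub>
     \<ominus>\<^bsub>ext_power R L 2\<^esub> wedge R L [bracket L b c, a])"
proof -
  interpret E: module R "ext_power R L 2" by (rule ext_module)
  have s: "{..<3::nat} = {0, 1, 2}" "{..<2::nat} = {0, 1}" "{..<Suc 0} = {0}" by auto
  have n: "nths [a, b, c] (- {0, Suc 0}) = [c]" "nths [a, b, c] (- {0, 2}) = [b]"
    "nths [a, b, c] (- {Suc 0, 2}) = [a]"
    by (simp_all add: nths_Cons)
  show ?thesis
    unfolding ce_wedge_diff_def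
    using assms by (simp add: s n wedge2 bracket_closed alt_sign_def E.M.a_ac)
qed

lemma ce_wedge_diff_4:
  assumes "a \<in> carrier L" "b \<in> carrier L" "c \<in> carrier L" "d \<in> carrier L"
  shows "ce_wedge_diff R L 4 [a, b, c, d] =
    \<ominus>\<^bsub>ext_power R L 3\<^esub> wedge R L [bracket L a b, c, d] \<oplus>\<^bsub>ext_power R L 3\<^esub>
    (wedge R L [bracket L a c, b, d] \<oplus>\<^bsub>ext_power R L 3\<^esub>
    (\<ominus>\<^bsub>ext_power R L 3\<^esub> wedge R L [bracket L b c, a, d] \<oplus>\<^bsub>ext_power R L 3\<^esub>
    (\<ominus>\<^bsub>ext_power R L 3\<^esub> wedge R L [bracket L a d, b, c] \<oplus>\<^bsub>ext_power R L 3\<^esub>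
    (wedge R L [bracket L b d, a, c] \<oplus>\<^bsub>ext_power R L 3\<^esub>
    \<ominus>\<^bsub>ext_power R L 3\<^esub> wedge R L [bracket L c d, a, b]))))"
proof -
  interpret E: module R "ext_power R L 3" by (rule ext_module)
  have s: "{..<4::nat} = {0, 1, 2, 3}" "{..<3::nat} = {0, 1, 2}" "{..<2::nat} = {0, 1}"
    "{..<Suc 0} = {0}" by auto
  have n: "nths [a, b, c, d] (- {0, Suc 0}) = [c, d]" "nths [a, b, c, d] (- {0, 2}) = [b, d]"
    "nths [a, b, c, d] (- {0, 3}) = [b, c]" "nths [a, b, c, d] (- {Suc 0, 2}) = [a, d]"
    "nths [a, b, c, d] (- {Suc 0, 3}) = [a, c]" "nths [a, b, c, d] (- {2, 3}) = [a, b]"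
    by (simp_all add: nths_Cons)
  show ?thesis
    unfolding ce_wedge_diff_def
    using assms by (simp add: s n wedge3 bracket_closed alt_sign_def E.M.a_ac)
qed

lemmas bracket_linear = bracket_add_left bracket_add_right bracket_smult_left bracket_smult_right
  bracket_closed

lemma wedge2_zero: "a \<in> carrier L \<Longrightarrow> wedge R L [\<zero>\<^bsub>L\<^esub>, a] = \<zero>\<^bsub>ext_power R L 2\<^esub>"
  using wedge2(4)[of "\<zero>\<^bsub>L\<^esub>" a "\<zero>\<^bsub>R\<^esub>"] module.smult_l_null[OF ext_module wedge2(1)[of "\<zero>\<^bsub>L\<^esub>" a]]
  by simp

lemma wedge3_zero:
  "a \<in> carrier L \<Longrightarrow> b \<in> carrier L \<Longrightarrow> wedge R L [\<zero>\<^bsub>L\<^esub>, a, b] = \<zero>\<^bsub>ext_power R L 3\<^esub>"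
  using wedge3(5)[of "\<zero>\<^bsub>L\<^esub>" a b "\<zero>\<^bsub>R\<^esub>"] module.smult_l_null[OF ext_module wedge3(1)[of "\<zero>\<^bsub>L\<^esub>" a b]]
  by simp

text \<open>\<open>ce_diff\<close> picks the only element of the image of a coset, so it can be
  evaluated once the formula on tuples is known to be alternating and multilinear. If two entries
  agree, their bracket vanishes and the other two terms cancel, in one case by antisymmetry of the
  bracket.\<close>

lemma ce_wedge_diff_3_alt_multilin:
  "alt_multilin R L 3 (ext_power R L 2) (ce_wedge_diff R L 3)"
proof -
  interpret E: module R "ext_power R L 2" by (rule ext_module)
  have mz: "\<ominus>\<^bsub>ext_power R L 2\<^esub> \<zero>\<^bsub>ext_power R L 2\<^esub> = \<zero>\<^bsub>ext_power R L 2\<^esub>"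
    by (rule E.M.minus_equality) auto
  note simps = ce_wedge_diff_3 wedge2 bracket_linear bracket_self wedge2_zero
    E.M.minus_add E.smult_r_distr E.smult_r_minus E.M.a_ac
  show ?thesis
  proof (rule alt_multilin_3I)
    fix a b assume ab: "a \<in> carrier L" "b \<in> carrier L"
    show "ce_wedge_diff R L 3 [a, a, b] = \<zero>\<^bsub>ext_power R L 2\<^esub>"
      using ab by (simp add: simps E.M.r_neg mz)
    show "ce_wedge_diff R L 3 [a, b, a] = \<zero>\<^bsub>ext_power R L 2\<^esub>"
      using ab bracket_antisym[OF ab] by (simp add: simps wedge2_minus E.M.r_neg)
    show "ce_wedge_diff R L 3 [b, a, a] = \<zero>\<^bsub>ext_power R L 2\<^esub>"
      using ab by (simp add: simps E.M.r_neg mz)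
  qed (simp_all add: simps)
qed

text \<open>If two entries agree, their bracket vanishes, and so does the complementary term, which
  has both of them as factors. The remaining four terms cancel in pairs after reordering.\<close>

lemma ce_wedge_diff_4_alt_multilin:
  "alt_multilin R L 4 (ext_power R L 3) (ce_wedge_diff R L 4)"
proof -
  interpret E: module R "ext_power R L 3" by (rule ext_module)
  have mz: "\<ominus>\<^bsub>ext_power R L 3\<^esub> \<zero>\<^bsub>ext_power R L 3\<^esub> = \<zero>\<^bsub>ext_power R L 3\<^esub>"
    by (rule E.M.minus_equality) auto
  note lin = wedge3 bracket_linear bracket_self wedge3_zero
    E.M.minus_add E.smult_r_distr E.smult_r_minus E.M.a_ac
  \<comment> \<open>After sorting, the four surviving summands may come as \<open>p\<close>,
    \<open>q\<close>, minus \<open>p\<close>, minus \<open>q\<close>, where no summand stands next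
    to its own negative.\<close>
  have cancel: "p \<oplus>\<^bsub>ext_power R L 3\<^esub> (q \<oplus>\<^bsub>ext_power R L 3\<^esub>
      (\<ominus>\<^bsub>ext_power R L 3\<^esub> p \<oplus>\<^bsub>ext_power R L 3\<^esub> \<ominus>\<^bsub>ext_power R L 3\<^esub> q)) = \<zero>\<^bsub>ext_power R L 3\<^esub>"
    if "p \<in> carrier (ext_power R L 3)" "q \<in> carrier (ext_power R L 3)" for p q
  proof -
    have "p \<oplus>\<^bsub>ext_power R L 3\<^esub> (q \<oplus>\<^bsub>ext_power R L 3\<^esub>
        (\<ominus>\<^bsub>ext_power R L 3\<^esub> p \<oplus>\<^bsub>ext_power R L 3\<^esub> \<ominus>\<^bsub>ext_power R L 3\<^esub> q)) =
      (p \<oplus>\<^bsub>ext_power R L 3\<^esub> q) \<oplus>\<^bsub>ext_power R L 3\<^esub> \<ominus>\<^bsub>ext_power R L 3\<^esub> (p \<oplus>\<^bsub>ext_power R L 3\<^esub> q)"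
      using that by (simp add: E.M.minus_add E.M.a_assoc)
    then show ?thesis using that by (simp add: E.M.r_neg)
  qed
  show ?thesis
  proof (rule alt_multilin_4I)
    fix x b c assume xbc: "x \<in> carrier L" "b \<in> carrier L" "c \<in> carrier L"
    note sw = wedge3_swap[of _ x b] wedge3_swap[of _ x c] wedge3_swap[of _ b c]
      bracket_antisym[of x b] bracket_antisym[of x c]
    note s = ce_wedge_diff_4 wedge3(1,8) bracket_self wedge3_zero wedge3_minus bracket_closed
    note ac = E.M.r_neg1 E.M.r_neg2 E.M.r_neg E.M.l_neg mz E.M.a_ac cancel
    show "ce_wedge_diff R L 4 [x, x, b, c] = \<zero>\<^bsub>ext_power R L 3\<^esub>"
      using xbc by (simp add: s ac)
    show "ce_wedge_diff R L 4 [x, b, x, c] = \<zero>\<^bsub>ext_power R L 3\<^esub>"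
      using xbc by (simp add: s sw ac)
    show "ce_wedge_diff R L 4 [x, b, c, x] = \<zero>\<^bsub>ext_power R L 3\<^esub>"
      using xbc by (simp add: s sw ac)
    show "ce_wedge_diff R L 4 [b, x, x, c] = \<zero>\<^bsub>ext_power R L 3\<^esub>"
      using xbc by (simp add: s ac)
    show "ce_wedge_diff R L 4 [b, x, c, x] = \<zero>\<^bsub>ext_power R L 3\<^esub>"
      using xbc by (simp add: s sw ac)
    show "ce_wedge_diff R L 4 [b, c, x, x] = \<zero>\<^bsub>ext_power R L 3\<^esub>"
      using xbc by (simp add: s ac)
  qed (simp_all add: ce_wedge_diff_4 lin)
qed

lemma ce_diff_wedge:
  assumes "alt_multilin R L n (ext_power R L (n - 1)) (ce_wedge_diff R L n)" "xs \<in> tuples L n"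
  shows "ce_diff R L n (wedge R L xs) = ce_wedge_diff R L n xs"
  unfolding ce_diff_eq_free_lift
  by (rule ext_lift_wedge[OF module_axioms ext_module assms])

text \<open>Every term of a boundary has a bracket as its first factor, so \<open>f\<close> annihilates the boundaries.\<close>

lemma H_CE_3_nontrivial:
  assumes "module R N" "alt_multilin R L 3 N f"
    and bracket: "\<And>x y b c. \<lbrakk>x \<in> carrier L; y \<in> carrier L; b \<in> carrier L; c \<in> carrier L\<rbrakk> \<Longrightarrow>
      f [bracket L x y, b, c] = \<zero>\<^bsub>N\<^esub>"
    and xs: "xs \<in> tuples L 3" and cycle: "ce_wedge_diff R L 3 xs = \<zero>\<^bsub>ext_power R L 2\<^esub>"
    and "f xs \<noteq> \<zero>\<^bsub>N\<^esub>"
  shows "carrier (H_CE R L 3) \<noteq> {\<zero>\<^bsub>H_CE R L 3\<^esub>}"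
proof
  assume trivial: "carrier (H_CE R L 3) = {\<zero>\<^bsub>H_CE R L 3\<^esub>}"
  interpret N: module R N by fact
  interpret E3: module R "ext_power R L 3" by (rule ext_module)
  define \<psi> where "\<psi> = (\<lambda>A. the_elem (free_lift R N f ` A))"
  have \<psi>: "\<psi> \<in> lin_hom R (ext_power R L 3) N"
    unfolding \<psi>_def by (rule ext_lift_lin_hom[OF module_axioms assms(1,2)])
  have \<psi>_wedge: "\<psi> (wedge R L ys) = f ys" if "ys \<in> tuples L 3" for ys
    unfolding \<psi>_def by (rule ext_lift_wedge[OF module_axioms assms(1,2) that])
  have \<psi>_bracket: "\<psi> (wedge R L [bracket L x y, b, c]) = \<zero>\<^bsub>N\<^esub>"
    if "x \<in> carrier L" "y \<in> carrier L" "b \<in> carrier L" "c \<in> carrier L" for x y b c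
    using that by (subst \<psi>_wedge) (auto simp: tuples_3 bracket bracket_closed)
  have mz: "\<ominus>\<^bsub>N\<^esub> \<zero>\<^bsub>N\<^esub> = \<zero>\<^bsub>N\<^esub>"
    by (rule N.M.minus_equality) auto
  have \<psi>_diff: "\<psi> (ce_wedge_diff R L 4 ys) = \<zero>\<^bsub>N\<^esub>" if ys: "ys \<in> tuples L 4" for ys
    using ys unfolding tuples_4
    by (auto simp: ce_wedge_diff_4 wedge3(1) bracket_closed lin_hom_add[OF \<psi>] mz \<psi>_bracket
        lin_hom_minus[OF E3.module_axioms assms(1) \<psi>])
  define B where "B = boundaries (ext_power R L) (ce_diff R L) 3"
  let ?\<omega> = "wedge R L xs"
  have \<omega>: "?\<omega> \<in> carrier (ext_power R L 3)"
    by (rule alt_multilin_closed[OF wedge_alt_multilin[OF module_axioms] xs])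
  have \<psi>_boundary: "\<psi> b = \<zero>\<^bsub>N\<^esub>" "b \<in> carrier (ext_power R L 3)" if b: "b \<in> B" for b
  proof -
    obtain A where A: "A \<in> carrier (ext_power R L 4)" "b = ce_diff R L 4 A"
      using b by (auto simp: B_def boundaries_def)
    obtain v where v: "v \<in> carrier (free_module R (tuples L 4))"
      "A = ext_null R L 4 +>\<^bsub>free_module R (tuples L 4)\<^esub> v"
      using A(1) by (auto simp: ext_power_carrier)
    have b_eq: "b = free_lift R (ext_power R L 3) (ce_wedge_diff R L 4) v"
      using ext_lift_coset[OF module_axioms ext_module ce_wedge_diff_4_alt_multilin v(1)]
      by (simp add: A(2) v(2) ce_diff_eq_free_lift)
    note c = alt_multilin_closed[OF ce_wedge_diff_4_alt_multilin]
    show "\<psi> b = \<zero>\<^bsub>N\<^esub>"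
      unfolding b_eq
      by (rule lin_hom_free_lift_zero[OF E3.module_axioms assms(1) \<psi> v(1) c \<psi>_diff])
    show "b \<in> carrier (ext_power R L 3)"
      unfolding b_eq by (rule lin_hom_closed[OF free_lift_lin_hom[OF ext_module c] v(1)])
  qed
  have "?\<omega> \<in> cycles (ext_power R L) (ce_diff R L) 3"
    using \<omega> ce_diff_wedge[of 3 xs] ce_wedge_diff_3_alt_multilin xs cycle
    by (simp add: cycles_def)
  then have "B +>\<^bsub>ext_power R L 3\<^esub> ?\<omega> \<in> carrier (H_CE R L 3)"
    by (auto simp: H_CE_def homology_def quot_carrier B_def a_r_coset_def')
  then have coset: "B +>\<^bsub>ext_power R L 3\<^esub> ?\<omega> = B"
    using trivial by (simp add: H_CE_def homology_def quot_zero B_def)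
  \<comment> \<open>A single element of \<open>B\<close> suffices: \<open>b\<close> and the sum of
    \<open>b\<close> and \<open>?\<omega>\<close> are both boundaries, both are killed by
    \<open>\<psi>\<close>, and so \<open>\<psi>\<close> kills \<open>?\<omega>\<close>.\<close>
  obtain b where b: "b \<in> B"
    using ext_power_carrier[of R L 4] module.axioms(2)[OF ext_module, of 4]
      abelian_monoid.zero_closed[OF abelian_group.axioms(1)[OF module.axioms(2)[OF ext_module]], of 4]
    by (auto simp: B_def boundaries_def)
  then have "b \<oplus>\<^bsub>ext_power R L 3\<^esub> ?\<omega> \<in> B +>\<^bsub>ext_power R L 3\<^esub> ?\<omega>"
    by (auto simp: mem_a_r_coset)
  then have "b \<oplus>\<^bsub>ext_power R L 3\<^esub> ?\<omega> \<in> B" unfolding coset .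
  from \<psi>_boundary(1)[OF this] have "f xs = \<zero>\<^bsub>N\<^esub>"
    using \<psi>_boundary[OF b] \<omega> lin_hom_closed[OF \<psi> \<omega>] by (simp add: lin_hom_add[OF \<psi>] \<psi>_wedge[OF xs])
  with assms(6) show False by contradiction
qed

text \<open>With \<open>G i j k = t\<^sub>i t\<^sub>j t\<^sub>k [e\<^sub>i, e\<^sub>j] \<and> e\<^sub>k\<close>, the relation \<open>\<Sum> t\<^sub>i e\<^sub>i = 0\<close> makes \<open>G\<close> change
  its sign when \<open>k\<close> or \<open>j\<close> is exchanged for the index that does not occur. This brings all three
  terms of the differential to the form \<open>G 1 2 4\<close>.\<close>

lemma ce_wedge_diff_3_eq_zero:
  assumes e: "x1 \<in> carrier L" "x2 \<in> carrier L" "x3 \<in> carrier L" "x4 \<in> carrier L"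
    and t: "t1 \<in> carrier R" "t2 \<in> carrier R" "t3 \<in> carrier R" "t4 \<in> carrier R"
    and sq: "t1 \<otimes>\<^bsub>R\<^esub> t1 = \<zero>\<^bsub>R\<^esub>" "t2 \<otimes>\<^bsub>R\<^esub> t2 = \<zero>\<^bsub>R\<^esub>" "t3 \<otimes>\<^bsub>R\<^esub> t3 = \<zero>\<^bsub>R\<^esub>" "t4 \<otimes>\<^bsub>R\<^esub> t4 = \<zero>\<^bsub>R\<^esub>"
    and char: "\<one>\<^bsub>R\<^esub> \<oplus>\<^bsub>R\<^esub> (\<one>\<^bsub>R\<^esub> \<oplus>\<^bsub>R\<^esub> \<one>\<^bsub>R\<^esub>) = \<zero>\<^bsub>R\<^esub>"
    and rel: "t1 \<odot>\<^bsub>L\<^esub> x1 \<oplus>\<^bsub>L\<^esub> (t2 \<odot>\<^bsub>L\<^esub> x2 \<oplus>\<^bsub>L\<^esub> (t3 \<odot>\<^bsub>L\<^esub> x3 \<oplus>\<^bsub>L\<^esub> t4 \<odot>\<^bsub>L\<^esub> x4)) = \<zero>\<^bsub>L\<^esub>"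
  shows "ce_wedge_diff R L 3 [(t1 \<otimes>\<^bsub>R\<^esub> (t2 \<otimes>\<^bsub>R\<^esub> t3)) \<odot>\<^bsub>L\<^esub> x1, x2, x3] = \<zero>\<^bsub>ext_power R L 2\<^esub>"
proof -
  let ?E = "ext_power R L 2"
  interpret E: module R ?E by (rule ext_module)
  define W where "W = (\<lambda>x y z. wedge R L [bracket L x y, z])"
  \<comment> \<open>Each coefficient stands directly before its vector, so that the moves below
    permute whole pairs.\<close>
  define G where "G = (\<lambda>p x q y r z. (p \<otimes>\<^bsub>R\<^esub> (q \<otimes>\<^bsub>R\<^esub> r)) \<odot>\<^bsub>?E\<^esub> W x y z)"
  have W: "W x y z \<in> carrier ?E" if "x \<in> carrier L" "y \<in> carrier L" "z \<in> carrier L" for x y z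
    using that by (simp add: W_def wedge2 bracket_closed)
  have W_neg: "W y x z = \<ominus>\<^bsub>?E\<^esub> W x y z" if "x \<in> carrier L" "y \<in> carrier L" "z \<in> carrier L" for x y z
    using that by (simp add: W_def bracket_antisym[of x y] wedge2_minus bracket_closed)
  have sq_mult: "p \<otimes>\<^bsub>R\<^esub> (q \<otimes>\<^bsub>R\<^esub> p) = \<zero>\<^bsub>R\<^esub>" "q \<otimes>\<^bsub>R\<^esub> (p \<otimes>\<^bsub>R\<^esub> p) = \<zero>\<^bsub>R\<^esub>" "p \<otimes>\<^bsub>R\<^esub> (p \<otimes>\<^bsub>R\<^esub> q) = \<zero>\<^bsub>R\<^esub>"
    if "p \<in> carrier R" "q \<in> carrier R" "p \<otimes>\<^bsub>R\<^esub> p = \<zero>\<^bsub>R\<^esub>" for p q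
  proof -
    show 1: "q \<otimes>\<^bsub>R\<^esub> (p \<otimes>\<^bsub>R\<^esub> p) = \<zero>\<^bsub>R\<^esub>" using that by simp
    show "p \<otimes>\<^bsub>R\<^esub> (q \<otimes>\<^bsub>R\<^esub> p) = \<zero>\<^bsub>R\<^esub>" using R.m_lcomm[OF that(1,2,1)] 1 by simp
    show "p \<otimes>\<^bsub>R\<^esub> (p \<otimes>\<^bsub>R\<^esub> q) = \<zero>\<^bsub>R\<^esub>" using R.m_assoc[OF that(1,1,2)] that by simp
  qed
  \<comment> \<open>The vanishing sum is placed in the last factor and multiplied by
    \<open>p\<close> and \<open>q\<close>. The terms in \<open>x\<close> and \<open>y\<close> need
    not vanish as wedges; the squares of \<open>p\<close> and \<open>q\<close> remove them.\<close>
  have swap3: "G p x q y r z = \<ominus>\<^bsub>?E\<^esub> G p x q y s u"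
    if c: "x \<in> carrier L" "y \<in> carrier L" "z \<in> carrier L" "u \<in> carrier L"
      "p \<in> carrier R" "q \<in> carrier R" "r \<in> carrier R" "s \<in> carrier R"
      and "p \<otimes>\<^bsub>R\<^esub> p = \<zero>\<^bsub>R\<^esub>" "q \<otimes>\<^bsub>R\<^esub> q = \<zero>\<^bsub>R\<^esub>"
      and r: "p \<odot>\<^bsub>L\<^esub> x \<oplus>\<^bsub>L\<^esub> (q \<odot>\<^bsub>L\<^esub> y \<oplus>\<^bsub>L\<^esub> (r \<odot>\<^bsub>L\<^esub> z \<oplus>\<^bsub>L\<^esub> s \<odot>\<^bsub>L\<^esub> u)) = \<zero>\<^bsub>L\<^esub>"
    for p x q y r z s u
  proof (rule E.M.minus_equality[symmetric])
    \<comment> \<open>Zero is spelled as a zero multiple of \<open>x\<close>, so that homogeneity in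
      the last factor shows that the wedge vanishes.\<close>
    have "\<zero>\<^bsub>?E\<^esub> = (p \<otimes>\<^bsub>R\<^esub> q) \<odot>\<^bsub>?E\<^esub> wedge R L [bracket L x y, \<zero>\<^bsub>R\<^esub> \<odot>\<^bsub>L\<^esub> x]"
      using c by (subst wedge2(5)) (auto simp: bracket_closed wedge2)
    also have "\<dots> = (p \<otimes>\<^bsub>R\<^esub> q) \<odot>\<^bsub>?E\<^esub>
        W x y (p \<odot>\<^bsub>L\<^esub> x \<oplus>\<^bsub>L\<^esub> (q \<odot>\<^bsub>L\<^esub> y \<oplus>\<^bsub>L\<^esub> (r \<odot>\<^bsub>L\<^esub> z \<oplus>\<^bsub>L\<^esub> s \<odot>\<^bsub>L\<^esub> u)))"
      using c unfolding r by (simp add: W_def)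
    also have "\<dots> = (p \<otimes>\<^bsub>R\<^esub> (q \<otimes>\<^bsub>R\<^esub> p)) \<odot>\<^bsub>?E\<^esub> W x y x \<oplus>\<^bsub>?E\<^esub>
        ((p \<otimes>\<^bsub>R\<^esub> (q \<otimes>\<^bsub>R\<^esub> q)) \<odot>\<^bsub>?E\<^esub> W x y y \<oplus>\<^bsub>?E\<^esub> (G p x q y r z \<oplus>\<^bsub>?E\<^esub> G p x q y s u))"
      using c by (simp add: W_def G_def wedge2 bracket_closed E.smult_r_distr R.m_assoc flip: E.smult_assoc1)
    also have "\<dots> = G p x q y r z \<oplus>\<^bsub>?E\<^esub> G p x q y s u"
      using that W by (simp add: sq_mult G_def)
    finally show "G p x q y r z \<oplus>\<^bsub>?E\<^esub> G p x q y s u = \<zero>\<^bsub>?E\<^esub>" ..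
  qed (use c W in \<open>auto simp: G_def\<close>)
  \<comment> \<open>The same with the sum inside the bracket and the coefficients \<open>p\<close>
    and \<open>r\<close>: the square of \<open>p\<close> removes the term with bracket of
    \<open>x\<close> and \<open>x\<close>, the square of \<open>r\<close> that with bracket of
    \<open>x\<close> and \<open>z\<close>.\<close>
  have swap2: "G p x q y r z = \<ominus>\<^bsub>?E\<^esub> G p x s u r z"
    if c: "x \<in> carrier L" "y \<in> carrier L" "z \<in> carrier L" "u \<in> carrier L"
      "p \<in> carrier R" "q \<in> carrier R" "r \<in> carrier R" "s \<in> carrier R"
      and "p \<otimes>\<^bsub>R\<^esub> p = \<zero>\<^bsub>R\<^esub>" "r \<otimes>\<^bsub>R\<^esub> r = \<zero>\<^bsub>R\<^esub>"
      and r: "p \<odot>\<^bsub>L\<^esub> x \<oplus>\<^bsub>L\<^esub> (r \<odot>\<^bsub>L\<^esub> z \<oplus>\<^bsub>L\<^esub> (q \<odot>\<^bsub>L\<^esub> y \<oplus>\<^bsub>L\<^esub> s \<odot>\<^bsub>L\<^esub> u)) = \<zero>\<^bsub>L\<^esub>"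
    for p x q y r z s u
  proof (rule E.M.minus_equality[symmetric])
    have "\<zero>\<^bsub>?E\<^esub> = (p \<otimes>\<^bsub>R\<^esub> r) \<odot>\<^bsub>?E\<^esub> wedge R L [bracket L x (\<zero>\<^bsub>R\<^esub> \<odot>\<^bsub>L\<^esub> x), z]"
      using c by (subst bracket_smult_right) (auto simp: bracket_closed wedge2_zero)
    also have "\<dots> = (p \<otimes>\<^bsub>R\<^esub> r) \<odot>\<^bsub>?E\<^esub>
        W x (p \<odot>\<^bsub>L\<^esub> x \<oplus>\<^bsub>L\<^esub> (r \<odot>\<^bsub>L\<^esub> z \<oplus>\<^bsub>L\<^esub> (q \<odot>\<^bsub>L\<^esub> y \<oplus>\<^bsub>L\<^esub> s \<odot>\<^bsub>L\<^esub> u))) z"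
      using c unfolding r by (simp add: W_def)
    also have "\<dots> = (p \<otimes>\<^bsub>R\<^esub> (r \<otimes>\<^bsub>R\<^esub> p)) \<odot>\<^bsub>?E\<^esub> W x x z \<oplus>\<^bsub>?E\<^esub>
        ((p \<otimes>\<^bsub>R\<^esub> (r \<otimes>\<^bsub>R\<^esub> r)) \<odot>\<^bsub>?E\<^esub> W x z z \<oplus>\<^bsub>?E\<^esub>
         ((p \<otimes>\<^bsub>R\<^esub> (r \<otimes>\<^bsub>R\<^esub> q)) \<odot>\<^bsub>?E\<^esub> W x y z \<oplus>\<^bsub>?E\<^esub> (p \<otimes>\<^bsub>R\<^esub> (r \<otimes>\<^bsub>R\<^esub> s)) \<odot>\<^bsub>?E\<^esub> W x u z))"
      using c by (simp add: W_def wedge2 bracket_linear E.smult_r_distr R.m_assoc flip: E.smult_assoc1)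
    also have "\<dots> = G p x q y r z \<oplus>\<^bsub>?E\<^esub> G p x s u r z"
      using that W by (simp add: sq_mult G_def R.m_comm)
    finally show "G p x q y r z \<oplus>\<^bsub>?E\<^esub> G p x s u r z = \<zero>\<^bsub>?E\<^esub>" ..
  qed (use c W in \<open>auto simp: G_def\<close>)
  have swap1: "G q y p x r z = \<ominus>\<^bsub>?E\<^esub> G p x q y r z"
    if c: "x \<in> carrier L" "y \<in> carrier L" "z \<in> carrier L" "p \<in> carrier R" "q \<in> carrier R" "r \<in> carrier R"
    for p x q y r z
    using c W W_neg[of x y z] by (simp add: G_def E.smult_r_minus R.m_lcomm)
  note ac = a_ac e t smult_closed
  let ?Y = "G t1 x1 t2 x2 t4 x4"
  have Y: "?Y \<in> carrier ?E" using e t W by (simp add: G_def)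
  have G134: "G t1 x1 t3 x3 t4 x4 = \<ominus>\<^bsub>?E\<^esub> ?Y"
    by (rule swap2) (use rel in \<open>simp_all add: ac sq\<close>)
  \<comment> \<open>The index paths are 123, 124; then 132, 134, 124; then 231, 234, 324, 314, 134,
    124. With 1, 2 and 5 sign changes the results are minus, plus and minus \<open>?Y\<close>. These
    are also the signs of the differential, so nothing cancels and three copies of \<open>?Y\<close>
    add up.\<close>
  have "G t1 x1 t2 x2 t3 x3 = \<ominus>\<^bsub>?E\<^esub> ?Y"
    by (rule swap3) (use rel in \<open>simp_all add: ac sq\<close>)
  moreover have "G t1 x1 t3 x3 t2 x2 = \<ominus>\<^bsub>?E\<^esub> G t1 x1 t3 x3 t4 x4"
    by (rule swap3) (use rel in \<open>simp_all add: ac sq\<close>)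
  moreover have "G t2 x2 t3 x3 t1 x1 = \<ominus>\<^bsub>?E\<^esub> G t2 x2 t3 x3 t4 x4"
    by (rule swap3) (use rel in \<open>simp_all add: ac sq\<close>)
  moreover have "G t2 x2 t3 x3 t4 x4 = \<ominus>\<^bsub>?E\<^esub> G t3 x3 t2 x2 t4 x4"
    by (rule swap1) (simp_all add: e t)
  moreover have "G t3 x3 t2 x2 t4 x4 = \<ominus>\<^bsub>?E\<^esub> G t3 x3 t1 x1 t4 x4"
    by (rule swap2) (use rel in \<open>simp_all add: ac sq\<close>)
  moreover have "G t3 x3 t1 x1 t4 x4 = \<ominus>\<^bsub>?E\<^esub> G t1 x1 t3 x3 t4 x4"
    by (rule swap1) (simp_all add: e t)
  ultimately have eqs: "G t1 x1 t2 x2 t3 x3 = \<ominus>\<^bsub>?E\<^esub> ?Y" "G t1 x1 t3 x3 t2 x2 = ?Y" "G t2 x2 t3 x3 t1 x1 = \<ominus>\<^bsub>?E\<^esub> ?Y"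
    using Y by (simp_all add: G134)
  let ?t = "t1 \<otimes>\<^bsub>R\<^esub> (t2 \<otimes>\<^bsub>R\<^esub> t3)"
  have "ce_wedge_diff R L 3 [?t \<odot>\<^bsub>L\<^esub> x1, x2, x3] =
      \<ominus>\<^bsub>?E\<^esub> (?t \<odot>\<^bsub>?E\<^esub> W x1 x2 x3) \<oplus>\<^bsub>?E\<^esub> (?t \<odot>\<^bsub>?E\<^esub> W x1 x3 x2 \<oplus>\<^bsub>?E\<^esub> \<ominus>\<^bsub>?E\<^esub> (?t \<odot>\<^bsub>?E\<^esub> W x2 x3 x1))"
    using e t by (simp add: ce_wedge_diff_3 W_def bracket_linear wedge2)
  also have "?t \<odot>\<^bsub>?E\<^esub> W x1 x2 x3 = G t1 x1 t2 x2 t3 x3" by (simp add: G_def)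
  also have "?t \<odot>\<^bsub>?E\<^esub> W x1 x3 x2 = G t1 x1 t3 x3 t2 x2" using t by (simp add: G_def R.m_comm)
  also have "?t \<odot>\<^bsub>?E\<^esub> W x2 x3 x1 = G t2 x2 t3 x3 t1 x1" using t by (simp add: G_def R.m_ac)
  also have "\<ominus>\<^bsub>?E\<^esub> G t1 x1 t2 x2 t3 x3 \<oplus>\<^bsub>?E\<^esub> (G t1 x1 t3 x3 t2 x2 \<oplus>\<^bsub>?E\<^esub> \<ominus>\<^bsub>?E\<^esub> G t2 x2 t3 x3 t1 x1) =
      ?Y \<oplus>\<^bsub>?E\<^esub> (?Y \<oplus>\<^bsub>?E\<^esub> ?Y)"
    using Y by (simp add: eqs)
  also have "\<dots> = (\<one>\<^bsub>R\<^esub> \<oplus>\<^bsub>R\<^esub> (\<one>\<^bsub>R\<^esub> \<oplus>\<^bsub>R\<^esub> \<one>\<^bsub>R\<^esub>)) \<odot>\<^bsub>?E\<^esub> ?Y"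
    using Y by (simp add: E.smult_l_distr)
  also have "\<dots> = \<zero>\<^bsub>?E\<^esub>" using Y by (simp add: char)
  finally show ?thesis .
qed

end


section \<open>Detecting classes on a free Lie algebra\<close>

text \<open>The target of the projection to the generators. It stands in for the weight one part of
  the free Lie algebra.\<close>

definition abelian_lie :: "('k, 'a, 'm) module_scheme \<Rightarrow> ('k, 'a) lie"
  where "abelian_lie M =
    \<lparr>carrier = carrier M, mult = (\<lambda>_ _. undefined), one = undefined,
      zero = \<zero>\<^bsub>M\<^esub>, add = (\<oplus>\<^bsub>M\<^esub>), smult = (\<odot>\<^bsub>M\<^esub>), bracket = (\<lambda>_ _. \<zero>\<^bsub>M\<^esub>)\<rparr>"

lemma abelian_lie_lie_algebra:
  assumes "module R M"
  shows "lie_algebra R (abelian_lie M)"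
proof -
  interpret M: module R M by fact
  have "abelian_group (abelian_lie M)"
    by (rule abelian_groupI) (auto simp: abelian_lie_def M.a_ac intro: M.M.add.l_inv_ex)
  then have "module R (abelian_lie M)"
    by (intro moduleI M.R.is_cring)
      (auto simp: abelian_lie_def M.smult_l_distr M.smult_r_distr M.smult_assoc1)
  then show ?thesis
    by (intro lie_algebra.intro lie_algebra_axioms.intro) (auto simp: abelian_lie_def)
qed

lemma alt_multilin_map:
  assumes "h \<in> lin_hom R M M'" "alt_multilin R M' n N f"
  shows "alt_multilin R M n N (\<lambda>xs. f (map h xs))"
proof -
  have t: "map h xs \<in> tuples M' n" if "xs \<in> tuples M n" for xs
    using that lin_hom_closed[OF assms(1)] by (auto simp: tuples_def)
  show ?thesis
    unfolding alt_multilin_def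
  proof (intro conjI ballI allI impI)
    fix xs i j assume xs: "xs \<in> tuples M n" and ij: "i < j" "j < n" "xs ! i = xs ! j"
    then have "map h xs ! i = map h xs ! j" by (simp add: tuples_def)
    then show "f (map h xs) = \<zero>\<^bsub>N\<^esub>"
      by (rule alt_multilin_zero[OF assms(2) t[OF xs] ij(1,2)])
  qed (auto simp: map_update lin_hom_add[OF assms(1)] lin_hom_smult[OF assms(1)]
      lin_hom_closed[OF assms(1)] t alt_multilin_closed[OF assms(2)] alt_multilin_add[OF assms(2)]
      alt_multilin_smult[OF assms(2)])
qed

text \<open>Freeness extends the identity of \<open>M\<close> to a projection \<open>\<pi>\<close>
  that undoes \<open>free_gen\<close>, so the pulled-back form takes the value \<open>f xs\<close>
  on the generators of \<open>xs\<close>. Its vanishing on brackets is automatic, as the target of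
  \<open>\<pi>\<close> is abelian.\<close>

lemma H_CE_3_free_lie_nontrivial:
  assumes "module R M" "module R N" "alt_multilin R M 3 N f" "xs \<in> tuples M 3"
    and "ce_wedge_diff R (free_lie R \<iota> M) 3 (map (free_gen R \<iota> M) xs) =
      \<zero>\<^bsub>ext_power R (free_lie R \<iota> M) 2\<^esub>"
    and "f xs \<noteq> \<zero>\<^bsub>N\<^esub>" "inj_on \<iota> (carrier M)"
  shows "carrier (H_CE R (free_lie R \<iota> M) 3) \<noteq> {\<zero>\<^bsub>H_CE R (free_lie R \<iota> M) 3\<^esub>}"
proof -
  let ?L = "free_lie R \<iota> M"
  interpret M: module R M by fact
  interpret N: module R N by fact
  interpret L: lie_algebra R ?L by (rule free_lie_lie_algebra) fact
  have id: "(\<lambda>x. x) \<in> lin_hom R M (abelian_lie M)"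
    by (simp add: lin_hom_def abelian_lie_def)
  obtain \<pi> where \<pi>: "\<pi> \<in> lie_hom R ?L (abelian_lie M)"
    and gen: "\<And>x. x \<in> carrier M \<Longrightarrow> \<pi> (free_gen R \<iota> M x) = x"
    using free_lie_universal[OF assms(1) abelian_lie_lie_algebra[OF assms(1)] assms(7) id] by blast
  have \<pi>_lin: "\<pi> \<in> lin_hom R ?L M"
    using lie_hom_lin_hom[OF \<pi>] by (simp add: lin_hom_def abelian_lie_def)
  have xs: "length xs = 3" "set xs \<subseteq> carrier M" using assms(4) by (auto simp: tuples_def)
  show ?thesis
  proof (rule L.H_CE_3_nontrivial[OF assms(2) alt_multilin_map[OF \<pi>_lin assms(3)] _ _ assms(5)])
    show "map (free_gen R \<iota> M) xs \<in> tuples ?L 3"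
      using xs by (auto simp: tuples_def intro: free_gen_closed)
    have "map \<pi> (map (free_gen R \<iota> M) xs) = xs"
      unfolding map_map by (rule map_idI) (use xs gen in auto)
    then show "f (map \<pi> (map (free_gen R \<iota> M) xs)) \<noteq> \<zero>\<^bsub>N\<^esub>" using assms(6) by simp
  next
    fix x y b c assume "x \<in> carrier ?L" "y \<in> carrier ?L" and bc: "b \<in> carrier ?L" "c \<in> carrier ?L"
    then have "\<pi> (bracket ?L x y) = \<zero>\<^bsub>M\<^esub>"
      using lie_hom_bracket[OF \<pi>] by (simp add: abelian_lie_def)
    moreover have "f [\<zero>\<^bsub>M\<^esub>, \<pi> b, \<pi> c] = \<zero>\<^bsub>N\<^esub>"
    proof -
      have t: "[\<zero>\<^bsub>M\<^esub>, \<pi> b, \<pi> c] \<in> tuples M 3"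
        using bc lin_hom_closed[OF \<pi>_lin] by (simp add: tuples_3)
      show ?thesis
        using alt_multilin_smult[OF assms(3) t, of 0 "\<zero>\<^bsub>R\<^esub>" "\<zero>\<^bsub>M\<^esub>"] alt_multilin_closed[OF assms(3) t]
        by simp
    qed
    ultimately show "f (map \<pi> [bracket ?L x y, b, c]) = \<zero>\<^bsub>N\<^esub>" by simp
  qed
qed

text \<open>\<open>F\<close> evaluates \<open>f\<close> on chosen representatives. Replacing them
  one slot at a time by given ones adds an element of \<open>N\<close> in that slot, which by
  additivity and the vanishing assumption for that slot changes nothing.\<close>

lemma alt_multilin_quot:
  assumes "module R V" "submodule N R V" "alt_multilin R V 3 K f"
    and vanish: "\<And>n b c. n \<in> N \<Longrightarrow> b \<in> carrier V \<Longrightarrow> c \<in> carrier V \<Longrightarrow> f [n, b, c] = \<zero>\<^bsub>K\<^esub>"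
      "\<And>n b c. n \<in> N \<Longrightarrow> b \<in> carrier V \<Longrightarrow> c \<in> carrier V \<Longrightarrow> f [b, n, c] = \<zero>\<^bsub>K\<^esub>"
      "\<And>n b c. n \<in> N \<Longrightarrow> b \<in> carrier V \<Longrightarrow> c \<in> carrier V \<Longrightarrow> f [b, c, n] = \<zero>\<^bsub>K\<^esub>"
    and "module R K"
  obtains F where "alt_multilin R (quot_module V N) 3 K F"
    "\<And>a b c. a \<in> carrier V \<Longrightarrow> b \<in> carrier V \<Longrightarrow> c \<in> carrier V \<Longrightarrow>
      F [N +>\<^bsub>V\<^esub> a, N +>\<^bsub>V\<^esub> b, N +>\<^bsub>V\<^esub> c] = f [a, b, c]"
proof
  interpret V: module R V by fact
  interpret K: module R K by fact
  interpret N: abelian_subgroup N V by (rule submodule_abelian_subgroup[OF assms(1,2)])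
  define rep where "rep = (\<lambda>X. SOME x. x \<in> X :: 'c)"
  define F where "F = (\<lambda>Xs. f (map rep Xs))"
  have rep: "\<exists>n\<in>N. rep (N +>\<^bsub>V\<^esub> x) = n \<oplus>\<^bsub>V\<^esub> x" if "x \<in> carrier V" for x
    unfolding rep_def using someI[of "\<lambda>y. y \<in> N +>\<^bsub>V\<^esub> x", OF N.a_rcos_self[OF that]]
    by (simp add: mem_a_r_coset)
  have NV: "n \<in> carrier V" if "n \<in> N" for n using that N.a_subset by auto
  have closed: "f [a, b, c] \<in> carrier K" if "a \<in> carrier V" "b \<in> carrier V" "c \<in> carrier V" for a b c
    using that by (intro alt_multilin_closed[OF assms(3)]) (simp add: tuples_3)
  have add: "f [n \<oplus>\<^bsub>V\<^esub> a, b, c] = f [n, b, c] \<oplus>\<^bsub>K\<^esub> f [a, b, c]"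
    "f [b, n \<oplus>\<^bsub>V\<^esub> a, c] = f [b, n, c] \<oplus>\<^bsub>K\<^esub> f [b, a, c]"
    "f [b, c, n \<oplus>\<^bsub>V\<^esub> a] = f [b, c, n] \<oplus>\<^bsub>K\<^esub> f [b, c, a]"
    if "n \<in> carrier V" "a \<in> carrier V" "b \<in> carrier V" "c \<in> carrier V" for n a b c
    using alt_multilin_add[OF assms(3), of "[a, b, c]" 0 n a] alt_multilin_add[OF assms(3), of "[b, a, c]" 1 n a]
      alt_multilin_add[OF assms(3), of "[b, c, a]" 2 n a] that by (simp_all add: tuples_3)
  have smult: "f [r \<odot>\<^bsub>V\<^esub> a, b, c] = r \<odot>\<^bsub>K\<^esub> f [a, b, c]"
    "f [a, r \<odot>\<^bsub>V\<^esub> b, c] = r \<odot>\<^bsub>K\<^esub> f [a, b, c]"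
    "f [a, b, r \<odot>\<^bsub>V\<^esub> c] = r \<odot>\<^bsub>K\<^esub> f [a, b, c]"
    if "r \<in> carrier R" "a \<in> carrier V" "b \<in> carrier V" "c \<in> carrier V" for r a b c
    using alt_multilin_smult[OF assms(3), of "[a, b, c]" 0 r a] alt_multilin_smult[OF assms(3), of "[a, b, c]" 1 r b]
      alt_multilin_smult[OF assms(3), of "[a, b, c]" 2 r c] that by (simp_all add: tuples_3)
  have zero: "f [a, a, b] = \<zero>\<^bsub>K\<^esub>" "f [a, b, a] = \<zero>\<^bsub>K\<^esub>" "f [b, a, a] = \<zero>\<^bsub>K\<^esub>"
    if "a \<in> carrier V" "b \<in> carrier V" for a b
    using alt_multilin_zero[OF assms(3), of "[a, a, b]" 0 1] alt_multilin_zero[OF assms(3), of "[a, b, a]" 0 2]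
      alt_multilin_zero[OF assms(3), of "[b, a, a]" 1 2] that by (simp_all add: tuples_3)
  show F: "F [N +>\<^bsub>V\<^esub> a, N +>\<^bsub>V\<^esub> b, N +>\<^bsub>V\<^esub> c] = f [a, b, c]"
    if abc: "a \<in> carrier V" "b \<in> carrier V" "c \<in> carrier V" for a b c
  proof -
    obtain l m n where lmn: "l \<in> N" "m \<in> N" "n \<in> N"
      and r: "rep (N +>\<^bsub>V\<^esub> a) = l \<oplus>\<^bsub>V\<^esub> a" "rep (N +>\<^bsub>V\<^esub> b) = m \<oplus>\<^bsub>V\<^esub> b" "rep (N +>\<^bsub>V\<^esub> c) = n \<oplus>\<^bsub>V\<^esub> c"
      using rep[OF abc(1)] rep[OF abc(2)] rep[OF abc(3)] by blast
    have "F [N +>\<^bsub>V\<^esub> a, N +>\<^bsub>V\<^esub> b, N +>\<^bsub>V\<^esub> c] = f [l \<oplus>\<^bsub>V\<^esub> a, m \<oplus>\<^bsub>V\<^esub> b, n \<oplus>\<^bsub>V\<^esub> c]"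
      by (simp add: F_def r)
    also have "\<dots> = f [a, m \<oplus>\<^bsub>V\<^esub> b, n \<oplus>\<^bsub>V\<^esub> c]"
      using lmn abc by (simp add: add(1) NV vanish(1) closed)
    also have "\<dots> = f [a, b, n \<oplus>\<^bsub>V\<^esub> c]"
      using lmn abc by (simp add: add(2) NV vanish(2) closed)
    also have "\<dots> = f [a, b, c]"
      using lmn abc by (simp add: add(3) NV vanish(3) closed)
    finally show ?thesis .
  qed
  note s = quot_add[OF assms(1,2)] quot_smult[OF assms(1,2)] F closed add smult zero
  show "alt_multilin R (quot_module V N) 3 K F"
    by (rule alt_multilin_3I; unfold quot_carrier; elim imageE; simp add: s)
qed


section \<open>The determinant form\<close>

definition self_module :: "('k, 'r) ring_scheme \<Rightarrow> ('k, 'k) module"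
  where "self_module R =
    \<lparr>carrier = carrier R, mult = (\<lambda>_ _. undefined), one = undefined,
      zero = \<zero>\<^bsub>R\<^esub>, add = (\<oplus>\<^bsub>R\<^esub>), smult = (\<otimes>\<^bsub>R\<^esub>)\<rparr>"

lemma self_module_module:
  assumes "cring R"
  shows "module R (self_module R)"
proof -
  interpret R: cring R by fact
  have "abelian_group (self_module R)"
    by (rule abelian_groupI) (auto simp: self_module_def R.a_ac intro: R.add.l_inv_ex)
  then show ?thesis
    by (intro moduleI assms) (auto simp: self_module_def R.l_distr R.r_distr R.m_assoc)
qed

definition det2 :: "('k, 'r) ring_scheme \<Rightarrow> 'k \<Rightarrow> 'k \<Rightarrow> 'k \<Rightarrow> 'k \<Rightarrow> 'k"
  where "det2 R y0 y1 z0 z1 = y0 \<otimes>\<^bsub>R\<^esub> z1 \<ominus>\<^bsub>R\<^esub> y1 \<otimes>\<^bsub>R\<^esub> z0"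

definition det3 :: "('k, 'r) ring_scheme \<Rightarrow> 'k \<Rightarrow> 'k \<Rightarrow> 'k \<Rightarrow> 'k \<Rightarrow> 'k \<Rightarrow> 'k \<Rightarrow> 'k \<Rightarrow> 'k \<Rightarrow> 'k \<Rightarrow> 'k"
  where "det3 R x0 x1 x2 y0 y1 y2 z0 z1 z2 =
    x0 \<otimes>\<^bsub>R\<^esub> det2 R y1 y2 z1 z2 \<ominus>\<^bsub>R\<^esub> x1 \<otimes>\<^bsub>R\<^esub> det2 R y0 y2 z0 z2 \<oplus>\<^bsub>R\<^esub> x2 \<otimes>\<^bsub>R\<^esub> det2 R y0 y1 z0 z1"

text \<open>Laplace expansion along a row \<open>t\<close> written below three others;
  \<open>a\<close>, \<open>b\<close>, \<open>c\<close>, \<open>d\<close> are meant as the minors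
  that omit column 3, 2, 1, 0. With the row \<open>t\<close> last, the value in
  \<open>det4_basis\<close> is \<open>t3\<close> without a sign.\<close>

definition alt_comb :: "('k, 'r) ring_scheme \<Rightarrow> 'k \<Rightarrow> 'k \<Rightarrow> 'k \<Rightarrow> 'k \<Rightarrow> 'k \<Rightarrow> 'k \<Rightarrow> 'k \<Rightarrow> 'k \<Rightarrow> 'k"
  where "alt_comb R t0 t1 t2 t3 a b c d =
    (t3 \<otimes>\<^bsub>R\<^esub> a \<ominus>\<^bsub>R\<^esub> t2 \<otimes>\<^bsub>R\<^esub> b) \<oplus>\<^bsub>R\<^esub> (t1 \<otimes>\<^bsub>R\<^esub> c \<ominus>\<^bsub>R\<^esub> t0 \<otimes>\<^bsub>R\<^esub> d)"

text \<open>The determinant with rows \<open>x\<close>, \<open>y\<close>, \<open>z\<close>,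
  \<open>t\<close>. Since \<open>t\<close> is kept apart from the minors, linearity and alternation
  in the other rows are inherited from \<open>det3\<close>; only the coincidence of \<open>t\<close>
  with another row mixes the two layers.\<close>

definition det4 :: "('k, 'r) ring_scheme \<Rightarrow> 'k \<Rightarrow> 'k \<Rightarrow> 'k \<Rightarrow> 'k \<Rightarrow> 'k \<Rightarrow> 'k \<Rightarrow> 'k \<Rightarrow> 'k \<Rightarrow>
    'k \<Rightarrow> 'k \<Rightarrow> 'k \<Rightarrow> 'k \<Rightarrow> 'k \<Rightarrow> 'k \<Rightarrow> 'k \<Rightarrow> 'k \<Rightarrow> 'k"
  where "det4 R t0 t1 t2 t3 x0 x1 x2 x3 y0 y1 y2 y3 z0 z1 z2 z3 = alt_comb R t0 t1 t2 t3
    (det3 R x0 x1 x2 y0 y1 y2 z0 z1 z2) (det3 R x0 x1 x3 y0 y1 y3 z0 z1 z3)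
    (det3 R x0 x2 x3 y0 y2 y3 z0 z2 z3) (det3 R x1 x2 x3 y1 y2 y3 z1 z2 z3)"

context cring
begin

lemma det2_closed:
  assumes "y0 \<in> carrier R" "y1 \<in> carrier R" "z0 \<in> carrier R" "z1 \<in> carrier R"
  shows "det2 R y0 y1 z0 z1 \<in> carrier R"
  using assms by (simp add: det2_def)

lemma det3_closed:
  assumes "x0 \<in> carrier R" "x1 \<in> carrier R" "x2 \<in> carrier R"
    "y0 \<in> carrier R" "y1 \<in> carrier R" "y2 \<in> carrier R"
    "z0 \<in> carrier R" "z1 \<in> carrier R" "z2 \<in> carrier R"
  shows "det3 R x0 x1 x2 y0 y1 y2 z0 z1 z2 \<in> carrier R"
  using assms by (simp add: det3_def det2_closed)

lemma det3_swap12: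
  assumes "x0 \<in> carrier R" "x1 \<in> carrier R" "x2 \<in> carrier R"
    "y0 \<in> carrier R" "y1 \<in> carrier R" "y2 \<in> carrier R"
    "z0 \<in> carrier R" "z1 \<in> carrier R" "z2 \<in> carrier R"
  shows "det3 R x0 x1 x2 y0 y1 y2 z0 z1 z2 = \<ominus> det3 R y0 y1 y2 x0 x1 x2 z0 z1 z2"
  unfolding det3_def det2_def using assms by algebra

lemma det3_swap23:
  assumes "x0 \<in> carrier R" "x1 \<in> carrier R" "x2 \<in> carrier R"
    "y0 \<in> carrier R" "y1 \<in> carrier R" "y2 \<in> carrier R"
    "z0 \<in> carrier R" "z1 \<in> carrier R" "z2 \<in> carrier R"
  shows "det3 R x0 x1 x2 y0 y1 y2 z0 z1 z2 = \<ominus> det3 R x0 x1 x2 z0 z1 z2 y0 y1 y2"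
  unfolding det3_def det2_def using assms by algebra

lemma det3_same12:
  assumes "x0 \<in> carrier R" "x1 \<in> carrier R" "x2 \<in> carrier R"
    "z0 \<in> carrier R" "z1 \<in> carrier R" "z2 \<in> carrier R"
  shows "det3 R x0 x1 x2 x0 x1 x2 z0 z1 z2 = \<zero>"
  unfolding det3_def det2_def using assms by algebra

lemma det3_add:
  assumes "x0 \<in> carrier R" "x1 \<in> carrier R" "x2 \<in> carrier R"
    "w0 \<in> carrier R" "w1 \<in> carrier R" "w2 \<in> carrier R"
    "y0 \<in> carrier R" "y1 \<in> carrier R" "y2 \<in> carrier R"
    "z0 \<in> carrier R" "z1 \<in> carrier R" "z2 \<in> carrier R"
  shows "det3 R (x0 \<oplus> w0) (x1 \<oplus> w1) (x2 \<oplus> w2) y0 y1 y2 z0 z1 z2 =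
    det3 R x0 x1 x2 y0 y1 y2 z0 z1 z2 \<oplus> det3 R w0 w1 w2 y0 y1 y2 z0 z1 z2"
  using assms by (simp add: det3_def det2_closed l_distr minus_add a_minus_def a_ac)

lemma det3_mult:
  assumes "r \<in> carrier R" "x0 \<in> carrier R" "x1 \<in> carrier R" "x2 \<in> carrier R"
    "y0 \<in> carrier R" "y1 \<in> carrier R" "y2 \<in> carrier R" "z0 \<in> carrier R"
    "z1 \<in> carrier R" "z2 \<in> carrier R"
  shows "det3 R (r \<otimes> x0) (r \<otimes> x1) (r \<otimes> x2) y0 y1 y2 z0 z1 z2 = r \<otimes> det3 R x0 x1 x2 y0 y1 y2 z0 z1 z2"
  unfolding det3_def det2_def using assms by algebra

context
  fixes t0 t1 t2 t3 a b c d
  assumes carr: "t0 \<in> carrier R" "t1 \<in> carrier R" "t2 \<in> carrier R" "t3 \<in> carrier R"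
    "a \<in> carrier R" "b \<in> carrier R" "c \<in> carrier R" "d \<in> carrier R"
begin

lemma alt_comb_closed: "alt_comb R t0 t1 t2 t3 a b c d \<in> carrier R"
  using carr by (simp add: alt_comb_def)

lemma alt_comb_minus:
  "alt_comb R t0 t1 t2 t3 (\<ominus> a) (\<ominus> b) (\<ominus> c) (\<ominus> d) = \<ominus> alt_comb R t0 t1 t2 t3 a b c d"
  unfolding alt_comb_def using carr by algebra

lemma alt_comb_add:
  assumes "a' \<in> carrier R" "b' \<in> carrier R" "c' \<in> carrier R" "d' \<in> carrier R"
  shows "alt_comb R t0 t1 t2 t3 (a \<oplus> a') (b \<oplus> b') (c \<oplus> c') (d \<oplus> d') =
    alt_comb R t0 t1 t2 t3 a b c d \<oplus> alt_comb R t0 t1 t2 t3 a' b' c' d'"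
  unfolding alt_comb_def using carr assms by algebra

lemma alt_comb_mult:
  assumes "r \<in> carrier R"
  shows "alt_comb R t0 t1 t2 t3 (r \<otimes> a) (r \<otimes> b) (r \<otimes> c) (r \<otimes> d) = r \<otimes> alt_comb R t0 t1 t2 t3 a b c d"
  unfolding alt_comb_def using carr assms by algebra

end

text \<open>The case of the row \<open>x\<close> equal to \<open>t\<close>, with the 3 by 3 minors
  expanded along it and \<open>m01\<close> to \<open>m23\<close> in place of the 2 by 2 minors of
  the rows \<open>y\<close> and \<open>z\<close>. Each product of two coefficients and one
  \<open>m\<close> occurs twice, with opposite signs.\<close>

lemma alt_comb_minors:
  assumes "t0 \<in> carrier R" "t1 \<in> carrier R" "t2 \<in> carrier R" "t3 \<in> carrier R"
    "m01 \<in> carrier R" "m02 \<in> carrier R" "m03 \<in> carrier R" "m12 \<in> carrier R"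
    "m13 \<in> carrier R" "m23 \<in> carrier R"
  shows "alt_comb R t0 t1 t2 t3 (t0 \<otimes> m12 \<ominus> t1 \<otimes> m02 \<oplus> t2 \<otimes> m01) (t0 \<otimes> m13 \<ominus> t1 \<otimes> m03 \<oplus> t3 \<otimes> m01)
    (t0 \<otimes> m23 \<ominus> t2 \<otimes> m03 \<oplus> t3 \<otimes> m02) (t1 \<otimes> m23 \<ominus> t2 \<otimes> m13 \<oplus> t3 \<otimes> m12) = \<zero>"
  unfolding alt_comb_def using assms by algebra

context
  fixes t0 t1 t2 t3 x0 x1 x2 x3 y0 y1 y2 y3 z0 z1 z2 z3
  assumes carr: "t0 \<in> carrier R" "t1 \<in> carrier R" "t2 \<in> carrier R" "t3 \<in> carrier R"
    "x0 \<in> carrier R" "x1 \<in> carrier R" "x2 \<in> carrier R" "x3 \<in> carrier R"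
    "y0 \<in> carrier R" "y1 \<in> carrier R" "y2 \<in> carrier R" "y3 \<in> carrier R"
    "z0 \<in> carrier R" "z1 \<in> carrier R" "z2 \<in> carrier R" "z3 \<in> carrier R"
begin

lemma det4_closed: "det4 R t0 t1 t2 t3 x0 x1 x2 x3 y0 y1 y2 y3 z0 z1 z2 z3 \<in> carrier R"
  using carr by (simp add: det4_def alt_comb_closed det3_closed)

lemma det4_swap12:
  "det4 R t0 t1 t2 t3 x0 x1 x2 x3 y0 y1 y2 y3 z0 z1 z2 z3 =
    \<ominus> det4 R t0 t1 t2 t3 y0 y1 y2 y3 x0 x1 x2 x3 z0 z1 z2 z3"
  using carr
  by (simp add: det4_def det3_swap12[of x0] det3_swap12[of x1 x2] alt_comb_minus det3_closed)

lemma det4_swap23: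
  "det4 R t0 t1 t2 t3 x0 x1 x2 x3 y0 y1 y2 y3 z0 z1 z2 z3 =
    \<ominus> det4 R t0 t1 t2 t3 x0 x1 x2 x3 z0 z1 z2 z3 y0 y1 y2 y3"
  using carr
  by (simp add: det4_def det3_swap23[of _ _ _ y0] det3_swap23[of _ _ _ y1 y2] alt_comb_minus det3_closed)

lemma det4_add:
  assumes "w0 \<in> carrier R" "w1 \<in> carrier R" "w2 \<in> carrier R" "w3 \<in> carrier R"
  shows "det4 R t0 t1 t2 t3 (x0 \<oplus> w0) (x1 \<oplus> w1) (x2 \<oplus> w2) (x3 \<oplus> w3) y0 y1 y2 y3 z0 z1 z2 z3 =
    det4 R t0 t1 t2 t3 x0 x1 x2 x3 y0 y1 y2 y3 z0 z1 z2 z3 \<oplus>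
    det4 R t0 t1 t2 t3 w0 w1 w2 w3 y0 y1 y2 y3 z0 z1 z2 z3"
  using carr assms by (simp add: det4_def det3_add alt_comb_add det3_closed)

lemma det4_mult:
  assumes "r \<in> carrier R"
  shows "det4 R t0 t1 t2 t3 (r \<otimes> x0) (r \<otimes> x1) (r \<otimes> x2) (r \<otimes> x3) y0 y1 y2 y3 z0 z1 z2 z3 =
    r \<otimes> det4 R t0 t1 t2 t3 x0 x1 x2 x3 y0 y1 y2 y3 z0 z1 z2 z3"
  using carr assms by (simp add: det4_def det3_mult alt_comb_mult det3_closed)

end

lemma det4_same12:
  assumes "t0 \<in> carrier R" "t1 \<in> carrier R" "t2 \<in> carrier R" "t3 \<in> carrier R"
    "x0 \<in> carrier R" "x1 \<in> carrier R" "x2 \<in> carrier R" "x3 \<in> carrier R"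
    "z0 \<in> carrier R" "z1 \<in> carrier R" "z2 \<in> carrier R" "z3 \<in> carrier R"
  shows "det4 R t0 t1 t2 t3 x0 x1 x2 x3 x0 x1 x2 x3 z0 z1 z2 z3 = \<zero>"
  using assms by (simp add: det4_def det3_same12 alt_comb_def a_minus_def r_neg)

lemma det4_same01:
  assumes "t0 \<in> carrier R" "t1 \<in> carrier R" "t2 \<in> carrier R" "t3 \<in> carrier R"
    "y0 \<in> carrier R" "y1 \<in> carrier R" "y2 \<in> carrier R" "y3 \<in> carrier R"
    "z0 \<in> carrier R" "z1 \<in> carrier R" "z2 \<in> carrier R" "z3 \<in> carrier R"
  shows "det4 R t0 t1 t2 t3 t0 t1 t2 t3 y0 y1 y2 y3 z0 z1 z2 z3 = \<zero>"
  unfolding det4_def det3_def using assms by (intro alt_comb_minors) (simp_all add: det2_closed)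

lemma det4_basis:
  assumes "t0 \<in> carrier R" "t1 \<in> carrier R" "t2 \<in> carrier R" "t3 \<in> carrier R"
  shows "det4 R t0 t1 t2 t3 \<one> \<zero> \<zero> \<zero> \<zero> \<one> \<zero> \<zero> \<zero> \<zero> \<one> \<zero> = t3"
  unfolding det4_def alt_comb_def det3_def det2_def using assms by algebra

end


text \<open>The type \<open>4\<close> consists of the residues 0 to 3, which stand for the indices 1
  to 4 of the informal statement.\<close>

definition det_form :: "('k, 'r) ring_scheme \<Rightarrow> (4 \<Rightarrow> 'k) \<Rightarrow> (4 \<Rightarrow> 'k) list \<Rightarrow> 'k"
  where "det_form R t xs = det4 R (t 0) (t 1) (t 2) (t 3)
    ((xs ! 0) 0) ((xs ! 0) 1) ((xs ! 0) 2) ((xs ! 0) 3)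
    ((xs ! 1) 0) ((xs ! 1) 1) ((xs ! 1) 2) ((xs ! 1) 3)
    ((xs ! 2) 0) ((xs ! 2) 1) ((xs ! 2) 2) ((xs ! 2) 3)"

context cring
begin

context
  fixes t :: "4 \<Rightarrow> 'a"
  assumes t: "\<And>i. t i \<in> carrier R"
begin

lemma det_form_closed:
  assumes "\<And>i. x i \<in> carrier R" "\<And>i. y i \<in> carrier R" "\<And>i. z i \<in> carrier R"
  shows "det_form R t [x, y, z] \<in> carrier R"
  using assms t by (simp add: det_form_def det4_closed)

lemma det_form_swap12:
  assumes "\<And>i. x i \<in> carrier R" "\<And>i. y i \<in> carrier R" "\<And>i. z i \<in> carrier R"
  shows "det_form R t [x, y, z] = \<ominus> det_form R t [y, x, z]"
  unfolding det_form_def using assms t by (subst det4_swap12) simp_all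

lemma det_form_swap23:
  assumes "\<And>i. x i \<in> carrier R" "\<And>i. y i \<in> carrier R" "\<And>i. z i \<in> carrier R"
  shows "det_form R t [x, y, z] = \<ominus> det_form R t [x, z, y]"
  unfolding det_form_def using assms t by (subst det4_swap23) simp_all

text \<open>Only the first slot is expanded. The other slots are carried there and back by exchanges
  of neighbours, whose signs occur on both sides.\<close>

lemma det_form_add:
  assumes "\<And>i. x i \<in> carrier R" "\<And>i. y i \<in> carrier R" "\<And>i. z i \<in> carrier R" "\<And>i. w i \<in> carrier R"
  shows "det_form R t [\<lambda>i. x i \<oplus> w i, y, z] = det_form R t [x, y, z] \<oplus> det_form R t [w, y, z]"
    and "det_form R t [y, \<lambda>i. x i \<oplus> w i, z] = det_form R t [y, x, z] \<oplus> det_form R t [y, w, z]"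
    and "det_form R t [y, z, \<lambda>i. x i \<oplus> w i] = det_form R t [y, z, x] \<oplus> det_form R t [y, z, w]"
proof -
  have add1: "det_form R t [\<lambda>i. x i \<oplus> w i, y, z] = det_form R t [x, y, z] \<oplus> det_form R t [w, y, z]"
    if "\<And>i. x i \<in> carrier R" "\<And>i. y i \<in> carrier R" "\<And>i. z i \<in> carrier R" "\<And>i. w i \<in> carrier R"
    for x y z w
    using that t by (simp add: det_form_def det4_add)
  have add2: "det_form R t [y, \<lambda>i. x i \<oplus> w i, z] = det_form R t [y, x, z] \<oplus> det_form R t [y, w, z]"
    if "\<And>i. x i \<in> carrier R" "\<And>i. y i \<in> carrier R" "\<And>i. z i \<in> carrier R" "\<And>i. w i \<in> carrier R"
    for x y z w
  proof -
    have "det_form R t [y, \<lambda>i. x i \<oplus> w i, z] = \<ominus> det_form R t [\<lambda>i. x i \<oplus> w i, y, z]"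
      using that by (intro det_form_swap12) auto
    also have "\<dots> = \<ominus> (det_form R t [x, y, z] \<oplus> det_form R t [w, y, z])"
      using that by (subst add1) auto
    also have "\<dots> = \<ominus> det_form R t [x, y, z] \<oplus> \<ominus> det_form R t [w, y, z]"
      using that by (intro minus_add det_form_closed) auto
    also have "\<ominus> det_form R t [x, y, z] = det_form R t [y, x, z]"
      using that by (intro det_form_swap12[symmetric]) auto
    also have "\<ominus> det_form R t [w, y, z] = det_form R t [y, w, z]"
      using that by (intro det_form_swap12[symmetric]) auto
    finally show ?thesis .
  qed
  have add3: "det_form R t [y, z, \<lambda>i. x i \<oplus> w i] = det_form R t [y, z, x] \<oplus> det_form R t [y, z, w]"
    if "\<And>i. x i \<in> carrier R" "\<And>i. y i \<in> carrier R" "\<And>i. z i \<in> carrier R" "\<And>i. w i \<in> carrier R"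
    for x y z w
  proof -
    have "det_form R t [y, z, \<lambda>i. x i \<oplus> w i] = \<ominus> det_form R t [y, \<lambda>i. x i \<oplus> w i, z]"
      using that by (intro det_form_swap23) auto
    also have "\<dots> = \<ominus> (det_form R t [y, x, z] \<oplus> det_form R t [y, w, z])"
      using that by (subst add2) auto
    also have "\<dots> = \<ominus> det_form R t [y, x, z] \<oplus> \<ominus> det_form R t [y, w, z]"
      using that by (intro minus_add det_form_closed) auto
    also have "\<ominus> det_form R t [y, x, z] = det_form R t [y, z, x]"
      using that by (intro det_form_swap23[symmetric]) auto
    also have "\<ominus> det_form R t [y, w, z] = det_form R t [y, z, w]"
      using that by (intro det_form_swap23[symmetric]) auto
    finally show ?thesis .
  qed
  show "det_form R t [\<lambda>i. x i \<oplus> w i, y, z] = det_form R t [x, y, z] \<oplus> det_form R t [w, y, z]"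
    by (rule add1) fact+
  show "det_form R t [y, \<lambda>i. x i \<oplus> w i, z] = det_form R t [y, x, z] \<oplus> det_form R t [y, w, z]"
    by (rule add2) fact+
  show "det_form R t [y, z, \<lambda>i. x i \<oplus> w i] = det_form R t [y, z, x] \<oplus> det_form R t [y, z, w]"
    by (rule add3) fact+
qed

lemma det_form_mult:
  assumes "\<And>i. x i \<in> carrier R" "\<And>i. y i \<in> carrier R" "\<And>i. z i \<in> carrier R" "r \<in> carrier R"
  shows "det_form R t [\<lambda>i. r \<otimes> x i, y, z] = r \<otimes> det_form R t [x, y, z]"
    and "det_form R t [y, \<lambda>i. r \<otimes> x i, z] = r \<otimes> det_form R t [y, x, z]"
    and "det_form R t [y, z, \<lambda>i. r \<otimes> x i] = r \<otimes> det_form R t [y, z, x]"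
proof -
  have mult1: "det_form R t [\<lambda>i. r \<otimes> x i, y, z] = r \<otimes> det_form R t [x, y, z]"
    if "\<And>i. x i \<in> carrier R" "\<And>i. y i \<in> carrier R" "\<And>i. z i \<in> carrier R" for x y z
    using that assms(4) t by (simp add: det_form_def det4_mult)
  have mult2: "det_form R t [y, \<lambda>i. r \<otimes> x i, z] = r \<otimes> det_form R t [y, x, z]"
    if "\<And>i. x i \<in> carrier R" "\<And>i. y i \<in> carrier R" "\<And>i. z i \<in> carrier R" for x y z
  proof -
    have "det_form R t [y, \<lambda>i. r \<otimes> x i, z] = \<ominus> det_form R t [\<lambda>i. r \<otimes> x i, y, z]"
      using that assms(4) by (intro det_form_swap12) auto
    also have "\<dots> = \<ominus> (r \<otimes> det_form R t [x, y, z])"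
      using that by (subst mult1) auto
    also have "\<dots> = r \<otimes> \<ominus> det_form R t [x, y, z]"
      using that assms(4) by (intro r_minus[symmetric] det_form_closed) auto
    also have "\<ominus> det_form R t [x, y, z] = det_form R t [y, x, z]"
      using that by (intro det_form_swap12[symmetric]) auto
    finally show ?thesis .
  qed
  have mult3: "det_form R t [y, z, \<lambda>i. r \<otimes> x i] = r \<otimes> det_form R t [y, z, x]"
    if "\<And>i. x i \<in> carrier R" "\<And>i. y i \<in> carrier R" "\<And>i. z i \<in> carrier R" for x y z
  proof -
    have "det_form R t [y, z, \<lambda>i. r \<otimes> x i] = \<ominus> det_form R t [y, \<lambda>i. r \<otimes> x i, z]"
      using that assms(4) by (intro det_form_swap23) auto
    also have "\<dots> = \<ominus> (r \<otimes> det_form R t [y, x, z])"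
      using that by (subst mult2) auto
    also have "\<dots> = r \<otimes> \<ominus> det_form R t [y, x, z]"
      using that assms(4) by (intro r_minus[symmetric] det_form_closed) auto
    also have "\<ominus> det_form R t [y, x, z] = det_form R t [y, z, x]"
      using that by (intro det_form_swap23[symmetric]) auto
    finally show ?thesis .
  qed
  show "det_form R t [\<lambda>i. r \<otimes> x i, y, z] = r \<otimes> det_form R t [x, y, z]"
    by (rule mult1) fact+
  show "det_form R t [y, \<lambda>i. r \<otimes> x i, z] = r \<otimes> det_form R t [y, x, z]"
    by (rule mult2) fact+
  show "det_form R t [y, z, \<lambda>i. r \<otimes> x i] = r \<otimes> det_form R t [y, z, x]"
    by (rule mult3) fact+
qed

lemma minus_zero_eq: "\<ominus> \<zero> = \<zero>"
  by (rule minus_equality) auto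

lemma det_form_same:
  assumes "\<And>i. x i \<in> carrier R" "\<And>i. y i \<in> carrier R"
  shows "det_form R t [x, x, y] = \<zero>" "det_form R t [x, y, x] = \<zero>" "det_form R t [y, x, x] = \<zero>"
proof -
  show 1: "det_form R t [x, x, y] = \<zero>"
    using assms t by (simp add: det_form_def det4_same12)
  show 2: "det_form R t [x, y, x] = \<zero>"
    by (subst det_form_swap23) (use assms in \<open>auto simp: 1 minus_zero_eq\<close>)
  show "det_form R t [y, x, x] = \<zero>"
    by (subst det_form_swap12) (use assms in \<open>auto simp: 2 minus_zero_eq\<close>)
qed

text \<open>The matrix has \<open>t\<close> as two of its rows. With \<open>t\<close> the
  coefficients of the defining relation, this is what lets the form descend to
  \<open>M_ex\<close>.\<close>

lemma det_form_t:
  assumes "\<And>i. x i \<in> carrier R" "\<And>i. y i \<in> carrier R"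
  shows "det_form R t [t, x, y] = \<zero>" "det_form R t [x, t, y] = \<zero>" "det_form R t [x, y, t] = \<zero>"
proof -
  have 1: "det_form R t [t, x, y] = \<zero>"
    if "\<And>i. x i \<in> carrier R" "\<And>i. y i \<in> carrier R" for x y
    using that t by (simp add: det_form_def det4_same01)
  show "det_form R t [t, x, y] = \<zero>" by (rule 1) fact+
  show 2: "det_form R t [x, t, y] = \<zero>"
    by (subst det_form_swap12) (use assms t in \<open>auto simp: 1 minus_zero_eq\<close>)
  show "det_form R t [x, y, t] = \<zero>"
    by (subst det_form_swap23) (use assms t in \<open>auto simp: 2 minus_zero_eq\<close>)
qed

lemma det_form_alt_multilin:
  "alt_multilin R (free_module R UNIV) 3 (self_module R) (det_form R t)"
proof -
  have V: "v i \<in> carrier R" if "v \<in> carrier (free_module R (UNIV :: 4 set))" for v i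
    using that by (simp add: free_module_def)
  have K: "carrier (self_module R) = carrier R" "\<zero>\<^bsub>self_module R\<^esub> = \<zero>"
    "a \<oplus>\<^bsub>self_module R\<^esub> b = a \<oplus> b" "a \<odot>\<^bsub>self_module R\<^esub> b = a \<otimes> b" for a b
    by (simp_all add: self_module_def)
  show ?thesis
    by (rule alt_multilin_3I)
      (simp_all add: V K free_module_simps det_form_closed det_form_add det_form_mult det_form_same)
qed

end

end


section \<open>The base ring\<close>

lemma UNIV_4: "(UNIV :: 4 set) = {0, 1, 2, 3}"
proof -
  have "x = 0 \<or> x = 1 \<or> x = 2 \<or> x = 3" for x :: 4
  proof (induct x)
    case (of_int z)
    then have "0 \<le> z" "z < 4" by simp_all
    then have "z = 0 \<or> z = 1 \<or> z = 2 \<or> z = 3" by arith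
    then show ?case by auto
  qed
  then show ?thesis by auto
qed

lemma poly4_cring: "cring poly4_ring"
  by (rule cringI) (auto simp: poly4_ring_def algebra_simps
      intro!: abelian_groupI comm_monoidI exI[of _ "- x" for x])

lemma poly4_simps: "carrier poly4_ring = UNIV" "p \<otimes>\<^bsub>poly4_ring\<^esub> q = p * q" "\<one>\<^bsub>poly4_ring\<^esub> = 1"
  "\<zero>\<^bsub>poly4_ring\<^esub> = 0" "p \<oplus>\<^bsub>poly4_ring\<^esub> q = p + q"
  by (simp_all add: poly4_ring_def)

lemma sq_ideal_ideal: "ideal sq_ideal poly4_ring"
proof -
  interpret cring poly4_ring by (rule poly4_cring)
  show ?thesis unfolding sq_ideal_def by (rule genideal_ideal) (simp add: poly4_simps)
qed

lemma kk_cring: "cring kk"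
  unfolding kk_def by (rule ideal.quotient_is_cring[OF sq_ideal_ideal poly4_cring])

text \<open>The quotient map as a function on polynomials; products and sums in \<open>kk\<close>
  can then be computed among polynomials first.\<close>

definition kk_class :: "poly4 \<Rightarrow> poly4 set"
  where "kk_class p = sq_ideal +>\<^bsub>poly4_ring\<^esub> p"

lemma kk_class_hom:
  "kk_class p \<in> carrier kk" "kk_class (p * q) = kk_class p \<otimes>\<^bsub>kk\<^esub> kk_class q"
  "kk_class (p + q) = kk_class p \<oplus>\<^bsub>kk\<^esub> kk_class q" "kk_class 1 = \<one>\<^bsub>kk\<^esub>"
  using ideal.rcos_ring_hom[OF sq_ideal_ideal] unfolding kk_def[symmetric]
  by (auto simp: ring_hom_def poly4_simps kk_class_def)

lemma kk_class_zero: "kk_class 0 = \<zero>\<^bsub>kk\<^esub>"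
proof -
  interpret kk: cring kk by (rule kk_cring)
  have "kk_class 0 \<oplus>\<^bsub>kk\<^esub> kk_class 0 = kk_class 0" by (simp flip: kk_class_hom(3))
  then show ?thesis using kk_class_hom(1)[of 0] by (metis kk.add.r_cancel_one')
qed

lemma kk_class_eq_zero:
  assumes "kk_class p = \<zero>\<^bsub>kk\<^esub>"
  shows "p \<in> sq_ideal"
proof -
  interpret ideal sq_ideal poly4_ring by (rule sq_ideal_ideal)
  have "p \<in> kk_class p" unfolding kk_class_def by (rule a_rcos_self) (simp add: poly4_simps)
  moreover have "kk_class 0 = sq_ideal"
    unfolding kk_class_def using a_coset_add_zero[OF a_subset] by (simp add: poly4_simps)
  ultimately show ?thesis using assms kk_class_zero by simp
qed

lemma kk_t_eq: "kk_t i = kk_class (poly_var i)"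
  by (simp add: kk_t_def kk_class_def)

lemma kk_t_closed: "kk_t i \<in> carrier kk"
  by (simp add: kk_t_eq kk_class_hom(1))

lemma poly_var_square: "poly_var i ^ 2 = poly_var i * poly_var i"
  by (simp add: power2_eq_square)

lemma kk_t_square: "kk_t i \<otimes>\<^bsub>kk\<^esub> kk_t i = \<zero>\<^bsub>kk\<^esub>"
proof -
  interpret cring poly4_ring by (rule poly4_cring)
  have "poly_var i ^ 2 \<in> sq_ideal"
    unfolding sq_ideal_def
    using genideal_self[of "range (\<lambda>i. poly_var i ^ 2)"] by (auto simp: poly4_simps)
  then have "kk_class (poly_var i ^ 2) = sq_ideal"
    unfolding kk_class_def
    using ideal.axioms(1)[OF sq_ideal_ideal, THEN additive_subgroup.a_subgroup]
    by (intro a_coset_join2) (auto simp: poly4_simps)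
  also have "\<dots> = \<zero>\<^bsub>kk\<^esub>" by (simp add: kk_def FactRing_def)
  finally show ?thesis by (metis kk_t_eq poly_var_square kk_class_hom(2))
qed

lemma kk_char_3: "\<one>\<^bsub>kk\<^esub> \<oplus>\<^bsub>kk\<^esub> (\<one>\<^bsub>kk\<^esub> \<oplus>\<^bsub>kk\<^esub> \<one>\<^bsub>kk\<^esub>) = \<zero>\<^bsub>kk\<^esub>"
proof -
  have "(1 :: poly4) + (1 + 1) = 0"
  proof -
    have "(1 :: poly4) + (1 + 1) = Poly_Mapping.single 0 (1 + (1 + 1))"
      by (simp only: single_add single_one)
    also have "(1 :: 3) + (1 + 1) = 0"
    proof -
      \<comment> \<open>In the type \<open>3\<close> the images of integers are equal when they
        agree modulo 3.\<close>
      have "(of_int 3 :: 3) = of_int 0" by (subst bit1.of_int_eq)+ simp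
      then show ?thesis by simp
    qed
    finally show ?thesis by simp
  qed
  then show ?thesis by (metis kk_class_hom(3,4) kk_class_zero)
qed

text \<open>The monomial ideal generated by the squares of the variables, described by coefficients.
  Membership in \<open>sq_ideal\<close> can thus be refuted by looking at one coefficient.\<close>

definition squarefree_vanishing :: "poly4 set"
  where "squarefree_vanishing =
    {p. \<forall>m. (\<forall>i. Poly_Mapping.lookup m i \<le> 1) \<longrightarrow> Poly_Mapping.lookup p m = 0}"

text \<open>A divisor of a squarefree monomial is squarefree. If \<open>m = l + r\<close> is
  squarefree, so is \<open>l\<close>, and the coefficient of \<open>p\<close> at \<open>l\<close> is
  zero.\<close>

lemma squarefree_vanishing_mult:
  assumes "p \<in> squarefree_vanishing"
  shows "p * q \<in> squarefree_vanishing"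
  unfolding squarefree_vanishing_def
proof (intro CollectI allI impI)
  fix m :: "4 \<Rightarrow>\<^sub>0 nat" assume m: "\<forall>i. Poly_Mapping.lookup m i \<le> 1"
  have "Poly_Mapping.lookup p l * (\<Sum>r. Poly_Mapping.lookup q r when m = l + r) = 0" for l
  proof (cases "\<forall>i. Poly_Mapping.lookup l i \<le> 1")
    case True
    then show ?thesis using assms by (simp add: squarefree_vanishing_def)
  next
    case False
    then obtain i where "\<not> Poly_Mapping.lookup l i \<le> 1" by blast
    then have "m \<noteq> l + r" for r using m[rule_format, of i] by (auto simp: lookup_add)
    then show ?thesis by simp
  qed
  then show "Poly_Mapping.lookup (p * q) m = 0" by (simp add: lookup_mult)
qed

lemma squarefree_vanishing_ideal: "ideal squarefree_vanishing poly4_ring"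
proof -
  interpret cring poly4_ring by (rule poly4_cring)
  have "a_inv poly4_ring p = - p" for p
    by (rule minus_equality) (simp_all add: poly4_simps)
  then have "subgroup squarefree_vanishing (add_monoid poly4_ring)"
    by (intro add.subgroupI) (auto simp: poly4_simps squarefree_vanishing_def lookup_add
        intro!: exI[of _ 0])
  then show ?thesis
    by (intro idealI ring_axioms)
      (auto simp: poly4_simps squarefree_vanishing_mult mult.commute[of _ "_ :: poly4"])
qed

lemma sq_ideal_subset: "sq_ideal \<subseteq> squarefree_vanishing"
proof -
  interpret cring poly4_ring by (rule poly4_cring)
  have "poly_var i ^ 2 \<in> squarefree_vanishing" for i
  proof -
    have "poly_var i ^ 2 = Poly_Mapping.single (Poly_Mapping.single i 2) 1"
      unfolding poly_var_square by (simp add: poly_var_def mult_single numeral_2_eq_2 flip: single_add)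
    moreover have "Poly_Mapping.single i 2 \<noteq> m" if "\<forall>i. Poly_Mapping.lookup m i \<le> 1"
      for m :: "4 \<Rightarrow>\<^sub>0 nat"
      using that[rule_format, of i] by auto
    ultimately show ?thesis by (simp add: squarefree_vanishing_def lookup_single)
  qed
  then show ?thesis
    unfolding sq_ideal_def by (intro genideal_minimal squarefree_vanishing_ideal) auto
qed

text \<open>The product is the class of a monomial in which each variable occurs once. It is
  squarefree with coefficient 1, which \<open>squarefree_vanishing\<close> excludes.\<close>

lemma kk_t_prod_nonzero: "(kk_t 0 \<otimes>\<^bsub>kk\<^esub> (kk_t 1 \<otimes>\<^bsub>kk\<^esub> kk_t 2)) \<otimes>\<^bsub>kk\<^esub> kk_t 3 \<noteq> \<zero>\<^bsub>kk\<^esub>"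
proof
  let ?s = "\<lambda>i :: 4. Poly_Mapping.single i (1 :: nat)"
  define m where "m = ?s 0 + (?s 1 + ?s 2) + ?s 3"
  have p: "(poly_var 0 * (poly_var 1 * poly_var 2)) * poly_var 3 = Poly_Mapping.single m 1"
    by (simp add: poly_var_def mult_single m_def)
  assume "(kk_t 0 \<otimes>\<^bsub>kk\<^esub> (kk_t 1 \<otimes>\<^bsub>kk\<^esub> kk_t 2)) \<otimes>\<^bsub>kk\<^esub> kk_t 3 = \<zero>\<^bsub>kk\<^esub>"
  then have "Poly_Mapping.single m 1 \<in> sq_ideal"
    by (intro kk_class_eq_zero) (simp add: kk_t_eq flip: kk_class_hom(2) p)
  then have "Poly_Mapping.single m 1 \<in> squarefree_vanishing" using sq_ideal_subset by auto
  moreover have "Poly_Mapping.lookup m i \<le> 1" for i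
    using UNIV_4 UNIV_I[of i] by (auto simp: m_def lookup_add lookup_single when_def)
  ultimately have "Poly_Mapping.lookup (Poly_Mapping.single m (1 :: 3)) m = 0"
    unfolding squarefree_vanishing_def by blast
  then show False by simp
qed


section \<open>The example\<close>

definition tau :: "4 \<Rightarrow> poly4 set"
  where "tau = (\<Oplus>\<^bsub>kk4\<^esub> i \<in> UNIV. kk_t i \<odot>\<^bsub>kk4\<^esub> basis_vec kk i)"

lemma kk4_module: "module kk kk4"
  unfolding kk4_def by (rule free_module_module[OF kk_cring])

lemma basis_vec_kk4: "basis_vec kk i \<in> carrier kk4"
  unfolding kk4_def by (rule basis_vec_closed[OF kk_cring]) simp

lemma finsum_UNIV_4:
  assumes "module kk M" "\<And>i. f i \<in> carrier M"
  shows "(\<Oplus>\<^bsub>M\<^esub> i \<in> UNIV. f i) = f (0::4) \<oplus>\<^bsub>M\<^esub> (f 1 \<oplus>\<^bsub>M\<^esub> (f 2 \<oplus>\<^bsub>M\<^esub> f 3))"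
proof -
  interpret M: module kk M by fact
  show ?thesis unfolding UNIV_4 using assms(2) by simp
qed

text \<open>Identifies the relation vector with the row of coefficients in \<open>det_form\<close>,
  so that \<open>det_form_t\<close> applies to it.\<close>

lemma tau_eq: "tau = kk_t"
proof
  interpret kk: cring kk by (rule kk_cring)
  interpret kk4: module kk kk4 by (rule kk4_module)
  fix j :: 4
  have j: "j \<in> {0, 1, 2, 3}" using UNIV_4 by auto
  have s: "tau = kk_t 0 \<odot>\<^bsub>kk4\<^esub> basis_vec kk 0 \<oplus>\<^bsub>kk4\<^esub> (kk_t 1 \<odot>\<^bsub>kk4\<^esub> basis_vec kk 1 \<oplus>\<^bsub>kk4\<^esub>
      (kk_t 2 \<odot>\<^bsub>kk4\<^esub> basis_vec kk 2 \<oplus>\<^bsub>kk4\<^esub> kk_t 3 \<odot>\<^bsub>kk4\<^esub> basis_vec kk 3))"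
    unfolding tau_def by (rule finsum_UNIV_4[OF kk4_module]) (simp add: kk_t_closed basis_vec_kk4)
  show "tau j = kk_t j"
    unfolding s using j by (auto simp: kk4_def free_module_simps basis_vec_def kk_t_closed)
qed

lemma tau_closed: "tau \<in> carrier kk4"
proof -
  interpret kk4: module kk kk4 by (rule kk4_module)
  show ?thesis unfolding tau_def
    by (rule kk4.finsum_closed) (auto simp: kk_t_closed basis_vec_kk4)
qed

lemma M_ex_eq: "M_ex = quot_module kk4 (mod_span kk kk4 {tau})"
  by (simp add: M_ex_def tau_def)

lemma tau_span_submodule: "submodule (mod_span kk kk4 {tau}) kk kk4"
  by (rule mod_span_submodule[OF kk4_module]) (simp add: tau_closed)

lemma M_ex_module: "module kk M_ex"
  unfolding M_ex_eq by (rule quot_module_module[OF kk4_module tau_span_submodule])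

text \<open>In each slot the form is linear and kills \<open>tau\<close>, hence it kills the whole
  span. The three slots are the vanishing assumptions of \<open>alt_multilin_quot\<close>.\<close>

lemma det_form_vanish:
  assumes "n \<in> mod_span kk kk4 {tau}" "b \<in> carrier kk4" "c \<in> carrier kk4"
  shows "det_form kk kk_t [n, b, c] = \<zero>\<^bsub>self_module kk\<^esub>"
    "det_form kk kk_t [b, n, c] = \<zero>\<^bsub>self_module kk\<^esub>"
    "det_form kk kk_t [b, c, n] = \<zero>\<^bsub>self_module kk\<^esub>"
proof -
  interpret kk: cring kk by (rule kk_cring)
  have K: "carrier (self_module kk) = carrier kk" "\<zero>\<^bsub>self_module kk\<^esub> = \<zero>\<^bsub>kk\<^esub>"
    "a \<oplus>\<^bsub>self_module kk\<^esub> b = a \<oplus>\<^bsub>kk\<^esub> b" "a \<odot>\<^bsub>self_module kk\<^esub> b = a \<otimes>\<^bsub>kk\<^esub> b" for a b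
    by (simp_all add: self_module_def)
  have V: "v i \<in> carrier kk" if "v \<in> carrier kk4" for v i
    using that by (simp add: kk4_def free_module_def)
  have lin: "(\<lambda>x. det_form kk kk_t [x, b, c]) \<in> lin_hom kk kk4 (self_module kk)"
    "(\<lambda>x. det_form kk kk_t [b, x, c]) \<in> lin_hom kk kk4 (self_module kk)"
    "(\<lambda>x. det_form kk kk_t [b, c, x]) \<in> lin_hom kk kk4 (self_module kk)"
    by (rule lin_homI; simp add: K V assms(2,3) kk_t_closed kk.det_form_closed kk.det_form_add
        kk.det_form_mult; simp add: kk4_def free_module_simps V[unfolded kk4_def] assms(2,3)[unfolded kk4_def]
        kk_t_closed kk.det_form_closed kk.det_form_add kk.det_form_mult)+
  note v = mod_span_vanish[OF kk4_module self_module_module[OF kk_cring] _ _ _ assms(1)]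
  show "det_form kk kk_t [n, b, c] = \<zero>\<^bsub>self_module kk\<^esub>"
    by (rule v[OF lin(1)]) (simp_all add: tau_closed[unfolded tau_eq] tau_eq K V assms(2,3) kk_t_closed kk.det_form_t)
  show "det_form kk kk_t [b, n, c] = \<zero>\<^bsub>self_module kk\<^esub>"
    by (rule v[OF lin(2)]) (simp_all add: tau_closed[unfolded tau_eq] tau_eq K V assms(2,3) kk_t_closed kk.det_form_t)
  show "det_form kk kk_t [b, c, n] = \<zero>\<^bsub>self_module kk\<^esub>"
    by (rule v[OF lin(3)]) (simp_all add: tau_closed[unfolded tau_eq] tau_eq K V assms(2,3) kk_t_closed kk.det_form_t)
qed

theorem H_CE_g_ex_nontrivial: "carrier (H_CE kk g_ex 3) \<noteq> {\<zero>\<^bsub>H_CE kk g_ex 3\<^esub>}"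
proof -
  interpret kk: cring kk by (rule kk_cring)
  interpret kk4: module kk kk4 by (rule kk4_module)
  interpret M: module kk M_ex by (rule M_ex_module)
  interpret g: lie_algebra kk g_ex unfolding g_ex_def by (rule free_lie_lie_algebra[OF M_ex_module])
  let ?N = "mod_span kk kk4 {tau}" and ?K = "self_module kk"
  let ?e = "\<lambda>i. basis_vec kk i" and ?x = "\<lambda>i. ?N +>\<^bsub>kk4\<^esub> basis_vec kk i"
  let ?t = "kk_t 0 \<otimes>\<^bsub>kk\<^esub> (kk_t 1 \<otimes>\<^bsub>kk\<^esub> kk_t 2)"
  have det: "alt_multilin kk kk4 3 ?K (det_form kk kk_t)"
    unfolding kk4_def by (rule kk.det_form_alt_multilin[OF kk_t_closed])
  obtain F where F: "alt_multilin kk M_ex 3 ?K F"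
    "\<And>a b c. a \<in> carrier kk4 \<Longrightarrow> b \<in> carrier kk4 \<Longrightarrow> c \<in> carrier kk4 \<Longrightarrow>
      F [?N +>\<^bsub>kk4\<^esub> a, ?N +>\<^bsub>kk4\<^esub> b, ?N +>\<^bsub>kk4\<^esub> c] = det_form kk kk_t [a, b, c]"
    by (rule alt_multilin_quot[OF kk4_module tau_span_submodule det det_form_vanish
          self_module_module[OF kk_cring], folded M_ex_eq])
      (assumption | rule that, assumption, simp)+
  have proj: "(\<lambda>v. ?N +>\<^bsub>kk4\<^esub> v) \<in> lin_hom kk kk4 M_ex"
    unfolding M_ex_eq by (rule quot_proj_lin_hom[OF kk4_module tau_span_submodule])
  define h where "h = free_gen kk Inl M_ex"
  have h: "h \<in> lin_hom kk M_ex g_ex"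
    unfolding g_ex_def h_def by (rule free_gen_lin_hom)
  note hp = lin_hom_comp[OF proj h]
  have x: "?x i \<in> carrier M_ex" for i
    by (rule lin_hom_closed[OF proj basis_vec_kk4])
  have t: "?t \<in> carrier kk" by (simp add: kk_t_closed)
  \<comment> \<open>\<open>tau\<close> becomes zero in \<open>M_ex\<close>, hence also in
    \<open>g_ex\<close>. Expanding it by linearity yields the relation between four generators that
    \<open>ce_wedge_diff_3_eq_zero\<close> assumes.\<close>
  have "h (?N +>\<^bsub>kk4\<^esub> tau) = \<zero>\<^bsub>g_ex\<^esub>"
  proof -
    have "?N +>\<^bsub>kk4\<^esub> tau = \<zero>\<^bsub>M_ex\<^esub>"
      using coset_eq_zero_iff[OF kk4_module tau_span_submodule tau_closed]
      by (simp add: M_ex_eq quot_zero mod_span_incl)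
    then show ?thesis using lin_hom_zero[OF M_ex_module g.module_axioms h] by simp
  qed
  moreover have "h (?N +>\<^bsub>kk4\<^esub> tau) = (\<Oplus>\<^bsub>g_ex\<^esub> i \<in> UNIV. h (?N +>\<^bsub>kk4\<^esub> (kk_t i \<odot>\<^bsub>kk4\<^esub> ?e i)))"
    by (rule lin_hom_finsum[OF kk4_module g.module_axioms hp, of UNIV "\<lambda>i. kk_t i \<odot>\<^bsub>kk4\<^esub> ?e i", folded tau_def])
      (auto simp: kk_t_closed basis_vec_kk4)
  moreover have "h (?N +>\<^bsub>kk4\<^esub> (kk_t i \<odot>\<^bsub>kk4\<^esub> ?e i)) = kk_t i \<odot>\<^bsub>g_ex\<^esub> h (?x i)" for i
    by (rule lin_hom_smult[OF hp kk_t_closed basis_vec_kk4])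
  ultimately have rel: "kk_t 0 \<odot>\<^bsub>g_ex\<^esub> h (?x 0) \<oplus>\<^bsub>g_ex\<^esub> (kk_t 1 \<odot>\<^bsub>g_ex\<^esub> h (?x 1) \<oplus>\<^bsub>g_ex\<^esub>
      (kk_t 2 \<odot>\<^bsub>g_ex\<^esub> h (?x 2) \<oplus>\<^bsub>g_ex\<^esub> kk_t 3 \<odot>\<^bsub>g_ex\<^esub> h (?x 3))) = \<zero>\<^bsub>g_ex\<^esub>"
    using finsum_UNIV_4[OF g.module_axioms] by (simp add: kk_t_closed lin_hom_closed[OF h x])
  show ?thesis
    unfolding g_ex_def
  proof (rule H_CE_3_free_lie_nontrivial[OF M_ex_module self_module_module[OF kk_cring] F(1)])
    \<comment> \<open>The coefficient is absorbed into the first entry, so that the cycle is the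
      wedge of a single tuple, as the detection criterion requires.\<close>
    let ?xs = "[?t \<odot>\<^bsub>M_ex\<^esub> ?x 0, ?x 1, ?x 2]"
    show "?xs \<in> tuples M_ex 3" using x t by (simp add: tuples_3)
    have "ce_wedge_diff kk g_ex 3 (map h ?xs) = \<zero>\<^bsub>ext_power kk g_ex 2\<^esub>"
      using g.ce_wedge_diff_3_eq_zero[OF _ _ _ _ kk_t_closed kk_t_closed kk_t_closed kk_t_closed
          kk_t_square kk_t_square kk_t_square kk_t_square kk_char_3 rel]
      by (simp add: lin_hom_smult[OF h t x] lin_hom_closed[OF h x])
    then show "ce_wedge_diff kk (free_lie kk Inl M_ex) 3 (map (free_gen kk Inl M_ex) ?xs) =
        \<zero>\<^bsub>ext_power kk (free_lie kk Inl M_ex) 2\<^esub>"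
      by (simp only: g_ex_def h_def)
    \<comment> \<open>Homogeneity in the first slot takes out the product of three coefficients, and
      the determinant of the remaining basis vectors supplies the fourth.\<close>
    have "F ?xs = ?t \<otimes>\<^bsub>kk\<^esub> det_form kk kk_t [?e 0, ?e 1, ?e 2]"
      using alt_multilin_smult[OF F(1), of "[?x 0, ?x 1, ?x 2]" 0 ?t "?x 0"] x t
      by (simp add: tuples_3 F(2) basis_vec_kk4) (simp add: self_module_def)
    also have "det_form kk kk_t [?e 0, ?e 1, ?e 2] = kk_t 3"
      by (simp add: det_form_def basis_vec_def kk.det4_basis kk_t_closed)
    finally show "F ?xs \<noteq> \<zero>\<^bsub>?K\<^esub>"
      using kk_t_prod_nonzero by (simp add: self_module_def)
  qed (rule inj_Inl)
qed

theorem proposition7p4: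
  shows "carrier (H_CE kk g_ex 3) \<noteq> {\<zero>\<^bsub>H_CE kk g_ex 3\<^esub>} \<and>
    carrier (H_RS kk g_ex 3) = {\<zero>\<^bsub>H_RS kk g_ex 3\<^esub>}"
  using H_CE_g_ex_nontrivial H_RS_free_lie[OF M_ex_module inj_Inl, of 3]
  by (simp add: g_ex_def)

end
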